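(* Let $F$ be a field and let $A$ be a semiassociative $F$-algebra of degree $n$. Then $A$ is $K'$-semiassociative for every $n$-dimensional étale $F$-subalgebra $K' \subseteq \mathfrak{N}(A)$ of the nucleus of $A$.
   Context: Algebras are unital and not necessarily associative. For an $F$-algebra $A$, the associator is $(x,y,z)=(xy)z-x(yz)$, and the nucleus $\mathfrak{N}(A)$ is the set of $x\in A$ with $(x,A,A)=(A,x,A)=(A,A,x)=0$; it is an associative subalgebra. The center is $Z(A)=\{x\in\mathfrak{N}(A) : xa=ax \text{ for all } a\in A\}$, and $A$ is $F$-central if $Z(A)=F$. An étale $F$-algebra is a finite direct product of finite separable field extensions of $F$. A module over an associative ring is minimally faithful if it is faithful and has no faithful proper section (a section is a quotient of submodules); over a commutative semisimple ring this is equivalent to being cyclic and faithful. If $K\subseteq\mathfrak{N}(A)$ is an étale $F$-subalgebra (containing $1_A$), then $A$ is a module over $K\otimes_F K$ via $(k\otimes k')a=kak'$. A finite dimensional $F$-central algebra $A$ is $K$-semiassociative if $K\subseteq\mathfrak{N}(A)$ is an étale $F$-subalgebra and $A$ is minimally faithful as a $K\otimes_F K$-module. $A$ is semiassociative if it is $K$-semiassociative for some such $K$; then $\dim_F A=(\dim_F K)^2$, and the degree of $A$ is $\sqrt{\dim_F A}$. *)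

theory Defs
  imports "HOL-Algebra.Algebraic_Closure_Type" "HOL-Algebra.Module" "HOL-Library.Poly_Mapping"
begin

section \<open>Etale algebras\<close>

text \<open>The base field is a type \<open>'f\<close> of class \<open>field\<close>; \<^const>\<open>ring_of_type_algebra\<close> turns it into a
  record.  Associative \<open>F\<close>-algebras with explicit carrier are records of type
  \<open>('f, 'b) module\<close> (these carry ring operations and a scalar multiplication).\<close>

definition eval_in :: "('f::field, 'b) module \<Rightarrow> 'f poly \<Rightarrow> 'b \<Rightarrow> 'b"
  where "eval_in L p x =
    (\<Oplus>\<^bsub>L\<^esub>i\<in>{..Polynomial.degree p}. Polynomial.coeff p i \<odot>\<^bsub>L\<^esub> (x [^]\<^bsub>L\<^esub> i))"

text \<open>An element is separable iff its minimal polynomial, i.e. the monic irreducible polynomial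
  vanishing at it, is coprime to its derivative.\<close>

definition separable_element :: "('f::field, 'b) module \<Rightarrow> 'b \<Rightarrow> bool"
  where "separable_element L x \<longleftrightarrow>
    (\<exists>p :: 'f poly. Polynomial.lead_coeff p = 1 \<and> Factorial_Ring.irreducible p
        \<and> eval_in L p x = \<zero>\<^bsub>L\<^esub> \<and> coprime p (Polynomial.pderiv p))"

definition finite_separable_extension :: "('f::field, 'b) module \<Rightarrow> bool"
  where "finite_separable_extension L \<longleftrightarrow>
    field L \<and> algebra (ring_of_type_algebra :: 'f ring) L
    \<and> ring.finite_dimension L (range (\<lambda>c::'f. c \<odot>\<^bsub>L\<^esub> \<one>\<^bsub>L\<^esub>)) (carrier L)
    \<and> (\<forall>x\<in>carrier L. separable_element L x)"

definition product_algebra :: "'i set \<Rightarrow> ('i \<Rightarrow> ('f, 'b) module) \<Rightarrow> ('f, 'i \<Rightarrow> 'b) module"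
  where "product_algebra I L =
    \<lparr>carrier = (\<Pi>\<^sub>E i\<in>I. carrier (L i)),
     monoid.mult = (\<lambda>x y. \<lambda>i\<in>I. x i \<otimes>\<^bsub>L i\<^esub> y i),
     one = (\<lambda>i\<in>I. \<one>\<^bsub>L i\<^esub>),
     ring.zero = (\<lambda>i\<in>I. \<zero>\<^bsub>L i\<^esub>),
     add = (\<lambda>x y. \<lambda>i\<in>I. x i \<oplus>\<^bsub>L i\<^esub> y i),
     module.smult = (\<lambda>c x. \<lambda>i\<in>I. c \<odot>\<^bsub>L i\<^esub> x i)\<rparr>"

definition algebra_iso :: "('f, 'b) module \<Rightarrow> ('f, 'c) module \<Rightarrow> ('b \<Rightarrow> 'c) set"
  where "algebra_iso B C =
    {h \<in> ring_iso B C. \<forall>c. \<forall>x\<in>carrier B. h (c \<odot>\<^bsub>B\<^esub> x) = c \<odot>\<^bsub>C\<^esub> h x}"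

text \<open>The factors \<open>L i\<close> are taken on the carrier type \<open>'b\<close> of \<open>K\<close> itself.  This is no
  restriction: each factor embeds into the product and hence can be transported into \<open>K\<close>.\<close>

definition etale_algebra :: "('f::field, 'b) module \<Rightarrow> bool"
  where "etale_algebra K \<longleftrightarrow>
    (\<exists>(r::nat) (L :: nat \<Rightarrow> ('f, 'b) module).
        (\<forall>i<r. finite_separable_extension (L i)) \<and> algebra_iso K (product_algebra {..<r} L) \<noteq> {})"


section \<open>Tensor products of algebras\<close>

text \<open>\<open>B \<otimes>\<^sub>F C\<close> is the free abelian group on \<open>B \<times> C\<close>, with the multiplication
  \<open>(b, c) (b', c') = (b b', c c')\<close>, modulo the biadditive and \<open>F\<close>-balanced relations.  The
  subgroup generated by the relations is closed under multiplication, so it is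
  the ideal they generate.\<close>

definition tensor_free :: "('f, 'b) module \<Rightarrow> ('f, 'c) module \<Rightarrow> ('b \<times> 'c \<Rightarrow>\<^sub>0 int) ring"
  where "tensor_free B C =
    \<lparr>carrier = {p. Poly_Mapping.keys p \<subseteq> carrier B \<times> carrier C},
     monoid.mult = (\<lambda>p q. frag_extend (\<lambda>(b, c). frag_extend (\<lambda>(b', c').
        frag_of (b \<otimes>\<^bsub>B\<^esub> b', c \<otimes>\<^bsub>C\<^esub> c')) q) p),
     one = frag_of (\<one>\<^bsub>B\<^esub>, \<one>\<^bsub>C\<^esub>),
     ring.zero = 0,
     add = (+)\<rparr>"

definition tensor_rels :: "('f, 'b) module \<Rightarrow> ('f, 'c) module \<Rightarrow> ('b \<times> 'c \<Rightarrow>\<^sub>0 int) set"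
  where "tensor_rels B C =
      {frag_of (b \<oplus>\<^bsub>B\<^esub> b', c) - frag_of (b, c) - frag_of (b', c) | b b' c.
          b \<in> carrier B \<and> b' \<in> carrier B \<and> c \<in> carrier C}
    \<union> {frag_of (b, c \<oplus>\<^bsub>C\<^esub> c') - frag_of (b, c) - frag_of (b, c') | b c c'.
          b \<in> carrier B \<and> c \<in> carrier C \<and> c' \<in> carrier C}
    \<union> {frag_of (s \<odot>\<^bsub>B\<^esub> b, c) - frag_of (b, s \<odot>\<^bsub>C\<^esub> c) | s b c.
          b \<in> carrier B \<and> c \<in> carrier C}"

definition tensor_algebra :: "('f, 'b) module \<Rightarrow> ('f, 'c) module \<Rightarrow> ('b \<times> 'c \<Rightarrow>\<^sub>0 int) set ring"
  where "tensor_algebra B C = tensor_free B C Quot (Idl\<^bsub>tensor_free B C\<^esub> (tensor_rels B C))"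


section \<open>Minimally faithful modules\<close>

definition faithful :: "('r, 'k) ring_scheme \<Rightarrow> ('r, 'm) module \<Rightarrow> bool"
  where "faithful R M \<longleftrightarrow>
    (\<forall>r\<in>carrier R. (\<forall>x\<in>carrier M. r \<odot>\<^bsub>M\<^esub> x = \<zero>\<^bsub>M\<^esub>) \<longrightarrow> r = \<zero>\<^bsub>R\<^esub>)"

text \<open>The ring multiplication and unit of a module record play no role for modules.\<close>

definition quotient_module :: "('r, 'm) module \<Rightarrow> 'm set \<Rightarrow> ('r, 'm set) module"
  where "quotient_module M N =
    \<lparr>carrier = a_rcosets\<^bsub>M\<^esub> N,
     monoid.mult = undefined,
     one = undefined,
     ring.zero = N,
     add = set_add M,
     module.smult = (\<lambda>r C. \<Union>x\<in>C. N +>\<^bsub>M\<^esub> (r \<odot>\<^bsub>M\<^esub> x))\<rparr>"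

text \<open>The section \<open>N/N'\<close> is proper unless \<open>N = M\<close> and \<open>N' = 0\<close>.\<close>

definition minimally_faithful :: "('r, 'k) ring_scheme \<Rightarrow> ('r, 'm) module \<Rightarrow> bool"
  where "minimally_faithful R M \<longleftrightarrow>
    faithful R M \<and>
    (\<forall>N N'. submodule N R M \<and> submodule N' R M \<and> N' \<subseteq> N
        \<and> \<not> (N = carrier M \<and> N' = {\<zero>\<^bsub>M\<^esub>})
      \<longrightarrow> \<not> faithful R (quotient_module (M\<lparr>carrier := N\<rparr>) N'))"


section \<open>Nonassociative and semiassociative algebras\<close>

locale nonassoc_algebra = vector_space scale
  for scale :: "'f::field \<Rightarrow> 'a::ab_group_add \<Rightarrow> 'a" (infixr \<open>*s\<close> 75) +
  fixes mul :: "'a \<Rightarrow> 'a \<Rightarrow> 'a" (infixl \<open>\<bullet>\<close> 70)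
    and unit :: 'a (\<open>\<e>\<close>)
  assumes mul_add_left: "(x + y) \<bullet> z = x \<bullet> z + y \<bullet> z"
    and mul_add_right: "x \<bullet> (y + z) = x \<bullet> y + x \<bullet> z"
    and mul_scale_left: "(c *s x) \<bullet> y = c *s (x \<bullet> y)"
    and mul_scale_right: "x \<bullet> (c *s y) = c *s (x \<bullet> y)"
    and unit_left: "\<e> \<bullet> x = x"
    and unit_right: "x \<bullet> \<e> = x"
begin

definition associator :: "'a \<Rightarrow> 'a \<Rightarrow> 'a \<Rightarrow> 'a"
  where "associator x y z = (x \<bullet> y) \<bullet> z - x \<bullet> (y \<bullet> z)"

definition nucleus :: "'a set"
  where "nucleus = {x. \<forall>a b. associator x a b = 0 \<and> associator a x b = 0 \<and> associator a b x = 0}"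

definition center :: "'a set"
  where "center = {x \<in> nucleus. \<forall>a. x \<bullet> a = a \<bullet> x}"

text \<open>\<open>Z(A) = F\<close>, where \<open>F\<close> is identified with \<open>F 1\<close>; in particular \<open>1 \<noteq> 0\<close>.\<close>

definition central :: bool
  where "central \<longleftrightarrow> \<e> \<noteq> 0 \<and> center = range (\<lambda>c. c *s \<e>)"

definition finite_dim :: bool
  where "finite_dim \<longleftrightarrow> (\<exists>B. finite B \<and> span B = UNIV)"

definition subalgebra :: "'a set \<Rightarrow> bool"
  where "subalgebra K \<longleftrightarrow> subspace K \<and> \<e> \<in> K \<and> (\<forall>x\<in>K. \<forall>y\<in>K. x \<bullet> y \<in> K)"

definition algebra_on :: "'a set \<Rightarrow> ('f, 'a) module"
  where "algebra_on K =
    \<lparr>carrier = K, monoid.mult = mul, one = \<e>, ring.zero = 0, add = (+), module.smult = scale\<rparr>"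

definition etale_subalgebra :: "'a set \<Rightarrow> bool"
  where "etale_subalgebra K \<longleftrightarrow> subalgebra K \<and> etale_algebra (algebra_on K)"

text \<open>The action \<open>(k \<otimes> k') a = k a k'\<close> of formal sums of pairs, then of their cosets.  For
  \<open>K \<subseteq> nucleus\<close> the former is constant on each coset, so the image below is a singleton.\<close>

definition formal_act :: "('a \<times> 'a \<Rightarrow>\<^sub>0 int) \<Rightarrow> 'a \<Rightarrow> 'a"
  where "formal_act p a =
    (\<Sum>(k, k')\<in>Poly_Mapping.keys p. of_int (Poly_Mapping.lookup p (k, k')) *s ((k \<bullet> a) \<bullet> k'))"

definition tensor_act :: "('a \<times> 'a \<Rightarrow>\<^sub>0 int) set \<Rightarrow> 'a \<Rightarrow> 'a"
  where "tensor_act T a = the_elem ((\<lambda>p. formal_act p a) ` T)"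

definition bimodule :: "(('a \<times> 'a \<Rightarrow>\<^sub>0 int) set, 'a) module"
  where "bimodule =
    \<lparr>carrier = UNIV, monoid.mult = mul, one = \<e>, ring.zero = 0, add = (+), module.smult = tensor_act\<rparr>"

definition semiassociative_wrt :: "'a set \<Rightarrow> bool"
  where "semiassociative_wrt K \<longleftrightarrow>
    finite_dim \<and> central \<and> K \<subseteq> nucleus \<and> etale_subalgebra K
    \<and> minimally_faithful (tensor_algebra (algebra_on K) (algebra_on K)) bimodule"

definition semiassociative :: bool
  where "semiassociative \<longleftrightarrow> (\<exists>K. semiassociative_wrt K)"

definition alg_degree :: real
  where "alg_degree = sqrt (real (dim UNIV))"

end

end

theory Submission
  imports Defs "HOL-Library.Function_Algebras"
begin

text \<open>Let \<open>\<Omega>\<close> be the algebraic closure of \<open>F\<close>. An etale \<open>K\<close> acts diagonalisably on the space of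
  \<open>F\<close>-linear maps \<open>A \<rightarrow> \<Omega>\<close>, the weights being pairs of algebra homomorphisms \<open>K \<rightarrow> \<Omega>\<close>, and \<open>A\<close> is
  faithful over \<open>K \<otimes> K\<close> as soon as every pair \<open>(\<sigma>, \<tau>)\<close> occurs. If \<open>A\<close> is minimally faithful, then it is
  free of rank one, and the weight spaces are one-dimensional.

  Given another etale \<open>K'\<close> in the nucleus, fix \<open>\<tau>\<close>. If \<open>\<sigma>'\<close> did not occur on the space of right
  weight \<open>\<tau>\<close>, the corresponding idempotent of \<open>K' \<otimes> \<Omega>\<close> would vanish there. But an element of the nucleus
  (over \<open>\<Omega>\<close>) acting as zero on one such column has zero diagonal with respect to the idempotents of \<open>K\<close>,
  and a two-sided ideal of such elements is nilpotent, so it contains no idempotent. The same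
  argument in the opposite algebra replaces \<open>\<tau>\<close> by any \<open>\<tau>'\<close>. Hence \<open>A\<close> is faithful over \<open>K' \<otimes> K'\<close>, and
  minimally so because \<open>dim A = (dim K')\<^sup>2\<close>.\<close>

section \<open>Polynomials in a linear operator\<close>

text \<open>Since A is not associative, its scalar extension to \<Omega> need not be a matrix
  algebra. What remains is a frame of lines: with e_\<sigma> the primitive idempotents of K over
  \<Omega>, every e_\<sigma> A e_\<tau> is one-dimensional. For x in the nucleus, e_\<sigma> x
  e_\<sigma> lies on the line of e_\<sigma>, so it is a scalar, and this scalar can be read off in
  any column in which \<sigma> occurs. This is why vanishing on a single column kills the whole
  diagonal. Off the diagonal, one-dimensionality makes nonzero entries of two operators compose to a
  nonzero entry, so a cycle of entries would produce a diagonal one. An idempotent fixes each vector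
  of its image, and the first component of such a vector in the resulting order would have to come
  from an earlier component. Mixed weights, left for K' and right for K, serve as the intermediate
  stage: left multiplications preserve the right weights of K because K lies in the nucleus.\<close>

locale scalar_space = vector_space scale for scale :: "'a::field \<Rightarrow> 'b::ab_group_add \<Rightarrow> 'b" (infixr \<open>*s\<close> 75)
begin

text \<open>This is p(T) v. \<open>T\<close> is a bare function whose linearity is assumed lemma by
  lemma, so that left multiplications on A and their transposes on functionals are both
  instances.\<close>

definition poly_op :: "'a poly \<Rightarrow> ('b \<Rightarrow> 'b) \<Rightarrow> 'b \<Rightarrow> 'b"
  where "poly_op p T v = (\<Sum>i\<le>Polynomial.degree p. Polynomial.coeff p i *s (T ^^ i) v)"

lemma poly_op_bound:
  fixes p :: "'a poly"
  assumes "Polynomial.degree p \<le> n"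
  shows "poly_op p T v = (\<Sum>i\<le>n. Polynomial.coeff p i *s (T ^^ i) v)"
  unfolding poly_op_def
  by (rule sum.mono_neutral_left) (use assms in \<open>auto simp: coeff_eq_0 not_le\<close>)

lemma poly_op_0 [simp]: "poly_op 0 T v = 0"
  by (simp add: poly_op_def)

lemma linear_zero:
  fixes T :: "'b \<Rightarrow> 'b"
  assumes "\<And>x y. T (x + y) = T x + T y" shows "T 0 = 0"
proof -
  have "T 0 = T 0 + T 0" using assms[of 0 0] unfolding add_0_right .
  then show ?thesis by (simp only: add_cancel_right_right)
qed

lemma linear_sum:
  fixes T :: "'b \<Rightarrow> 'b"
  assumes add: "\<And>x y. T (x + y) = T x + T y"
  shows "T (\<Sum>i\<in>I. f i) = (\<Sum>i\<in>I. T (f i))"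
  by (induction I rule: infinite_finite_induct) (simp_all add: add linear_zero[of T, OF add])

lemma poly_op_pCons:
  fixes p :: "'a poly"
  assumes add: "\<And>x y. T (x + y) = T x + T y" and sc: "\<And>c x. T (c *s x) = c *s T x"
  shows "poly_op (pCons c p) T v = c *s v + T (poly_op p T v)"
proof -
  have "poly_op (pCons c p) T v
      = (\<Sum>i\<le>Suc (Polynomial.degree p). Polynomial.coeff (pCons c p) i *s (T ^^ i) v)"
    by (rule poly_op_bound) (rule degree_pCons_le)
  also have "\<dots> = c *s v + (\<Sum>i\<le>Polynomial.degree p. Polynomial.coeff p i *s (T ^^ Suc i) v)"
    by (subst sum.atMost_Suc_shift) simp
  also have "\<dots> = c *s v + T (poly_op p T v)"
    unfolding poly_op_def by (simp add: linear_sum[of T, OF add] sc)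
  finally show ?thesis .
qed

lemma poly_op_add: "poly_op (p + q) T v = poly_op p T v + poly_op q T v"
proof -
  define n where "n = max (Polynomial.degree p) (Polynomial.degree q)"
  have "Polynomial.degree (p + q) \<le> n" "Polynomial.degree p \<le> n" "Polynomial.degree q \<le> n"
    by (auto simp: n_def degree_add_le_max)
  then show ?thesis
    by (simp add: poly_op_bound[of _ n] scale_left_distrib sum.distrib)
qed

lemma poly_op_smult: "poly_op (Polynomial.smult c p) T v = c *s poly_op p T v"
  by (cases "c = 0") (simp_all add: poly_op_def scale_sum_right)

lemma poly_op_mult:
  assumes add: "\<And>x y. T (x + y) = T x + T y" and sc: "\<And>c x. T (c *s x) = c *s T x"
  shows "poly_op (p * q) T v = poly_op p T (poly_op q T v)"
proof (induction p)
  case 0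
  then show ?case by simp
next
  case (pCons c p)
  have "poly_op (pCons c p * q) T v = c *s poly_op q T v + poly_op (pCons 0 (p * q)) T v"
    by (simp add: mult_pCons_left poly_op_add poly_op_smult)
  also have "poly_op (pCons 0 (p * q)) T v = T (poly_op (p * q) T v)"
    by (simp add: poly_op_pCons[of T, OF add sc])
  finally show ?case
    by (simp add: poly_op_pCons[of T, OF add sc] pCons.IH)
qed

text \<open>Induction on the number of roots: \<open>T - r\<close> maps u to some w killed by the
  remaining factors, and w has a preimage x built from eigenvectors with eigenvalues other than r.
  Then u - x is an eigenvector for r.\<close>

lemma diagonalisable_span:
  assumes add: "\<And>x y. T (x + y) = T x + T y" and sc: "\<And>c x. T (c *s x) = c *s T x"
    and U: "subspace U" and TU: "\<And>u. u \<in> U \<Longrightarrow> T u \<in> U" and "finite R"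
    and "u \<in> U" "poly_op (\<Prod>r\<in>R. [:-r, 1:]) T u = 0"
  shows "u \<in> span {w \<in> U. \<exists>r. T w = r *s w}"
proof -
  \<comment> \<open>Eigenvalues are confined to \<open>R\<close> during the induction, so that none
    of those occurring in w equals the new root r.\<close>
  have "u \<in> span {w \<in> U. \<exists>r\<in>R. T w = r *s w}" using assms(5-7)
  proof (induction R arbitrary: u rule: finite_induct)
    case empty
    then have "u = 0" by (simp add: poly_op_def)
    then show ?case by (simp add: span_zero)
  next
    case (insert r R)
    define w where "w = T u - r *s u"
    have w: "w \<in> U" unfolding w_def using insert.prems U TU by (simp add: subspace_diff subspace_scale)
    have "poly_op [:-r, 1:] T u = w"
      by (simp add: poly_op_pCons[of T, OF add sc] w_def linear_zero[of T, OF add])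
    then have "poly_op (\<Prod>r\<in>R. [:-r, 1:]) T w = 0"
      using insert.prems insert.hyps poly_op_mult[of T "\<Prod>r\<in>R. [:-r, 1:]" "[:-r, 1:]" u, OF add sc]
      by (simp add: mult.commute)
    then have "w \<in> span {w \<in> U. \<exists>r\<in>R. T w = r *s w}" using insert.IH w by blast
    \<comment> \<open>Divide each eigencomponent of \<open>w\<close> by its eigenvalue minus \<open>r\<close>.\<close>
    then have "\<exists>x \<in> span {w \<in> U. \<exists>r\<in>R. T w = r *s w}. T x - r *s x = w"
    proof (induction w rule: span_induct_alt)
      case base
      show ?case by (rule bexI[of _ 0]) (simp_all add: span_zero linear_zero[of T, OF add])
    next
      case (step c y z)
      then obtain s x where s: "s \<in> R" "T y = s *s y" "y \<in> U"
        and x: "x \<in> span {w \<in> U. \<exists>r\<in>R. T w = r *s w}" "T x - r *s x = z" by blast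
      have "s - r \<noteq> 0" using s insert.hyps by auto
      let ?x = "(c / (s - r)) *s y + x"
      have "T ?x - r *s ?x = (c / (s - r)) *s ((s - r) *s y) + z"
        by (simp only: add sc s x(2)[symmetric] scale_left_diff_distrib scale_right_diff_distrib
              scale_right_distrib scale_scale) (simp add: algebra_simps)
      also have "\<dots> = c *s y + z" using \<open>s - r \<noteq> 0\<close> by simp
      finally have "T ?x - r *s ?x = c *s y + z" .
      moreover have "?x \<in> span {w \<in> U. \<exists>r\<in>R. T w = r *s w}"
        using s x(1) by (intro span_add span_scale) (auto intro: span_base)
      ultimately show ?case by blast
    qed
    then obtain x where x: "x \<in> span {w \<in> U. \<exists>r\<in>R. T w = r *s w}" "T x - r *s x = w" by blast
    have "span {w \<in> U. \<exists>r\<in>R. T w = r *s w} \<subseteq> U"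
      by (rule span_minimal) (use U in auto)
    then have "x \<in> U" using x by blast
    have "T (u - x) = r *s (u - x)"
    proof -
      have "T (u - x) = T u - T x" using add[of "u - x" x] by simp
      also have "T u = w + r *s u" by (simp add: w_def)
      also have "T x = w + r *s x" using x(2) by (simp add: diff_eq_eq)
      finally show ?thesis by (simp add: scale_right_diff_distrib)
    qed
    then have "u - x \<in> span {w \<in> U. \<exists>r\<in>insert r R. T w = r *s w}"
      using \<open>x \<in> U\<close> insert.prems U by (intro span_base) (auto simp: subspace_diff)
    moreover have "x \<in> span {w \<in> U. \<exists>r\<in>insert r R. T w = r *s w}"
      by (rule subsetD[OF span_mono x(1)]) auto
    ultimately have "(u - x) + x \<in> span {w \<in> U. \<exists>r\<in>insert r R. T w = r *s w}"
      by (rule span_add)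
    then show ?case by simp
  qed
  then show ?thesis by (rule subsetD[OF span_mono, rotated]) auto
qed

text \<open>A joint eigenspace of the operators treated so far is stable under the next one by
  commutativity, and the next one still satisfies its split polynomial there. So every joint
  eigenvector splits further.\<close>

lemma simultaneously_diagonalisable_span:
  assumes "finite I"
    and add: "\<And>i x y. i \<in> I \<Longrightarrow> T i (x + y) = T i x + T i y"
    and sc: "\<And>i c x. i \<in> I \<Longrightarrow> T i (c *s x) = c *s T i x"
    and comm: "\<And>i j u. i \<in> I \<Longrightarrow> j \<in> I \<Longrightarrow> u \<in> U \<Longrightarrow> T i (T j u) = T j (T i u)"
    and U: "subspace U" and TU: "\<And>i u. i \<in> I \<Longrightarrow> u \<in> U \<Longrightarrow> T i u \<in> U"
    and fin: "\<And>i. i \<in> I \<Longrightarrow> finite (R i)"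
    and poly: "\<And>i u. i \<in> I \<Longrightarrow> u \<in> U \<Longrightarrow> poly_op (\<Prod>r\<in>R i. [:-r, 1:]) (T i) u = 0"
    and "u \<in> U"
  shows "u \<in> span {w \<in> U. \<forall>i\<in>I. \<exists>r. T i w = r *s w}"
proof -
  have "J \<subseteq> I \<Longrightarrow> u \<in> span {w \<in> U. \<forall>i\<in>J. \<exists>r. T i w = r *s w}" if "finite J" for J
    using that
  proof (induction J rule: finite_induct)
    case empty
    then show ?case using \<open>u \<in> U\<close> by (auto intro: span_base)
  next
    case (insert j J)
    have "w \<in> span {w \<in> U. \<forall>i\<in>insert j J. \<exists>r. T i w = r *s w}"
      if w: "w \<in> U" "\<And>i. i \<in> J \<Longrightarrow> \<exists>r. T i w = r *s w" for w
    proof -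
      obtain r where r: "\<And>i. i \<in> J \<Longrightarrow> T i w = r i *s w" using w(2) by metis
      define U' where "U' = {w \<in> U. \<forall>i\<in>J. T i w = r i *s w}"
      have 0: "T i 0 = 0" if "i \<in> I" for i using add[OF that] by (rule linear_zero)
      have U': "subspace U'"
        using U insert.prems unfolding U'_def subspace_def
        by (auto simp: add sc 0 subsetD scale_right_distrib scale_left_commute)
      have "j \<in> I" using insert.prems by simp
      have TU': "T j v \<in> U'" if "v \<in> U'" for v
      proof -
        have "T i (T j v) = r i *s T j v" if "i \<in> J" for i
        proof -
          have "T i (T j v) = T j (T i v)"
            by (rule comm) (use \<open>v \<in> U'\<close> that insert.prems in \<open>auto simp: U'_def\<close>)
          then show ?thesis using that \<open>v \<in> U'\<close> sc[OF \<open>j \<in> I\<close>] by (simp add: U'_def)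
        qed
        then show ?thesis using TU[OF \<open>j \<in> I\<close>] that by (simp add: U'_def)
      qed
      have "w \<in> span {v \<in> U'. \<exists>r. T j v = r *s v}"
        using diagonalisable_span[of "T j" U' "R j" w] add sc U' TU' fin poly w(1) r \<open>j \<in> I\<close>
        by (simp add: U'_def)
      also have "\<dots> \<subseteq> span {w \<in> U. \<forall>i\<in>insert j J. \<exists>r. T i w = r *s w}"
        by (rule span_mono) (auto simp: U'_def)
      finally show ?thesis .
    qed
    then have "span {w \<in> U. \<forall>i\<in>J. \<exists>r. T i w = r *s w}
        \<subseteq> span {w \<in> U. \<forall>i\<in>insert j J. \<exists>r. T i w = r *s w}"
      by (intro span_minimal) auto
    then show ?case using insert by blast
  qed
  from this[OF \<open>finite I\<close>] show ?thesis by simp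
qed

end

section \<open>Separable polynomials\<close>

text \<open>Stated as a Bezout identity, because such an identity passes to the algebraic closure by
  applying \<open>to_ac\<close> to all coefficients.\<close>

definition separable_poly :: "'f::field poly \<Rightarrow> bool"
  where "separable_poly p \<longleftrightarrow> (\<exists>a b. a * p + b * pderiv p = 1)"

text \<open>By division with remainder, a nonzero element of least degree in the ideal
  \<open>J\<close> generated by p and q divides both of them, so it is a unit.\<close>

lemma coprime_imp_bezout:
  fixes p q :: "'f::field poly"
  assumes "coprime p q"
  shows "\<exists>a b. a * p + b * q = 1"
proof -
  define J where "J = {a * p + b * q | a b. True}"
  have J_diff: "x - c * y \<in> J" if xy: "x \<in> J" "y \<in> J" for x y c
  proof -
    obtain a b a' b' where "x = a * p + b * q" "y = a' * p + b' * q"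
      using xy unfolding J_def by blast
    then have "x - c * y = (a - c * a') * p + (b - c * b') * q" by (simp add: algebra_simps)
    then show ?thesis by (auto simp: J_def)
  qed
  have "p = 1 * p + 0 * q" "q = 0 * p + 1 * q" by simp_all
  then have pq: "p \<in> J" "q \<in> J" unfolding J_def by blast+
  have "p \<noteq> 0 \<or> q \<noteq> 0" using assms by auto
  then obtain x where "x \<in> J" "x \<noteq> 0" using pq by blast
  then obtain d where d: "d \<in> J" "d \<noteq> 0"
    and min: "\<And>y. y \<in> J \<Longrightarrow> y \<noteq> 0 \<Longrightarrow> Polynomial.degree d \<le> Polynomial.degree y"
    using exists_least_iff[of "\<lambda>n. \<exists>x. x \<in> J \<and> x \<noteq> 0 \<and> Polynomial.degree x = n"]
    by (metis not_less)
  have dvd: "d dvd y" if "y \<in> J" for y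
  proof -
    have "y mod d \<in> J" using J_diff[OF that d(1), of "y div d"]
      by (metis minus_div_mult_eq_mod)
    then have "y mod d = 0" using min[of "y mod d"] degree_mod_less[OF d(2), of y] by fastforce
    then show ?thesis by (simp add: mod_eq_0_iff_dvd)
  qed
  have "is_unit d" using dvd pq assms by (auto simp: coprime_def)
  then obtain e where "1 = d * e" by (auto elim: dvdE)
  moreover obtain a b where "d = a * p + b * q" using d by (auto simp: J_def)
  ultimately have "(e * a) * p + (e * b) * q = 1" by (simp add: algebra_simps)
  then show ?thesis by blast
qed

lemma separable_poly_mult:
  fixes p q :: "'f::field poly"
  assumes "separable_poly p" "separable_poly q" "c * p + d * q = 1"
  shows "separable_poly (p * q)"
proof -
  obtain a b where ab: "a * p + b * pderiv p = 1" using assms by (auto simp: separable_poly_def)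
  obtain a' b' where ab': "a' * q + b' * pderiv q = 1" using assms by (auto simp: separable_poly_def)
  define D where "D = pderiv (p * q)"
  have D: "D = p * pderiv q + q * pderiv p" by (simp add: D_def pderiv_mult mult.commute)
  define r where "r = a * d * q - b * d * pderiv q"
  define s where "s = a' * c * p - b' * c * pderiv p"
  \<comment> \<open>Modulo p the derivative \<open>D\<close> is q p', and p' is invertible there.
    This puts d q into the ideal (p, D), and likewise c p into (q, D); since c p + d q = 1, both
    ideals contain 1.\<close>
  have B: "d * q = (a * d * q - b * d * pderiv q) * p + (b * d) * D"
  proof -
    have "d * q = d * q * (a * p + b * pderiv p)" by (simp add: ab)
    also have "\<dots> = (a * d * q - b * d * pderiv q) * p + (b * d) * D"
      by (simp add: D algebra_simps)
    finally show ?thesis .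
  qed
  have C: "c * p = (a' * c * p - b' * c * pderiv p) * q + (b' * c) * D"
  proof -
    have "c * p = c * p * (a' * q + b' * pderiv q)" by (simp add: ab')
    also have "\<dots> = (a' * c * p - b' * c * pderiv p) * q + (b' * c) * D"
      by (simp add: D algebra_simps)
    finally show ?thesis .
  qed
  \<comment> \<open>Multiply Bezout relations for \<open>(p, D)\<close> and for \<open>(q, D)\<close>.\<close>
  have p: "(c + r) * p + (b * d) * D = 1"
    using arg_cong[OF B[folded r_def], of "\<lambda>x. c * p + x"] assms(3)
    by (simp only: distrib_right add.assoc)
  have q: "(d + s) * q + (b' * c) * D = 1"
    using arg_cong[OF C[folded s_def], of "\<lambda>x. d * q + x"] assms(3)
    by (simp only: distrib_right add.assoc add.commute[of "d * q" "c * p"])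
  have "((c + r) * (d + s)) * (p * q)
      + ((c + r) * p * (b' * c) + (b * d)) * D
      = (c + r) * p * ((d + s) * q + (b' * c) * D) + (b * d) * D"
    by (simp add: algebra_simps)
  also have "\<dots> = 1" by (simp add: p q)
  finally show ?thesis unfolding separable_poly_def D_def by blast
qed

lemma distinct_monic_irreducible_coprime:
  fixes p q :: "'f::field poly"
  assumes "Factorial_Ring.irreducible p" "Factorial_Ring.irreducible q"
    "Polynomial.lead_coeff p = 1" "Polynomial.lead_coeff q = 1" "p \<noteq> q"
  shows "coprime p q"
proof (rule coprimeI)
  fix c assume c: "c dvd p" "c dvd q"
  show "is_unit c"
  proof (rule ccontr)
    assume "\<not> is_unit c"
    then have "p dvd c" "q dvd c" using c assms irreducibleD' by blast+
    then have "p dvd q" "q dvd p" using c dvd_trans by blast+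
    then obtain k l where k: "q = p * k" and l: "p = q * l" unfolding dvd_def by blast
    have "p \<noteq> 0" using assms(3) by auto
    have "p * (k * l) = p * 1" using k l by (simp only: mult.assoc[symmetric] mult_1_right)
    then have "k * l = 1" using \<open>p \<noteq> 0\<close> mult_cancel_left by blast
    then have "k dvd 1" by (metis dvd_triv_left)
    then obtain u where u: "k = [:u:]" by (auto simp: is_unit_poly_iff)
    have "Polynomial.lead_coeff q = Polynomial.lead_coeff p * Polynomial.lead_coeff k"
      unfolding k by (rule lead_coeff_mult)
    then have "u = 1" using assms u by simp
    then show False using k u assms(5) by simp
  qed
qed

text \<open>The product runs over a set of polynomials: a minimal polynomial shared by several field
  factors is taken only once, which keeps the product free of repeated factors.\<close>

lemma separable_poly_prod:
  fixes P :: "'f::field poly set"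
  assumes "finite P" "\<And>p. p \<in> P \<Longrightarrow> Factorial_Ring.irreducible p"
    "\<And>p. p \<in> P \<Longrightarrow> Polynomial.lead_coeff p = 1" "\<And>p. p \<in> P \<Longrightarrow> coprime p (pderiv p)"
  shows "separable_poly (\<Prod>P)"
  using assms
proof (induction P rule: finite_induct)
  case empty
  show ?case unfolding separable_poly_def by (rule exI[of _ 1], rule exI[of _ 0]) simp
next
  case (insert p P)
  have "finite Q \<Longrightarrow> Q \<subseteq> P \<Longrightarrow> \<exists>c d. c * p + d * \<Prod>Q = 1" for Q
  proof (induction Q rule: finite_induct)
    case empty
    show ?case by (rule exI[of _ 0], rule exI[of _ 1]) simp
  next
    case (insert q Q)
    then obtain c d where cd: "c * p + d * \<Prod>Q = 1" by auto
    have "coprime p q"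
      using insert \<open>p \<notin> P\<close> by (intro distinct_monic_irreducible_coprime insert.prems)
        (auto intro: \<open>\<And>r. r \<in> insert p P \<Longrightarrow> Factorial_Ring.irreducible r\<close>
              \<open>\<And>r. r \<in> insert p P \<Longrightarrow> Polynomial.lead_coeff r = 1\<close>)
    then obtain a b where ab: "a * p + b * q = 1" using coprime_imp_bezout by blast
    have "(a + b * q * c) * p + (b * d) * (q * \<Prod>Q) = a * p + b * q * (c * p + d * \<Prod>Q)"
      by (simp add: algebra_simps)
    then have "(a + b * q * c) * p + (b * d) * \<Prod>(insert q Q) = 1" using insert.hyps cd ab by simp
    then show ?case by blast
  qed
  then obtain c d where "c * p + d * \<Prod>P = 1" using insert.hyps by blast
  moreover have "separable_poly p"
    unfolding separable_poly_def using coprime_imp_bezout insert.prems(3) by blast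
  ultimately have "separable_poly (p * \<Prod>P)"
    using insert by (intro separable_poly_mult) auto
  then show ?case using insert.hyps by simp
qed

section \<open>Splitting over the algebraic closure\<close>

lemma map_poly_to_ac_mult: "map_poly to_ac (p * q) = map_poly to_ac p * map_poly to_ac q"
  by (simp add: poly_eq_iff coeff_map_poly coeff_mult to_ac_sum)

lemma map_poly_to_ac_pderiv: "map_poly to_ac (pderiv p) = pderiv (map_poly to_ac p)"
  by (simp add: poly_eq_iff coeff_map_poly coeff_pderiv)

text \<open>That \<open>R\<close> is a set expresses that all roots are simple: a root x of both p
  and p / (X - x) would be a root of p', and the left side of the Bezout identity would vanish at
  x.\<close>

lemma separable_poly_alg_closed_splits:
  fixes p :: "'k::alg_closed_field poly"
  assumes "separable_poly p"
  shows "\<exists>c R. c \<noteq> 0 \<and> finite R \<and> p = Polynomial.smult c (\<Prod>r\<in>R. [:-r, 1:])"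
  using assms
proof (induction "Polynomial.degree p" arbitrary: p)
  case 0
  then obtain c where c: "p = [:c:]" by (metis degree_0_id)
  with 0 have "c \<noteq> 0" by (auto simp: separable_poly_def)
  then show ?case using c by (intro exI[of _ c] exI[of _ "{}"]) simp
next
  case (Suc n)
  obtain a b where ab: "a * p + b * pderiv p = 1" using Suc by (auto simp: separable_poly_def)
  obtain x where x: "poly p x = 0" using alg_closed_imp_poly_has_root Suc by (metis zero_less_Suc)
  then obtain q where q: "p = [:-x, 1:] * q" by (metis poly_eq_0_iff_dvd dvdE)
  have p': "pderiv p = [:-x, 1:] * pderiv q + q"
    by (simp only: q pderiv_mult) (simp add: pderiv_pCons algebra_simps)
  have "(a * [:-x, 1:] + b) * q + (b * [:-x, 1:]) * pderiv q = 1"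
    using ab unfolding p' unfolding q by (simp only: algebra_simps)
  then have "separable_poly q" unfolding separable_poly_def by blast
  moreover have "q \<noteq> 0" using q Suc by auto
  then have "Polynomial.degree q = n" using q Suc by (simp add: degree_mult_eq del: mult_pCons_left)
  ultimately obtain c R where R: "c \<noteq> 0" "finite R"
    "q = Polynomial.smult c (\<Prod>r\<in>R. [:-r, 1:])" using Suc by blast
  have "poly q x \<noteq> 0"
  proof
    assume "poly q x = 0"
    then have "poly (pderiv p) x = 0" by (simp add: p')
    moreover have "poly (a * p + b * pderiv p) x = 1" by (simp add: ab)
    ultimately show False using x by simp
  qed
  then have "x \<notin> R" using R by (auto simp: poly_prod)
  then show ?case using R q
    by (intro exI[of _ c] exI[of _ "insert x R"]) (simp del: mult_pCons_left)
qed

lemma separable_poly_splits: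
  fixes p :: "'f::field poly"
  assumes "separable_poly p"
  shows "\<exists>c R. c \<noteq> 0 \<and> finite R \<and> map_poly to_ac p = Polynomial.smult c (\<Prod>r\<in>R. [:-r, 1:])"
proof -
  obtain a b where "a * p + b * pderiv p = 1" using assms by (auto simp: separable_poly_def)
  then have "map_poly to_ac (a * p + b * pderiv p) = 1" by (simp add: map_poly_1)
  moreover have "map_poly to_ac (u + v) = map_poly to_ac u + map_poly to_ac v" for u v :: "'f poly"
    by (simp add: poly_eq_iff coeff_map_poly)
  ultimately have "separable_poly (map_poly to_ac p)"
    by (auto simp: separable_poly_def map_poly_to_ac_mult map_poly_to_ac_pderiv)
  then show ?thesis by (rule separable_poly_alg_closed_splits)
qed

section \<open>Weight vectors in the dual space\<close>

sublocale nonassoc_algebra \<subseteq> scalar_space scale ..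

definition fun_scale :: "'k::field \<Rightarrow> ('a \<Rightarrow> 'k) \<Rightarrow> 'a \<Rightarrow> 'k"
  where "fun_scale c \<phi> = (\<lambda>x. c * \<phi> x)"

lemma fun_scale_apply [simp]: "fun_scale c \<phi> x = c * \<phi> x"
  by (simp add: fun_scale_def)

global_interpretation funs: scalar_space fun_scale
  by unfold_locales (simp_all add: fun_eq_iff algebra_simps)

lemma funs_sum_apply: "(\<Sum>i\<in>I. f i) x = (\<Sum>i\<in>I. f i x)"
  for f :: "'i \<Rightarrow> 'a \<Rightarrow> 'k::comm_monoid_add"
  by (induction I rule: infinite_finite_induct) simp_all

context nonassoc_algebra
begin

text \<open>Base change to the algebraic closure is avoided: the \<open>F\<close>-linear maps \<open>A \<rightarrow> F\<^sup>a\<^sup>l\<^sup>g\<close>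
  form the dual of the scalar extension of \<open>A\<close>.\<close>

definition dual :: "('a \<Rightarrow> 'f alg_closure) set"
  where "dual = {\<phi>. (\<forall>x y. \<phi> (x + y) = \<phi> x + \<phi> y) \<and> (\<forall>c x. \<phi> (c *s x) = to_ac c * \<phi> x)}"

text \<open>For a character \<sigma> of an etale K in the nucleus, these are the functionals on
  e_\<sigma> A extended by zero, e_\<sigma> being the idempotent of K over \<Omega> that belongs to
  \<sigma>.\<close>

definition left_weight :: "'a set \<Rightarrow> ('a \<Rightarrow> 'f alg_closure) \<Rightarrow> ('a \<Rightarrow> 'f alg_closure) set"
  where "left_weight K \<sigma> = {\<phi> \<in> dual. \<forall>k\<in>K. \<forall>a. \<phi> (k \<bullet> a) = \<sigma> k * \<phi> a}"

definition right_weight :: "'a set \<Rightarrow> ('a \<Rightarrow> 'f alg_closure) \<Rightarrow> ('a \<Rightarrow> 'f alg_closure) set"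
  where "right_weight K \<tau> = {\<phi> \<in> dual. \<forall>k\<in>K. \<forall>a. \<phi> (a \<bullet> k) = \<tau> k * \<phi> a}"

text \<open>Homomorphisms on \<open>K\<close> are extended by \<open>0\<close>, so that there are only finitely many of them.\<close>

definition chars :: "'a set \<Rightarrow> ('a \<Rightarrow> 'f alg_closure) set"
  where "chars K = {\<sigma>. (\<forall>x\<in>K. \<forall>y\<in>K. \<sigma> (x + y) = \<sigma> x + \<sigma> y) \<and> (\<forall>c. \<forall>x\<in>K. \<sigma> (c *s x) = to_ac c * \<sigma> x)
    \<and> (\<forall>x\<in>K. \<forall>y\<in>K. \<sigma> (x \<bullet> y) = \<sigma> x * \<sigma> y) \<and> \<sigma> \<e> = 1 \<and> (\<forall>x. x \<notin> K \<longrightarrow> \<sigma> x = 0)}"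

lemma dual_add: "\<phi> \<in> dual \<Longrightarrow> \<phi> (x + y) = \<phi> x + \<phi> y"
  and dual_scale: "\<phi> \<in> dual \<Longrightarrow> \<phi> (c *s x) = to_ac c * \<phi> x"
  by (auto simp: dual_def)

lemma dual_0: "\<phi> \<in> dual \<Longrightarrow> \<phi> 0 = 0"
  using dual_scale[of \<phi> 0 0] by simp

lemma dual_sum: "\<phi> \<in> dual \<Longrightarrow> \<phi> (\<Sum>i\<in>I. f i) = (\<Sum>i\<in>I. \<phi> (f i))"
  by (induction I rule: infinite_finite_induct) (simp_all add: dual_0 dual_add)

lemma subspace_dual: "funs.subspace dual"
  unfolding funs.subspace_def by (auto simp: dual_def algebra_simps)

lemma dual_left_mult: "\<phi> \<in> dual \<Longrightarrow> (\<lambda>a. \<phi> (x \<bullet> a)) \<in> dual"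
  by (auto simp: dual_def mul_add_right mul_scale_right)

lemma dual_right_mult: "\<phi> \<in> dual \<Longrightarrow> (\<lambda>a. \<phi> (a \<bullet> x)) \<in> dual"
  by (auto simp: dual_def mul_add_left mul_scale_left)

lemma subspace_left_weight: "funs.subspace (left_weight K \<sigma>)"
  using subspace_dual unfolding funs.subspace_def left_weight_def by (auto simp: algebra_simps)

lemma subspace_right_weight: "funs.subspace (right_weight K \<sigma>)"
  using subspace_dual unfolding funs.subspace_def right_weight_def by (auto simp: algebra_simps)

section \<open>Existence of functionals\<close>

lemma dual_extend_basis:
  assumes "independent B"
  shows "\<exists>\<phi>\<in>dual. \<forall>b\<in>B. \<phi> b = f b"
proof -
  interpret pair: vector_space_pair scale "\<lambda>c (z::'f alg_closure). to_ac c * z"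
    by unfold_locales (auto simp: algebra_simps)
  obtain g where g: "Vector_Spaces.linear scale (\<lambda>c (z::'f alg_closure). to_ac c * z) g"
    "\<forall>b\<in>B. g b = f b"
    using pair.linear_independent_extend[OF assms] by blast
  have "g \<in> dual" using g(1) by (simp add: dual_def pair.linear_add pair.linear_scale)
  then show ?thesis using g(2) by blast
qed

lemma dual_extend:
  assumes S: "subspace S" and add: "\<And>x y. x \<in> S \<Longrightarrow> y \<in> S \<Longrightarrow> f (x + y) = f x + f y"
    and sc: "\<And>c x. x \<in> S \<Longrightarrow> f (c *s x) = to_ac c * f x"
  shows "\<exists>\<phi>\<in>dual. \<forall>x\<in>S. \<phi> x = f x"
proof -
  obtain B where B: "B \<subseteq> S" "independent B" "S \<subseteq> span B"
    using maximal_independent_subset[of S] by blast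
  obtain \<phi> where \<phi>: "\<phi> \<in> dual" "\<forall>b\<in>B. \<phi> b = f b" using dual_extend_basis[OF B(2)] by blast
  have "x \<in> S \<and> \<phi> x = f x" if "x \<in> span B" for x using that
  proof (induction x rule: span_induct_alt)
    case base
    then show ?case using S sc[of 0 0] by (simp add: subspace_0 dual_0 \<phi>)
  next
    case (step c x y)
    then have "x \<in> S" "\<phi> x = f x" using B \<phi> by auto
    then show ?case using step S by (simp add: subspace_add subspace_scale dual_add dual_scale \<phi>(1) add sc)
  qed
  then show ?thesis using B \<phi> by blast
qed

lemma dual_separates:
  assumes N: "subspace N" and "w \<notin> N"
  shows "\<exists>\<phi>\<in>dual. (\<forall>x\<in>N. \<phi> x = 0) \<and> \<phi> w \<noteq> 0"
proof -
  obtain B where B: "B \<subseteq> N" "independent B" "N \<subseteq> span B"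
    using maximal_independent_subset[of N] by blast
  have "span B = N" using B N by (metis span_minimal subset_antisym)
  then have "independent (insert w B)" using B assms(2) by (simp add: independent_insertI)
  then obtain \<phi> where \<phi>: "\<phi> \<in> dual" "\<forall>b\<in>insert w B. \<phi> b = (if b = w then 1 else 0)"
    using dual_extend_basis[of "insert w B" "\<lambda>b. if b = w then 1 else 0"] by blast
  have "\<phi> x = 0" if "x \<in> span B" for x using that
  proof (induction x rule: span_induct_alt)
    case base
    then show ?case by (simp add: dual_0 \<phi>)
  next
    case (step c x y)
    then show ?case using \<phi> B assms(2) by (auto simp: dual_add dual_scale)
  qed
  then show ?thesis using \<phi> B by (intro bexI[of _ \<phi>]) auto
qed

end

text \<open>What etaleness contributes to the argument, without reference to a product decomposition
  and symmetric under passage to the opposite algebra. In \<open>K_separable\<close> the condition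
  p(k) = 0 is written with iterated left multiplication applied to the unit, so no powers have to be
  defined in A.\<close>

locale separable_subalgebra = nonassoc_algebra scale mul unit
  for scale :: "'f::field \<Rightarrow> 'a::ab_group_add \<Rightarrow> 'a" (infixr \<open>*s\<close> 75)
    and mul :: "'a \<Rightarrow> 'a \<Rightarrow> 'a" (infixl \<open>\<bullet>\<close> 70)
    and unit :: 'a (\<open>\<e>\<close>) +
  fixes K :: "'a set"
  assumes fin: "\<exists>B. finite B \<and> span B = UNIV"
    and K_subspace: "subspace K" and K_unit: "\<e> \<in> K"
    and K_mult: "\<And>x y. x \<in> K \<Longrightarrow> y \<in> K \<Longrightarrow> x \<bullet> y \<in> K"
    and K_comm: "\<And>x y. x \<in> K \<Longrightarrow> y \<in> K \<Longrightarrow> x \<bullet> y = y \<bullet> x"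
    and K_left: "\<And>k x y. k \<in> K \<Longrightarrow> (k \<bullet> x) \<bullet> y = k \<bullet> (x \<bullet> y)"
    and K_mid: "\<And>k x y. k \<in> K \<Longrightarrow> (x \<bullet> k) \<bullet> y = x \<bullet> (k \<bullet> y)"
    and K_right: "\<And>k x y. k \<in> K \<Longrightarrow> (x \<bullet> y) \<bullet> k = x \<bullet> (y \<bullet> k)"
    and K_separable: "\<And>k. k \<in> K \<Longrightarrow> \<exists>p. separable_poly p \<and> poly_op p (\<lambda>x. k \<bullet> x) \<e> = 0"
begin

lemma finite_basis: "\<exists>B. finite B \<and> independent B \<and> B \<subseteq> K \<and> span B = K"
proof -
  obtain B where B: "B \<subseteq> K" "independent B" "K \<subseteq> span B"
    using maximal_independent_subset[of K] by blast
  have "finite B" using fin B(2) independent_span_bound by (metis subset_UNIV)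
  then show ?thesis using B K_subspace by (metis span_minimal subset_antisym)
qed

lemma funpow_left_mult:
  assumes "k \<in> K" shows "((\<lambda>x. k \<bullet> x) ^^ i) a = ((\<lambda>x. k \<bullet> x) ^^ i) \<e> \<bullet> a"
  by (induction i) (simp_all add: unit_left K_left assms)

lemma funpow_left_mult_closed:
  assumes "k \<in> K" shows "((\<lambda>x. k \<bullet> x) ^^ i) \<e> \<in> K"
  by (induction i) (simp_all add: K_unit K_mult assms)

lemma mul_0_left: "0 \<bullet> x = 0" using mul_scale_left[of 0 0 x] by simp
lemma mul_0_right: "x \<bullet> 0 = 0" using mul_scale_right[of x 0 0] by simp

lemma mul_sum_left: "(\<Sum>i\<in>I. f i) \<bullet> x = (\<Sum>i\<in>I. f i \<bullet> x)"
  by (induction I rule: infinite_finite_induct) (simp_all add: mul_0_left mul_add_left)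

text \<open>Every statement about right weights is obtained from its left counterpart through this
  symmetry. Powers of k formed from either side agree because K is commutative.\<close>

lemma opposite: "separable_subalgebra scale (\<lambda>x y. y \<bullet> x) \<e> K"
proof -
  interpret opp: nonassoc_algebra scale "\<lambda>x y. y \<bullet> x" \<e>
    by unfold_locales (simp_all add: mul_add_left mul_add_right mul_scale_left mul_scale_right unit_left unit_right)
  have pow: "((\<lambda>x. x \<bullet> k) ^^ i) \<e> = ((\<lambda>x. k \<bullet> x) ^^ i) \<e>" if "k \<in> K" for k i
    by (induction i) (simp_all add: K_comm[OF funpow_left_mult_closed[OF that] that])
  have "\<exists>p. separable_poly p \<and> poly_op p (\<lambda>x. x \<bullet> k) \<e> = 0" if "k \<in> K" for k
    using K_separable[OF that] by (simp add: poly_op_def pow[OF that])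
  then show ?thesis
    by unfold_locales (use fin K_subspace K_unit K_mult K_comm K_left K_mid K_right in simp_all)
qed

lemma opposite_left_weight:
  "nonassoc_algebra.left_weight scale (\<lambda>x y. y \<bullet> x) K \<sigma> = right_weight K \<sigma>"
proof -
  interpret opp: separable_subalgebra scale "\<lambda>x y. y \<bullet> x" \<e> K by (rule opposite)
  show ?thesis by (simp add: opp.left_weight_def right_weight_def)
qed

lemma opposite_right_weight:
  "nonassoc_algebra.right_weight scale (\<lambda>x y. y \<bullet> x) K \<sigma> = left_weight K \<sigma>"
proof -
  interpret opp: separable_subalgebra scale "\<lambda>x y. y \<bullet> x" \<e> K by (rule opposite)
  show ?thesis by (simp add: opp.right_weight_def left_weight_def)
qed

lemma opposite_chars: "nonassoc_algebra.chars scale (\<lambda>x y. y \<bullet> x) \<e> K = chars K"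
proof -
  interpret opp: separable_subalgebra scale "\<lambda>x y. y \<bullet> x" \<e> K by (rule opposite)
  show ?thesis unfolding opp.chars_def chars_def by (intro Collect_cong) (auto simp: mult.commute)
qed

text \<open>As k lies in the nucleus, p(k) = 0 forces p of the left multiplication by k to vanish on
  all of A. Its transpose then satisfies the image of p over \<Omega>, which splits with distinct
  roots, and the leading constant cancels.\<close>

lemma left_mult_annihilated:
  assumes "k \<in> K"
  shows "\<exists>R. finite R \<and> (\<forall>\<phi>\<in>dual. funs.poly_op (\<Prod>r\<in>R. [:-r, 1:]) (\<lambda>\<phi> a. \<phi> (k \<bullet> a)) \<phi> = 0)"
proof -
  obtain p where p: "separable_poly p" "poly_op p (\<lambda>x. k \<bullet> x) \<e> = 0" using K_separable[OF assms] by blast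
  obtain c R where cR: "c \<noteq> 0" "finite R" "map_poly to_ac p = Polynomial.smult c (\<Prod>r\<in>R. [:-r, 1:])"
    using separable_poly_splits[OF p(1)] by blast
  let ?L = "\<lambda>(\<phi> :: 'a \<Rightarrow> 'f alg_closure) a. \<phi> (k \<bullet> a)"
  have pow: "(?L ^^ i) \<phi> = (\<lambda>a. \<phi> (((\<lambda>x. k \<bullet> x) ^^ i) a))" for i \<phi>
  proof (induction i arbitrary: \<phi>)
    case (Suc i)
    show ?case unfolding funpow_Suc_right[of i ?L] o_apply Suc.IH by simp
  qed simp
  have ev: "poly_op p (\<lambda>x. k \<bullet> x) a = 0" for a
  proof -
    have "((\<lambda>x. k \<bullet> x) ^^ i) a = ((\<lambda>x. k \<bullet> x) ^^ i) \<e> \<bullet> a" for i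
      by (rule funpow_left_mult[OF assms])
    then have "poly_op p (\<lambda>x. k \<bullet> x) a = poly_op p (\<lambda>x. k \<bullet> x) \<e> \<bullet> a"
      unfolding poly_op_def mul_sum_left mul_scale_left by (intro sum.cong) simp_all
    then show ?thesis using p(2) mul_0_left by simp
  qed
  have "funs.poly_op (\<Prod>r\<in>R. [:-r, 1:]) ?L \<phi> = 0" if \<phi>: "\<phi> \<in> dual" for \<phi>
  proof -
    have "funs.poly_op (map_poly to_ac p) ?L \<phi> a = \<phi> (poly_op p (\<lambda>x. k \<bullet> x) a)" for a
      unfolding funs.poly_op_def funs_sum_apply pow poly_op_def dual_sum[OF \<phi>] dual_scale[OF \<phi>]
      by (simp add: degree_map_poly coeff_map_poly)
    then have "funs.poly_op (map_poly to_ac p) ?L \<phi> a = 0" for a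
      by (simp only: ev dual_0[OF \<phi>])
    then have "c * funs.poly_op (\<Prod>r\<in>R. [:-r, 1:]) ?L \<phi> a = 0" for a
      unfolding cR(3) funs.poly_op_smult fun_scale_apply .
    then show ?thesis using cR(1) by (intro ext) simp
  qed
  then show ?thesis using cR(2) by blast
qed

text \<open>The transposed multiplications by a basis of K commute and are diagonalisable. On a
  nonzero joint eigenvector w all of K acts by scalars, and evaluating at a point where w does not
  vanish shows that these scalars form a character.\<close>

lemma span_left_weights:
  assumes U: "funs.subspace U" "U \<subseteq> dual" and inv: "\<And>k \<phi>. k \<in> K \<Longrightarrow> \<phi> \<in> U \<Longrightarrow> (\<lambda>a. \<phi> (k \<bullet> a)) \<in> U"
  shows "U \<subseteq> funs.span (\<Union>\<sigma>\<in>chars K. U \<inter> left_weight K \<sigma>)"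
proof
  fix \<phi> assume "\<phi> \<in> U"
  obtain B where B: "finite B" "independent B" "B \<subseteq> K" "span B = K" using finite_basis by blast
  have "\<forall>k\<in>B. \<exists>R. finite R \<and> (\<forall>\<phi>\<in>dual. funs.poly_op (\<Prod>r\<in>R. [:-r, 1:]) (\<lambda>\<phi> a. \<phi> (k \<bullet> a)) \<phi> = 0)"
    using left_mult_annihilated B by blast
  then obtain R where R: "\<And>k. k \<in> B \<Longrightarrow> finite (R k)"
    "\<And>k \<phi>. k \<in> B \<Longrightarrow> \<phi> \<in> dual \<Longrightarrow> funs.poly_op (\<Prod>r\<in>R k. [:-r, 1:]) (\<lambda>\<phi> a. \<phi> (k \<bullet> a)) \<phi> = 0"
    by metis
  define T :: "'a \<Rightarrow> ('a \<Rightarrow> 'f alg_closure) \<Rightarrow> 'a \<Rightarrow> 'f alg_closure"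
    where "T = (\<lambda>k \<phi> a. \<phi> (k \<bullet> a))"
  have comm: "T i (T j u) = T j (T i u)" if "i \<in> B" "j \<in> B" for i j u
  proof -
    have "i \<bullet> (j \<bullet> a) = j \<bullet> (i \<bullet> a)" for a
      using that B by (metis K_comm K_left subsetD)
    then show ?thesis by (simp add: T_def fun_eq_iff)
  qed
  have eigen: "\<phi> \<in> funs.span {w \<in> U. \<forall>i\<in>B. \<exists>r. T i w = fun_scale r w}"
  proof (rule funs.simultaneously_diagonalisable_span[where R = R])
    show "finite B" "funs.subspace U" "\<phi> \<in> U" by fact+
  qed (use comm R U(2) B(3) inv \<open>\<phi> \<in> U\<close> in \<open>auto simp: T_def fun_eq_iff\<close>)
  \<comment> \<open>The zero functional is a joint eigenvector too, but determines no eigenvalues;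
    hence the \<open>insert 0\<close>.\<close>
  have eigen_weight: "{w \<in> U. \<forall>i\<in>B. \<exists>r. T i w = fun_scale r w}
      \<subseteq> insert 0 (\<Union>\<sigma>\<in>chars K. U \<inter> left_weight K \<sigma>)"
  proof
    fix w assume "w \<in> {w \<in> U. \<forall>i\<in>B. \<exists>r. T i w = fun_scale r w}"
    then have w: "w \<in> U" "\<And>i. i \<in> B \<Longrightarrow> \<exists>r. \<forall>a. w (i \<bullet> a) = r * w a" and wd: "w \<in> dual"
      using U by (auto simp: T_def fun_eq_iff)
    have "\<exists>r. \<forall>a. w (k \<bullet> a) = r * w a" if "k \<in> span B" for k using that
    proof (induction k rule: span_induct_alt)
      case base
      show ?case by (rule exI[of _ 0]) (simp add: mul_0_left dual_0 wd)
    next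
      case (step c x y)
      then obtain r s where "\<forall>a. w (x \<bullet> a) = r * w a" "\<forall>a. w (y \<bullet> a) = s * w a" using w by metis
      then show ?case
        by (intro exI[of _ "to_ac c * r + s"])
          (simp add: mul_add_left mul_scale_left dual_add dual_scale wd algebra_simps)
    qed
    then obtain \<sigma> where \<sigma>: "\<And>k a. k \<in> K \<Longrightarrow> w (k \<bullet> a) = \<sigma> k * w a" using B(4) by metis
    show "w \<in> insert 0 (\<Union>\<sigma>\<in>chars K. U \<inter> left_weight K \<sigma>)"
    proof (cases "w = 0")
      case False
      then obtain a where a: "w a \<noteq> 0" by (auto simp: fun_eq_iff)
      define \<tau> where "\<tau> = (\<lambda>k. if k \<in> K then \<sigma> k else 0)"
      have \<tau>: "w (k \<bullet> a) = \<tau> k * w a" if "k \<in> K" for k a using \<sigma> that by (simp add: \<tau>_def)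
      have unique: "\<tau> k = r" if "k \<in> K" "w (k \<bullet> a) = r * w a" for k r
        using \<tau>[OF that(1), of a] that(2) a by simp
      have "\<tau> \<in> chars K"
        unfolding chars_def
      proof (intro CollectI conjI ballI allI impI)
        fix x y assume "x \<in> K" "y \<in> K"
        then show "\<tau> (x + y) = \<tau> x + \<tau> y"
          by (intro unique) (simp_all add: K_subspace subspace_add mul_add_left dual_add wd \<tau> algebra_simps)
        from \<open>x \<in> K\<close> \<open>y \<in> K\<close> show "\<tau> (x \<bullet> y) = \<tau> x * \<tau> y"
          by (intro unique) (simp_all add: K_mult K_left \<tau>)
      next
        fix c x assume "x \<in> K"
        then show "\<tau> (c *s x) = to_ac c * \<tau> x"
          by (intro unique) (simp_all add: K_subspace subspace_scale mul_scale_left dual_scale wd \<tau>)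
      next
        show "\<tau> \<e> = 1" by (intro unique) (simp_all add: K_unit unit_left)
      qed (simp add: \<tau>_def)
      moreover have "w \<in> left_weight K \<tau>" using wd \<tau> by (simp add: left_weight_def)
      ultimately show ?thesis using w by blast
    qed simp
  qed
  have "\<phi> \<in> funs.span (insert 0 (\<Union>\<sigma>\<in>chars K. U \<inter> left_weight K \<sigma>))"
    by (rule subsetD[OF funs.span_mono[OF eigen_weight] eigen])
  then show "\<phi> \<in> funs.span (\<Union>\<sigma>\<in>chars K. U \<inter> left_weight K \<sigma>)"
    by (simp only: funs.span_insert_0)
qed

lemma span_right_weights:
  assumes U: "funs.subspace U" "U \<subseteq> dual" and inv: "\<And>k \<phi>. k \<in> K \<Longrightarrow> \<phi> \<in> U \<Longrightarrow> (\<lambda>a. \<phi> (a \<bullet> k)) \<in> U"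
  shows "U \<subseteq> funs.span (\<Union>\<sigma>\<in>chars K. U \<inter> right_weight K \<sigma>)"
  using separable_subalgebra.span_left_weights[OF opposite U inv]
  by (simp add: opposite_left_weight opposite_chars)

text \<open>Since k (a x) = (k a) x for k in K, right multiplications preserve each left weight
  space, which can therefore be split once more by right weights.\<close>

lemma span_bi_weights:
  assumes U: "funs.subspace U" "U \<subseteq> dual" and left: "\<And>k \<phi>. k \<in> K \<Longrightarrow> \<phi> \<in> U \<Longrightarrow> (\<lambda>a. \<phi> (k \<bullet> a)) \<in> U"
    and right: "\<And>k \<phi>. k \<in> K \<Longrightarrow> \<phi> \<in> U \<Longrightarrow> (\<lambda>a. \<phi> (a \<bullet> k)) \<in> U"
  shows "U \<subseteq> funs.span (\<Union>\<sigma>\<in>chars K. \<Union>\<tau>\<in>chars K. U \<inter> left_weight K \<sigma> \<inter> right_weight K \<tau>)"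
    (is "_ \<subseteq> funs.span ?W")
proof -
  have "U \<inter> left_weight K \<sigma> \<subseteq> funs.span ?W" if "\<sigma> \<in> chars K" for \<sigma>
  proof -
    have inv: "(\<lambda>a. \<phi> (a \<bullet> k)) \<in> U \<inter> left_weight K \<sigma>" if "k \<in> K" "\<phi> \<in> U \<inter> left_weight K \<sigma>" for k \<phi>
      using that right by (auto simp: left_weight_def dual_right_mult K_left)
    have "U \<inter> left_weight K \<sigma> \<subseteq> funs.span (\<Union>\<tau>\<in>chars K. U \<inter> left_weight K \<sigma> \<inter> right_weight K \<tau>)"
      by (rule span_right_weights) (use U inv subspace_left_weight in \<open>auto intro: funs.subspace_inter\<close>)
    also have "\<dots> \<subseteq> funs.span ?W" by (rule funs.span_mono) (use that in auto)
    finally show ?thesis .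
  qed
  then have "funs.span (\<Union>\<sigma>\<in>chars K. U \<inter> left_weight K \<sigma>) \<subseteq> funs.span ?W"
    by (intro funs.span_minimal) auto
  then show ?thesis using span_left_weights[OF U left] by blast
qed

text \<open>A character is determined on a basis, where its value at k is one of finitely many
  roots: a functional extending \<sigma> is, on K, an eigenvector of the transposed multiplication
  by k, and the annihilating polynomial can be evaluated at the unit.\<close>

lemma finite_chars: "finite (chars K)"
proof -
  obtain B where B: "finite B" "independent B" "B \<subseteq> K" "span B = K" using finite_basis by blast
  have "\<forall>k\<in>B. \<exists>R. finite R \<and> (\<forall>\<phi>\<in>dual. funs.poly_op (\<Prod>r\<in>R. [:-r, 1:]) (\<lambda>\<phi> a. \<phi> (k \<bullet> a)) \<phi> = 0)"
    using left_mult_annihilated B by blast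
  then obtain R where R: "\<And>k. k \<in> B \<Longrightarrow> finite (R k)"
    "\<And>k \<phi>. k \<in> B \<Longrightarrow> \<phi> \<in> dual \<Longrightarrow> funs.poly_op (\<Prod>r\<in>R k. [:-r, 1:]) (\<lambda>\<phi> a. \<phi> (k \<bullet> a)) \<phi> = 0"
    by metis
  have "\<sigma> k \<in> R k" if \<sigma>: "\<sigma> \<in> chars K" and k: "k \<in> B" for \<sigma> k
  proof -
    obtain \<phi> where \<phi>: "\<phi> \<in> dual" "\<forall>x\<in>K. \<phi> x = \<sigma> x"
      using dual_extend[OF K_subspace, of \<sigma>] \<sigma> by (auto simp: chars_def)
    have "k \<in> K" using B k by auto
    have pow: "((\<lambda>\<phi> a. \<phi> (k \<bullet> a)) ^^ i) \<phi> x = \<sigma> k ^ i * \<sigma> x" if "x \<in> K" for i x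
      using that
    proof (induction i arbitrary: x)
      case (Suc i)
      then show ?case using \<open>k \<in> K\<close> \<sigma> by (simp add: K_mult chars_def)
    qed (simp add: \<phi>)
    have "0 = funs.poly_op (\<Prod>r\<in>R k. [:-r, 1:]) (\<lambda>\<phi> a. \<phi> (k \<bullet> a)) \<phi> \<e>"
      by (simp add: R k \<phi>)
    also have "\<dots> = poly (\<Prod>r\<in>R k. [:-r, 1:]) (\<sigma> k)"
      using \<sigma> by (simp add: funs.poly_op_def funs_sum_apply pow K_unit poly_altdef chars_def)
    finally show ?thesis using R(1)[OF k] by (auto simp: poly_prod)
  qed
  then have "(\<lambda>\<sigma>. restrict \<sigma> B) ` chars K \<subseteq> Pi\<^sub>E B R" by auto
  then have "finite ((\<lambda>\<sigma>. restrict \<sigma> B) ` chars K)"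
    using B(1) R(1) by (meson finite_PiE finite_subset)
  moreover have "inj_on (\<lambda>\<sigma>. restrict \<sigma> B) (chars K)"
  proof (rule inj_onI, rule ext)
    fix \<sigma> \<tau> x assume \<sigma>: "\<sigma> \<in> chars K" and \<tau>: "\<tau> \<in> chars K" and "restrict \<sigma> B = restrict \<tau> B"
    then have eq: "\<sigma> b = \<tau> b" if "b \<in> B" for b using that by (metis restrict_apply')
    have "x \<in> K \<and> \<sigma> x = \<tau> x" if "x \<in> span B" for x using that
    proof (induction x rule: span_induct_alt)
      case base
      have "\<sigma> (0 *s 0) = 0" "\<tau> (0 *s 0) = 0" using \<sigma> \<tau> subspace_0[OF K_subspace]
        unfolding chars_def by (simp_all del: scale_zero_left scale_zero_right)
      then show ?case using subspace_0[OF K_subspace] by simp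
    next
      case (step c x y)
      then have "x \<in> K" "\<sigma> x = \<tau> x" "c *s x \<in> K" using B eq K_subspace by (auto simp: subspace_scale)
      then show ?case using step \<sigma> \<tau> K_subspace by (simp add: chars_def subspace_add)
    qed
    then show "\<sigma> x = \<tau> x" using \<sigma> \<tau> B(4) by (cases "x \<in> K") (auto simp: chars_def)
  qed
  ultimately show ?thesis by (rule finite_imageD)
qed

text \<open>The characters span all functionals on K: a vector of left weight \<sigma> restricts on
  K to a multiple of \<sigma>, and such vectors span the dual of A. So the relation also holds for
  the coordinate functional of b, where it reads d b = 0.\<close>

lemma chars_separate:
  assumes "finite B" "independent B" "B \<subseteq> K" and zero: "\<And>\<sigma>. \<sigma> \<in> chars K \<Longrightarrow> (\<Sum>b\<in>B. d b * \<sigma> b) = 0"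
    and "b \<in> B"
  shows "d b = 0"
proof -
  obtain \<phi> where \<phi>: "\<phi> \<in> dual" "\<forall>x\<in>B. \<phi> x = (if x = b then 1 else 0)"
    using dual_extend_basis[OF assms(2), of "\<lambda>x. if x = b then 1 else 0"] by blast
  have "dual \<subseteq> funs.span (\<Union>\<sigma>\<in>chars K. dual \<inter> left_weight K \<sigma>)"
    by (rule span_left_weights) (auto simp: subspace_dual dual_left_mult)
  also have "\<dots> \<subseteq> {\<phi>. (\<Sum>b\<in>B. d b * \<phi> b) = 0}"
  proof (rule funs.span_minimal)
    show "funs.subspace {\<phi>. (\<Sum>b\<in>B. d b * \<phi> b) = 0}"
      by (auto simp: funs.subspace_def distrib_left sum.distrib mult.left_commute
            simp flip: sum_distrib_left)
    show "(\<Union>\<sigma>\<in>chars K. dual \<inter> left_weight K \<sigma>) \<subseteq> {\<phi>. (\<Sum>b\<in>B. d b * \<phi> b) = 0}"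
    proof clarify
      fix \<sigma> \<phi> assume \<sigma>: "\<sigma> \<in> chars K" and \<phi>: "\<phi> \<in> left_weight K \<sigma>"
      have "\<phi> b = \<sigma> b * \<phi> \<e>" if "b \<in> B" for b
      proof -
        have "\<phi> (b \<bullet> \<e>) = \<sigma> b * \<phi> \<e>" using that \<phi> assms(3) by (auto simp: left_weight_def)
        then show ?thesis by (simp add: unit_right)
      qed
      then have "(\<Sum>b\<in>B. d b * \<phi> b) = (\<Sum>b\<in>B. d b * \<sigma> b) * \<phi> \<e>"
        by (simp add: sum_distrib_right mult.assoc)
      then show "(\<Sum>b\<in>B. d b * \<phi> b) = 0" using zero[OF \<sigma>] by simp
    qed
  qed
  finally have "(\<Sum>b\<in>B. d b * \<phi> b) = 0" using \<phi> by auto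
  then have "(\<Sum>x\<in>B. if x = b then d x else 0) = 0" using \<phi>(2) by (simp add: if_distrib cong: if_cong)
  then show ?thesis using assms(1,5) by simp
qed

end

section \<open>The tensor square of a separable subalgebra\<close>

context scalar_space
begin

text \<open>The homomorphism on the free abelian group that extends g; the action of formal sums on
  A and their evaluation at a pair of characters are both of this form.\<close>

definition int_sum :: "('c \<Rightarrow> 'b) \<Rightarrow> ('c \<Rightarrow>\<^sub>0 int) \<Rightarrow> 'b"
  where "int_sum g p = (\<Sum>x\<in>Poly_Mapping.keys p. of_int (Poly_Mapping.lookup p x) *s g x)"

lemma int_sum_superset:
  assumes "finite S" "Poly_Mapping.keys p \<subseteq> S"
  shows "int_sum g p = (\<Sum>x\<in>S. of_int (Poly_Mapping.lookup p x) *s g x)"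
  unfolding int_sum_def by (rule sum.mono_neutral_left) (use assms in \<open>auto simp: in_keys_iff\<close>)

lemma int_sum_0 [simp]: "int_sum g 0 = 0"
  by (simp add: int_sum_def)

lemma int_sum_of [simp]: "int_sum g (frag_of x) = g x"
  by (simp add: int_sum_def keys_frag_of)

lemma int_sum_add: "int_sum g (p + q) = int_sum g p + int_sum g q"
proof -
  define S where "S = Poly_Mapping.keys p \<union> Poly_Mapping.keys q"
  have "finite S" "Poly_Mapping.keys p \<subseteq> S" "Poly_Mapping.keys q \<subseteq> S" "Poly_Mapping.keys (p + q) \<subseteq> S"
    using keys_add[of p q] by (auto simp: S_def)
  then show ?thesis
    by (simp add: int_sum_superset[of S] lookup_add scale_left_distrib sum.distrib)
qed

lemma int_sum_diff: "int_sum g (p - q) = int_sum g p - int_sum g q"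
  using int_sum_add[of g "p - q" q] by simp

lemma int_sum_sum: "int_sum g (\<Sum>i\<in>I. f i) = (\<Sum>i\<in>I. int_sum g (f i))"
  by (induction I rule: infinite_finite_induct) (simp_all add: int_sum_add)

end

global_interpretation field_space: scalar_space "(*) :: 'k::field \<Rightarrow> 'k \<Rightarrow> 'k"
  by unfold_locales (simp_all add: algebra_simps)

context separable_subalgebra
begin

abbreviation free_ring where "free_ring \<equiv> tensor_free (algebra_on K) (algebra_on K)"
abbreviation rel_ideal where "rel_ideal \<equiv> Idl\<^bsub>free_ring\<^esub> (tensor_rels (algebra_on K) (algebra_on K))"
abbreviation tensor_square where "tensor_square \<equiv> tensor_algebra (algebra_on K) (algebra_on K)"

definition bi_weight :: "('a \<Rightarrow> 'f alg_closure) \<Rightarrow> ('a \<Rightarrow> 'f alg_closure) \<Rightarrow> ('a \<Rightarrow> 'f alg_closure) set"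
  where "bi_weight \<sigma> \<tau> = left_weight K \<sigma> \<inter> right_weight K \<tau>"

definition tensor_char :: "('a \<Rightarrow> 'f alg_closure) \<Rightarrow> ('a \<Rightarrow> 'f alg_closure) \<Rightarrow> ('a \<times> 'a \<Rightarrow>\<^sub>0 int) \<Rightarrow> 'f alg_closure"
  where "tensor_char \<sigma> \<tau> = field_space.int_sum (\<lambda>(k, k'). \<sigma> k * \<tau> k')"

text \<open>The kernel of the evaluation of formal sums at all pairs of characters. It turns out to
  be the ideal of tensor relations, so that K \<otimes> K embeds into a product of copies of
  \<Omega> and equality in it is tested by characters.\<close>

definition null_sums :: "('a \<times> 'a \<Rightarrow>\<^sub>0 int) set"
  where "null_sums = {p. Poly_Mapping.keys p \<subseteq> K \<times> K \<and> (\<forall>\<sigma>\<in>chars K. \<forall>\<tau>\<in>chars K. tensor_char \<sigma> \<tau> p = 0)}"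

lemma formal_act_int_sum: "formal_act p a = int_sum (\<lambda>(k, k'). (k \<bullet> a) \<bullet> k') p"
  by (simp add: formal_act_def int_sum_def split_def)

lemma formal_act_diff: "formal_act (p - q) a = formal_act p a - formal_act q a"
  and formal_act_add: "formal_act (p + q) a = formal_act p a + formal_act q a"
  and formal_act_of: "formal_act (frag_of (k, k')) a = (k \<bullet> a) \<bullet> k'"
  and formal_act_0: "formal_act 0 a = 0"
  by (simp_all add: formal_act_int_sum int_sum_diff int_sum_add)

lemma tensor_char_diff: "tensor_char \<sigma> \<tau> (p - q) = tensor_char \<sigma> \<tau> p - tensor_char \<sigma> \<tau> q"
  and tensor_char_of: "tensor_char \<sigma> \<tau> (frag_of (k, k')) = \<sigma> k * \<tau> k'"
  by (simp_all add: tensor_char_def field_space.int_sum_diff)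

lemma formal_act_add_right: "formal_act p (a + b) = formal_act p a + formal_act p b"
  by (simp add: formal_act_int_sum int_sum_def split_def mul_add_right mul_add_left scale_right_distrib sum.distrib)

lemma formal_act_closed:
  assumes "subspace N" and "\<And>k a. k \<in> K \<Longrightarrow> a \<in> N \<Longrightarrow> k \<bullet> a \<in> N \<and> a \<bullet> k \<in> N"
    and "Poly_Mapping.keys p \<subseteq> K \<times> K" "a \<in> N"
  shows "formal_act p a \<in> N"
  unfolding formal_act_def split_def
  by (intro subspace_sum subspace_scale assms) (use assms in auto)

lemma bi_weight_formal_act:
  assumes "\<phi> \<in> bi_weight \<sigma> \<tau>" "Poly_Mapping.keys p \<subseteq> K \<times> K"
  shows "\<phi> (formal_act p a) = tensor_char \<sigma> \<tau> p * \<phi> a"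
  using assms(2)
proof (induction p rule: frag_induction)
  case zero
  then show ?case using assms by (simp add: formal_act_0 tensor_char_def dual_0 bi_weight_def left_weight_def)
next
  case (one x)
  then show ?case
    using assms by (cases x) (auto simp: formal_act_of tensor_char_of bi_weight_def left_weight_def right_weight_def)
next
  case (diff p q)
  have "\<phi> \<in> dual" using assms by (simp add: bi_weight_def left_weight_def)
  have "\<phi> (x - y) = \<phi> x - \<phi> y" for x y using dual_add[OF \<open>\<phi> \<in> dual\<close>, of "x - y" y] by simp
  then show ?case using diff by (simp add: formal_act_diff tensor_char_diff left_diff_distrib)
qed

lemma span_bi_weight:
  assumes U: "funs.subspace U" "U \<subseteq> dual" and left: "\<And>k \<phi>. k \<in> K \<Longrightarrow> \<phi> \<in> U \<Longrightarrow> (\<lambda>a. \<phi> (k \<bullet> a)) \<in> U"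
    and right: "\<And>k \<phi>. k \<in> K \<Longrightarrow> \<phi> \<in> U \<Longrightarrow> (\<lambda>a. \<phi> (a \<bullet> k)) \<in> U"
  shows "U \<subseteq> funs.span (\<Union>\<sigma>\<in>chars K. \<Union>\<tau>\<in>chars K. U \<inter> bi_weight \<sigma> \<tau>)"
  using span_bi_weights[OF assms] by (simp add: bi_weight_def Int_assoc)

text \<open>The functionals vanishing on N are stable under both multiplications, so they are
  spanned by weight vectors. If all of those killed w, every functional vanishing on N
  would.\<close>

lemma bi_weight_separates:
  assumes N: "subspace N" and inv: "\<And>k a. k \<in> K \<Longrightarrow> a \<in> N \<Longrightarrow> k \<bullet> a \<in> N \<and> a \<bullet> k \<in> N" and "w \<notin> N"
  shows "\<exists>\<sigma>\<in>chars K. \<exists>\<tau>\<in>chars K. \<exists>\<phi>\<in>bi_weight \<sigma> \<tau>. (\<forall>x\<in>N. \<phi> x = 0) \<and> \<phi> w \<noteq> 0"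
proof (rule ccontr)
  assume none: "\<not> ?thesis"
  define U where "U = {\<phi> \<in> dual. \<forall>x\<in>N. \<phi> x = 0}"
  have "U \<subseteq> funs.span (\<Union>\<sigma>\<in>chars K. \<Union>\<tau>\<in>chars K. U \<inter> bi_weight \<sigma> \<tau>)"
  proof (rule span_bi_weight)
    show "funs.subspace U" using subspace_dual unfolding U_def funs.subspace_def by auto
  qed (auto simp: U_def dual_left_mult dual_right_mult inv)
  also have "\<dots> \<subseteq> {\<phi>. \<phi> w = 0}"
    by (rule funs.span_minimal) (use none in \<open>auto simp: U_def funs.subspace_def\<close>)
  finally show False using dual_separates[OF N \<open>w \<notin> N\<close>] by (auto simp: U_def)
qed

text \<open>This makes the action well defined on cosets: a weight vector not vanishing at p a would
  have a weight at which p is nonzero.\<close>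

lemma null_sums_act:
  assumes "p \<in> null_sums" shows "formal_act p a = 0"
proof (rule ccontr)
  assume "formal_act p a \<noteq> 0"
  then obtain \<sigma> \<tau> \<phi> where "\<sigma> \<in> chars K" "\<tau> \<in> chars K" "\<phi> \<in> bi_weight \<sigma> \<tau>" "\<phi> (formal_act p a) \<noteq> 0"
    using bi_weight_separates[of "{0}" "formal_act p a"] by (auto simp: mul_0_left mul_0_right)
  then show False using assms by (simp add: bi_weight_formal_act null_sums_def)
qed

section \<open>The ring of formal sums and its ideal of relations\<close>

lemma free_ring_simps:
  "carrier free_ring = {p. Poly_Mapping.keys p \<subseteq> K \<times> K}"
  "x \<oplus>\<^bsub>free_ring\<^esub> y = x + y"
  "\<zero>\<^bsub>free_ring\<^esub> = 0"
  "\<one>\<^bsub>free_ring\<^esub> = frag_of (\<e>, \<e>)"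
  by (simp_all add: tensor_free_def algebra_on_def)

lemma free_ring_mult_of: "frag_of (b, c) \<otimes>\<^bsub>free_ring\<^esub> frag_of (b', c') = frag_of (b \<bullet> b', c \<bullet> c')"
  by (simp add: tensor_free_def algebra_on_def)

lemma free_ring_mult_0: "0 \<otimes>\<^bsub>free_ring\<^esub> p = 0" "p \<otimes>\<^bsub>free_ring\<^esub> 0 = 0"
  by (simp_all add: tensor_free_def frag_extend_def split_def)

lemma free_ring_mult_diff_left:
  "(p - p') \<otimes>\<^bsub>free_ring\<^esub> q = p \<otimes>\<^bsub>free_ring\<^esub> q - p' \<otimes>\<^bsub>free_ring\<^esub> q"
  by (simp add: tensor_free_def frag_extend_diff)

lemma free_ring_mult_diff_right:
  "p \<otimes>\<^bsub>free_ring\<^esub> (q - q') = p \<otimes>\<^bsub>free_ring\<^esub> q - p \<otimes>\<^bsub>free_ring\<^esub> q'"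
proof -
  have "Poly_Mapping.keys p \<subseteq> UNIV" by simp
  then show ?thesis
  proof (induction p rule: frag_induction)
    case zero
    show ?case by (simp add: free_ring_mult_0)
  next
    case (one x)
    show ?case by (cases x) (simp add: tensor_free_def frag_extend_diff)
  next
    case (diff a b)
    then show ?case by (simp add: free_ring_mult_diff_left)
  qed
qed

lemma free_ring_mult_closed:
  assumes "Poly_Mapping.keys p \<subseteq> K \<times> K" "Poly_Mapping.keys q \<subseteq> K \<times> K"
  shows "Poly_Mapping.keys (p \<otimes>\<^bsub>free_ring\<^esub> q) \<subseteq> K \<times> K"
  using assms(1)
proof (induction p rule: frag_induction)
  case zero
  show ?case by (simp add: free_ring_mult_0)
next
  case (one x)
  from assms(2) show ?case
  proof (induction q rule: frag_induction)
    case zero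
    show ?case by (simp add: free_ring_mult_0)
  next
    case (one y)
    then show ?case using \<open>x \<in> K \<times> K\<close>
      by (cases x, cases y) (auto simp: free_ring_mult_of keys_frag_of K_mult)
  next
    case (diff a b)
    then show ?case using keys_diff by (fastforce simp: free_ring_mult_diff_right)
  qed
next
  case (diff a b)
  then show ?case using keys_diff by (fastforce simp: free_ring_mult_diff_left)
qed

lemma free_ring_mult_assoc:
  assumes "Poly_Mapping.keys p \<subseteq> K \<times> K" "Poly_Mapping.keys q \<subseteq> K \<times> K" "Poly_Mapping.keys r \<subseteq> K \<times> K"
  shows "(p \<otimes>\<^bsub>free_ring\<^esub> q) \<otimes>\<^bsub>free_ring\<^esub> r = p \<otimes>\<^bsub>free_ring\<^esub> (q \<otimes>\<^bsub>free_ring\<^esub> r)"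
  using assms(1)
proof (induction p rule: frag_induction)
  case (one x)
  from assms(2) show ?case
  proof (induction q rule: frag_induction)
    case (one y)
    from assms(3) show ?case
    proof (induction r rule: frag_induction)
      case (one z)
      then show ?case using \<open>x \<in> K \<times> K\<close> \<open>y \<in> K \<times> K\<close>
        by (cases x, cases y, cases z) (simp add: free_ring_mult_of K_left)
    qed (simp_all add: free_ring_mult_0 free_ring_mult_diff_right)
  qed (simp_all add: free_ring_mult_0 free_ring_mult_diff_right free_ring_mult_diff_left)
qed (simp_all add: free_ring_mult_0 free_ring_mult_diff_left)

lemma free_ring_mult_one:
  assumes "Poly_Mapping.keys p \<subseteq> K \<times> K"
  shows "frag_of (\<e>, \<e>) \<otimes>\<^bsub>free_ring\<^esub> p = p \<and> p \<otimes>\<^bsub>free_ring\<^esub> frag_of (\<e>, \<e>) = p"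
  using assms
proof (induction p rule: frag_induction)
  case (one x)
  then show ?case by (cases x) (simp add: free_ring_mult_of unit_left unit_right)
qed (simp_all add: free_ring_mult_0 free_ring_mult_diff_right free_ring_mult_diff_left)

lemma ring_free_ring: "ring free_ring"
proof (rule ringI)
  show "abelian_group free_ring"
  proof (rule abelian_groupI)
    fix x y z assume xyz: "x \<in> carrier free_ring" "y \<in> carrier free_ring" "z \<in> carrier free_ring"
    then show "x \<oplus>\<^bsub>free_ring\<^esub> y \<in> carrier free_ring"
      using keys_add[of x y] by (auto simp: free_ring_simps)
    show "\<exists>y\<in>carrier free_ring. y \<oplus>\<^bsub>free_ring\<^esub> x = \<zero>\<^bsub>free_ring\<^esub>"
      by (rule bexI[of _ "- x"]) (use xyz in \<open>auto simp: free_ring_simps\<close>)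
  qed (auto simp: free_ring_simps algebra_simps)
  show "Group.monoid free_ring"
    by (rule monoidI) (use free_ring_mult_closed free_ring_mult_assoc free_ring_mult_one K_unit
        in \<open>auto simp: free_ring_simps keys_frag_of\<close>)
next
  fix x y z
  show "(x \<oplus>\<^bsub>free_ring\<^esub> y) \<otimes>\<^bsub>free_ring\<^esub> z = x \<otimes>\<^bsub>free_ring\<^esub> z \<oplus>\<^bsub>free_ring\<^esub> y \<otimes>\<^bsub>free_ring\<^esub> z"
    using free_ring_mult_diff_left[of "x + y" y z] by (simp add: free_ring_simps)
  show "z \<otimes>\<^bsub>free_ring\<^esub> (x \<oplus>\<^bsub>free_ring\<^esub> y) = z \<otimes>\<^bsub>free_ring\<^esub> x \<oplus>\<^bsub>free_ring\<^esub> z \<otimes>\<^bsub>free_ring\<^esub> y"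
    using free_ring_mult_diff_right[of z "x + y" y] by (simp add: free_ring_simps)
qed

lemma free_ring_uminus:
  assumes "Poly_Mapping.keys p \<subseteq> K \<times> K" shows "\<ominus>\<^bsub>free_ring\<^esub> p = - p"
proof -
  interpret abelian_group free_ring using ring_free_ring by (rule ring.is_abelian_group)
  show ?thesis by (rule minus_equality) (use assms in \<open>auto simp: free_ring_simps\<close>)
qed

lemma tensor_char_mult:
  assumes "\<sigma> \<in> chars K" "\<tau> \<in> chars K" "Poly_Mapping.keys p \<subseteq> K \<times> K" "Poly_Mapping.keys q \<subseteq> K \<times> K"
  shows "tensor_char \<sigma> \<tau> (p \<otimes>\<^bsub>free_ring\<^esub> q) = tensor_char \<sigma> \<tau> p * tensor_char \<sigma> \<tau> q"
  using assms(3)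
proof (induction p rule: frag_induction)
  case (one x)
  from assms(4) show ?case
  proof (induction q rule: frag_induction)
    case (one y)
    then show ?case using \<open>x \<in> K \<times> K\<close> assms(1,2)
      by (cases x, cases y) (simp add: free_ring_mult_of tensor_char_of chars_def)
  qed (simp_all add: free_ring_mult_0 free_ring_mult_diff_right tensor_char_diff algebra_simps
      tensor_char_def[of _ _ ] field_space.int_sum_diff)
qed (simp_all add: free_ring_mult_0 free_ring_mult_diff_left tensor_char_def field_space.int_sum_diff
      algebra_simps)

lemma tensor_rels_carrier: "tensor_rels (algebra_on K) (algebra_on K) \<subseteq> carrier free_ring"
proof
  fix p assume "p \<in> tensor_rels (algebra_on K) (algebra_on K)"
  then have "\<exists>x y z. p = frag_of x - frag_of y - frag_of z \<and> {x, y, z} \<subseteq> K \<times> K \<or>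
      p = frag_of x - frag_of y \<and> {x, y} \<subseteq> K \<times> K"
    unfolding tensor_rels_def algebra_on_def using K_subspace subspace_add subspace_scale
    by simp blast
  moreover have "Poly_Mapping.keys (q - r) \<subseteq> K \<times> K"
    if "Poly_Mapping.keys q \<subseteq> K \<times> K" "Poly_Mapping.keys r \<subseteq> K \<times> K" for q r :: "'a \<times> 'a \<Rightarrow>\<^sub>0 int"
    using keys_diff[of q r] that by blast
  ultimately show "p \<in> carrier free_ring"
    by (elim exE disjE conjE) (simp_all add: free_ring_simps keys_frag_of)
qed

text \<open>Evaluation at a pair of characters is multiplicative and bilinear, so its kernel is an
  ideal containing the relations.\<close>

lemma rel_ideal_subset_null_sums: "rel_ideal \<subseteq> null_sums"
proof -
  interpret abelian_group free_ring using ring_free_ring by (rule ring.is_abelian_group)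
  have keys: "Poly_Mapping.keys p \<subseteq> K \<times> K" if "p \<in> tensor_rels (algebra_on K) (algebra_on K)" for p
    using that tensor_rels_carrier by (auto simp: free_ring_simps)
  have "ideal null_sums free_ring"
  proof (rule idealI)
    show "ring free_ring" by (rule ring_free_ring)
    show "subgroup null_sums (add_monoid free_ring)"
    proof (rule add.subgroupI)
      show "null_sums \<subseteq> carrier free_ring" by (auto simp: null_sums_def free_ring_simps)
      have "0 \<in> null_sums" by (simp add: null_sums_def tensor_char_def)
      then show "null_sums \<noteq> {}" by blast
    next
      fix a b assume "a \<in> null_sums" "b \<in> null_sums"
      then show "a \<oplus>\<^bsub>free_ring\<^esub> b \<in> null_sums"
        using keys_add[of a b] by (auto simp: free_ring_simps null_sums_def tensor_char_def field_space.int_sum_add)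
      have "tensor_char \<sigma> \<tau> (0 - a) = - tensor_char \<sigma> \<tau> a" for \<sigma> \<tau>
        unfolding tensor_char_diff by (simp add: tensor_char_def)
      with \<open>a \<in> null_sums\<close> show "\<ominus>\<^bsub>free_ring\<^esub> a \<in> null_sums"
        by (auto simp: free_ring_uminus null_sums_def)
    qed
  next
    fix a x assume "a \<in> null_sums" "x \<in> carrier free_ring"
    then show "x \<otimes>\<^bsub>free_ring\<^esub> a \<in> null_sums" "a \<otimes>\<^bsub>free_ring\<^esub> x \<in> null_sums"
      by (simp_all add: null_sums_def free_ring_simps tensor_char_mult free_ring_mult_closed)
  qed
  moreover have "tensor_rels (algebra_on K) (algebra_on K) \<subseteq> null_sums"
  proof
    fix p assume p: "p \<in> tensor_rels (algebra_on K) (algebra_on K)"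
    have "tensor_char \<sigma> \<tau> p = 0" if "\<sigma> \<in> chars K" "\<tau> \<in> chars K" for \<sigma> \<tau>
    proof -
      have add: "\<sigma> (x + y) = \<sigma> x + \<sigma> y" "\<tau> (x + y) = \<tau> x + \<tau> y"
        and scale: "\<sigma> (c *s x) = to_ac c * \<sigma> x" "\<tau> (c *s x) = to_ac c * \<tau> x"
        if "x \<in> K" "y \<in> K" for c x y
        using \<open>\<sigma> \<in> chars K\<close> \<open>\<tau> \<in> chars K\<close> that by (simp_all add: chars_def)
      from p show ?thesis
        unfolding tensor_rels_def Un_iff mem_Collect_eq algebra_on_def
        by (elim disjE exE conjE; hypsubst)
          (simp_all add: tensor_char_diff tensor_char_of add scale distrib_left distrib_right)
    qed
    then show "p \<in> null_sums" using keys[OF p] by (simp add: null_sums_def)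
  qed
  ultimately show ?thesis by (rule ring.genideal_minimal[OF ring_free_ring])
qed

text \<open>A representative of the general element of K \<otimes> K in a basis. Formal sums have
  only integer coefficients, so the scalars are absorbed into the first factor.\<close>

definition basis_sum :: "'a set \<Rightarrow> ('a \<times> 'a \<Rightarrow> 'f) \<Rightarrow> ('a \<times> 'a \<Rightarrow>\<^sub>0 int)"
  where "basis_sum B c = (\<Sum>x\<in>B \<times> B. frag_of (c x *s fst x, snd x))"

text \<open>Separation by characters is applied twice: to the first factor with \<tau> fixed, then
  to the second.\<close>

lemma basis_sum_in_null_sums:
  assumes B: "finite B" "independent B" "B \<subseteq> K" and null: "basis_sum B c \<in> null_sums"
    and b: "b \<in> B" "b' \<in> B"
  shows "c (b, b') = 0"
proof -
  have zero: "(\<Sum>b\<in>B. (\<Sum>b'\<in>B. to_ac (c (b, b')) * \<tau> b') * \<sigma> b) = 0"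
    if \<sigma>: "\<sigma> \<in> chars K" and \<tau>: "\<tau> \<in> chars K" for \<sigma> \<tau>
  proof -
    have "0 = tensor_char \<sigma> \<tau> (basis_sum B c)" using null \<sigma> \<tau> by (simp add: null_sums_def)
    also have "\<dots> = (\<Sum>(b, b')\<in>B \<times> B. to_ac (c (b, b')) * \<tau> b' * \<sigma> b)"
      unfolding basis_sum_def tensor_char_def field_space.int_sum_sum
      by (rule sum.cong) (use \<sigma> B in \<open>auto simp: chars_def\<close>)
    also have "\<dots> = (\<Sum>b\<in>B. (\<Sum>b'\<in>B. to_ac (c (b, b')) * \<tau> b') * \<sigma> b)"
      by (simp add: sum.cartesian_product[symmetric] sum_distrib_right)
    finally show ?thesis by simp
  qed
  have "(\<Sum>b'\<in>B. to_ac (c (b, b')) * \<tau> b') = 0" if "\<tau> \<in> chars K" for \<tau>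
    using chars_separate[OF B, where d = "\<lambda>b. \<Sum>b'\<in>B. to_ac (c (b, b')) * \<tau> b'"] zero that b by blast
  then have "to_ac (c (b, b')) = 0"
    using chars_separate[OF B, where d = "\<lambda>b'. to_ac (c (b, b'))"] b by blast
  then show ?thesis by simp
qed

text \<open>The second conjunct has content: with zero coefficients the formal sum still consists of
  pairs (0, b'), which are only congruent to 0.\<close>

lemma basis_expansion:
  assumes B: "finite B" "B \<subseteq> K" "span B = K" and p: "Poly_Mapping.keys p \<subseteq> K \<times> K"
  shows "(\<exists>c. p - basis_sum B c \<in> rel_ideal) \<and> basis_sum B (\<lambda>x. 0) \<in> rel_ideal"
proof -
  interpret J: additive_subgroup rel_ideal free_ring
    by (rule ideal.axioms(1)) (rule ring.genideal_ideal[OF ring_free_ring tensor_rels_carrier])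
  interpret abelian_group free_ring using ring_free_ring by (rule ring.is_abelian_group)
  let ?J = rel_ideal
  have J_keys: "q \<in> ?J \<Longrightarrow> Poly_Mapping.keys q \<subseteq> K \<times> K" for q
    using J.a_subset by (auto simp: free_ring_simps)
  have J_add: "q + r \<in> ?J" if "q \<in> ?J" "r \<in> ?J" for q r
    using J.a_closed[OF that] by (simp add: free_ring_simps)
  have J_uminus: "- q \<in> ?J" if "q \<in> ?J" for q
    using J.a_inv_closed[OF that] J_keys[OF that] by (simp add: free_ring_uminus)
  have J_diff: "q - r \<in> ?J" if "q \<in> ?J" "r \<in> ?J" for q r
    using J_add[OF that(1) J_uminus[OF that(2)]] by simp
  have J_0: "0 \<in> ?J" using J.zero_closed by (simp add: free_ring_simps)
  have J_sum: "(\<Sum>i\<in>I. f i) \<in> ?J" if "\<And>i. i \<in> I \<Longrightarrow> f i \<in> ?J" for I and f :: "'a \<times> 'a \<Rightarrow> _"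
    using that by (induction I rule: infinite_finite_induct) (auto intro: J_0 J_add)
  have rel: "q \<in> tensor_rels (algebra_on K) (algebra_on K) \<Longrightarrow> q \<in> ?J" for q
    using ring.genideal_self[OF ring_free_ring tensor_rels_carrier] by blast
  have rel_left: "frag_of (x + y, z) - frag_of (x, z) - frag_of (y, z) \<in> ?J"
    if "x \<in> K" "y \<in> K" "z \<in> K" for x y z
    by (rule rel) (use that in \<open>auto simp: tensor_rels_def algebra_on_def\<close>)
  have rel_right: "frag_of (z, x + y) - frag_of (z, x) - frag_of (z, y) \<in> ?J"
    if "x \<in> K" "y \<in> K" "z \<in> K" for x y z
    by (rule rel) (use that in \<open>auto simp: tensor_rels_def algebra_on_def\<close>)
  have rel_scale: "frag_of (c *s x, y) - frag_of (x, c *s y) \<in> ?J" if "x \<in> K" "y \<in> K" for c x y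
    by (rule rel) (use that in \<open>auto simp: tensor_rels_def algebra_on_def\<close>)
  \<comment> \<open>The additivity relation for 0 + 0 is the negative of the pair (0, z).\<close>
  have zero_left: "frag_of (0, z) \<in> ?J" if "z \<in> K" for z
    using J_uminus[OF rel_left[of 0 0 z]] that subspace_0[OF K_subspace] by simp
  have zero_right: "frag_of (z, 0) \<in> ?J" if "z \<in> K" for z
    using J_uminus[OF rel_right[of 0 0 z]] that subspace_0[OF K_subspace] by simp
  note N_def = basis_sum_def[of B]
  let ?N = "basis_sum B"
  have N_diff: "(?N c - ?N d) - ?N (\<lambda>x. c x - d x) \<in> ?J" for c d
  proof -
    have "(frag_of (c x *s fst x, snd x) - frag_of (d x *s fst x, snd x))
        - frag_of ((c x - d x) *s fst x, snd x) \<in> ?J" if "x \<in> B \<times> B" for x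
    proof -
      have "fst x \<in> K" "snd x \<in> K" using that B by auto
      then show ?thesis using rel_left[of "(c x - d x) *s fst x" "d x *s fst x" "snd x"] K_subspace
        by (simp add: subspace_scale subspace_diff scale_left_diff_distrib algebra_simps)
    qed
    then have "(\<Sum>x\<in>B \<times> B. (frag_of (c x *s fst x, snd x) - frag_of (d x *s fst x, snd x))
        - frag_of ((c x - d x) *s fst x, snd x)) \<in> ?J" by (rule J_sum)
    then show ?thesis by (simp add: N_def sum_subtractf)
  qed
  \<comment> \<open>The formal sums congruent to a basis sum form a subgroup closed under
    congruence. It remains to put every pair into it, first varying the left entry over the span of
    the basis, then the right one.\<close>
  define Q where "Q = {q. \<exists>c. q - ?N c \<in> ?J}"
  have Q_diff: "q - r \<in> Q" if qr: "q \<in> Q" "r \<in> Q" for q r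
  proof -
    obtain c d where cd: "q - ?N c \<in> ?J" "r - ?N d \<in> ?J" using qr by (auto simp: Q_def)
    then have "((q - ?N c) - (r - ?N d)) + ((?N c - ?N d) - ?N (\<lambda>x. c x - d x)) \<in> ?J"
      by (intro J_add[OF J_diff[OF cd] N_diff])
    then show ?thesis unfolding Q_def by (intro CollectI exI[of _ "\<lambda>x. c x - d x"]) (simp add: algebra_simps)
  qed
  have Q_J: "r \<in> Q" if qr: "q \<in> Q" "r - q \<in> ?J" for q r
  proof -
    obtain c where "q - ?N c \<in> ?J" using qr by (auto simp: Q_def)
    from J_add[OF this qr(2)] show ?thesis by (auto simp: Q_def intro: exI[of _ c])
  qed
  have N0: "?N (\<lambda>x. 0) \<in> ?J" unfolding N_def
  proof (rule J_sum)
    fix x assume "x \<in> B \<times> B"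
    then have "snd x \<in> K" using B(2) by auto
    then show "frag_of (0 *s fst x, snd x) \<in> ?J" using zero_left by simp
  qed
  then have Q_0: "0 \<in> Q" unfolding Q_def using J_uminus by force
  have Q_add: "q + r \<in> Q" if "q \<in> Q" "r \<in> Q" for q r
    using Q_diff[OF that(1) Q_diff[OF Q_0 that(2)]] by simp
  have J_Q: "q \<in> Q" if "q \<in> ?J" for q using Q_J[OF Q_0, of q] that by simp
  have basis: "frag_of (c *s b, b') \<in> Q" if b: "b \<in> B" "b' \<in> B" for c b b'
  proof -
    define d where "d = (\<lambda>x. if x = (b, b') then c else 0)"
    have "?N d = (\<Sum>x\<in>{(b, b')}. frag_of (d x *s fst x, snd x))
        + (\<Sum>x\<in>B \<times> B - {(b, b')}. frag_of (d x *s fst x, snd x))"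
      unfolding N_def using b B(1) by (subst sum.subset_diff[of "{(b, b')}"]) (simp_all add: add.commute)
    moreover have "(\<Sum>x\<in>B \<times> B - {(b, b')}. frag_of (d x *s fst x, snd x)) \<in> ?J"
    proof (rule J_sum)
      fix x assume "x \<in> B \<times> B - {(b, b')}"
      then have "snd x \<in> K" "d x = 0" using B(2) by (auto simp: d_def)
      then show "frag_of (d x *s fst x, snd x) \<in> ?J" using zero_left by simp
    qed
    ultimately have "frag_of (c *s b, b') - ?N d \<in> ?J" using J_uminus by (simp add: d_def)
    then show ?thesis by (auto simp: Q_def)
  qed
  have left: "k \<in> K \<and> frag_of (k, b') \<in> Q" if "k \<in> span B" "b' \<in> B" for k b' using that(1)
  proof (induction k rule: span_induct_alt)
    case base
    then show ?case using J_Q zero_left that B subspace_0[OF K_subspace] by auto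
  next
    case (step c x y)
    have K: "c *s x \<in> K" "b' \<in> K" "y \<in> K" using step that B K_subspace by (auto simp: subspace_scale)
    have "frag_of (c *s x, b') + frag_of (y, b') \<in> Q" using basis step that by (intro Q_add) auto
    then have "frag_of (c *s x + y, b') \<in> Q"
      by (rule Q_J) (use rel_left[OF K(1,3,2)] in \<open>simp add: algebra_simps\<close>)
    then show ?case using K K_subspace by (simp add: subspace_add)
  qed
  have both: "k' \<in> K \<and> frag_of (k, k') \<in> Q" if "k \<in> K" "k' \<in> span B" for k k' using that(2)
  proof (induction k' rule: span_induct_alt)
    case base
    then show ?case using J_Q zero_right that B subspace_0[OF K_subspace] by auto
  next
    case (step c x y)
    have K: "c *s k \<in> K" "x \<in> K" "c *s x \<in> K" "y \<in> K"
      using step that B K_subspace by (auto simp: subspace_scale)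
    have "frag_of (c *s k, x) \<in> Q" using left K B step by auto
    then have "frag_of (k, c *s x) \<in> Q"
      by (rule Q_J) (use J_uminus[OF rel_scale[OF that(1) K(2), of c]] in simp)
    then have "frag_of (k, c *s x) + frag_of (k, y) \<in> Q" using step by (intro Q_add) auto
    then have "frag_of (k, c *s x + y) \<in> Q"
      by (rule Q_J) (use rel_right[OF K(3,4) that(1)] in \<open>simp add: algebra_simps\<close>)
    then show ?case using K K_subspace by (simp add: subspace_add)
  qed
  from p have "p \<in> Q"
    by (induction p rule: frag_induction) (use Q_0 both B Q_diff in auto)
  then show ?thesis using N0 by (auto simp: Q_def)
qed

text \<open>Modulo the relations p is a basis sum, and this basis sum is null as well, so its
  coefficients are zero.\<close>

lemma null_sums_subset_rel_ideal: "null_sums \<subseteq> rel_ideal"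
proof
  fix p assume p: "p \<in> null_sums"
  interpret J: additive_subgroup rel_ideal free_ring
    by (rule ideal.axioms(1)) (rule ring.genideal_ideal[OF ring_free_ring tensor_rels_carrier])
  obtain B where B: "finite B" "independent B" "B \<subseteq> K" "span B = K" using finite_basis by blast
  obtain c where c: "p - basis_sum B c \<in> rel_ideal"
    using basis_expansion[OF B(1,3,4), of p] p unfolding null_sums_def by blast
  have "p - basis_sum B c \<in> null_sums" using c rel_ideal_subset_null_sums by blast
  have "basis_sum B c = p - (p - basis_sum B c)" by simp
  moreover have "p - (p - basis_sum B c) \<in> null_sums"
    using p \<open>p - basis_sum B c \<in> null_sums\<close> keys_diff[of p "p - basis_sum B c"]
    by (auto simp: null_sums_def tensor_char_diff simp del: diff_diff_eq2 diff_diff_add)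
  ultimately have "basis_sum B c \<in> null_sums" by metis
  then have "c x = 0" if "x \<in> B \<times> B" for x
    using basis_sum_in_null_sums[OF B(1-3), of c "fst x" "snd x"] that by auto
  then have "basis_sum B c = basis_sum B (\<lambda>x. 0)" unfolding basis_sum_def by (intro sum.cong) auto
  moreover have "basis_sum B (\<lambda>x. 0) \<in> rel_ideal"
    using basis_expansion[OF B(1,3,4), of 0] by simp
  ultimately show "p \<in> rel_ideal" using J.a_closed[OF c, of "basis_sum B c"] by (simp add: free_ring_simps)
qed

lemma rel_ideal_eq: "rel_ideal = null_sums"
  using rel_ideal_subset_null_sums null_sums_subset_rel_ideal by blast

section \<open>Faithful sections of the bimodule\<close>

lemma tensor_square_carrier:
  "carrier tensor_square = {(\<lambda>h. h + p) ` null_sums | p. Poly_Mapping.keys p \<subseteq> K \<times> K}"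
  unfolding tensor_algebra_def FactRing_def A_RCOSETS_def' a_r_coset_def' rel_ideal_eq
  by (auto simp: free_ring_simps)

lemma tensor_square_zero: "\<zero>\<^bsub>tensor_square\<^esub> = null_sums"
  by (simp add: tensor_algebra_def FactRing_def rel_ideal_eq)

lemma tensor_act_coset: "tensor_act ((\<lambda>h. h + p) ` null_sums) a = formal_act p a"
proof -
  have "0 \<in> null_sums" by (simp add: null_sums_def tensor_char_def)
  then have "(\<lambda>p. formal_act p a) ` (\<lambda>h. h + p) ` null_sums = {formal_act p a}"
    by (auto simp: image_image formal_act_add null_sums_act)
  then show ?thesis by (simp add: tensor_act_def)
qed

lemma coset_eq_null_sums:
  assumes "Poly_Mapping.keys p \<subseteq> K \<times> K"
  shows "(\<lambda>h. h + p) ` null_sums = null_sums \<longleftrightarrow> p \<in> null_sums"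
proof
  have "0 \<in> null_sums" by (simp add: null_sums_def tensor_char_def)
  then show "(\<lambda>h. h + p) ` null_sums = null_sums \<Longrightarrow> p \<in> null_sums" by (metis add_0 imageI)
next
  assume p: "p \<in> null_sums"
  have "h + p \<in> null_sums" "h - p \<in> null_sums" if "h \<in> null_sums" for h
    using p that keys_add[of h p] keys_diff[of h p]
    by (auto simp: null_sums_def tensor_char_def field_space.int_sum_add field_space.int_sum_diff)
  then show "(\<lambda>h. h + p) ` null_sums = null_sums"
    by (force simp: image_iff intro: bexI[of _ "_ - p"])
qed

text \<open>The predicate is left open so that the same translation serves the bimodule and its
  sections.\<close>

lemma tensor_square_all_zero_iff:
  "(\<forall>r\<in>carrier tensor_square. P r \<longrightarrow> r = \<zero>\<^bsub>tensor_square\<^esub>) \<longleftrightarrow>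
    (\<forall>p. Poly_Mapping.keys p \<subseteq> K \<times> K \<longrightarrow> P ((\<lambda>h. h + p) ` null_sums) \<longrightarrow> p \<in> null_sums)"
proof -
  have "(\<forall>r\<in>carrier tensor_square. P r \<longrightarrow> r = \<zero>\<^bsub>tensor_square\<^esub>) \<longleftrightarrow>
    (\<forall>p. Poly_Mapping.keys p \<subseteq> K \<times> K \<longrightarrow> P ((\<lambda>h. h + p) ` null_sums) \<longrightarrow>
      (\<lambda>h. h + p) ` null_sums = null_sums)"
    unfolding tensor_square_carrier tensor_square_zero by blast
  then show ?thesis by (simp add: coset_eq_null_sums cong: imp_cong)
qed

lemma faithful_bimodule_iff:
  "faithful tensor_square bimodule \<longleftrightarrow>
    (\<forall>p. Poly_Mapping.keys p \<subseteq> K \<times> K \<longrightarrow> (\<forall>a. formal_act p a = 0) \<longrightarrow> p \<in> null_sums)"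
  unfolding faithful_def tensor_square_all_zero_iff by (simp add: bimodule_def tensor_act_coset)

lemma faithful_section_iff:
  assumes N': "subspace N'" and inv: "\<And>k a. k \<in> K \<Longrightarrow> a \<in> N' \<Longrightarrow> k \<bullet> a \<in> N' \<and> a \<bullet> k \<in> N'"
  shows "faithful tensor_square (quotient_module (bimodule\<lparr>carrier := N\<rparr>) N') \<longleftrightarrow>
    (\<forall>p. Poly_Mapping.keys p \<subseteq> K \<times> K \<longrightarrow> (\<forall>a\<in>N. formal_act p a \<in> N') \<longrightarrow> p \<in> null_sums)"
proof -
  let ?M = "quotient_module (bimodule\<lparr>carrier := N\<rparr>) N'"
  have zero: "0 \<in> N'" using N' by (rule subspace_0)
  have carrier: "carrier ?M = (\<lambda>a. (\<lambda>h. h + a) ` N') ` N"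
    unfolding quotient_module_def A_RCOSETS_def' a_r_coset_def' by (auto simp: bimodule_def)
  have coset: "(\<lambda>h. h + a) ` N' = N' \<longleftrightarrow> a \<in> N'" for a
  proof
    show "(\<lambda>h. h + a) ` N' = N' \<Longrightarrow> a \<in> N'" using zero by (metis add_0 imageI)
    assume "a \<in> N'"
    then have "h + a \<in> N'" "h - a \<in> N'" if "h \<in> N'" for h using that N' by (auto simp: subspace_add subspace_diff)
    then show "(\<lambda>h. h + a) ` N' = N'" by (force simp: image_iff intro: bexI[of _ "_ - a"])
  qed
  have smult: "(\<lambda>h. h + p) ` null_sums \<odot>\<^bsub>?M\<^esub> ((\<lambda>h. h + a) ` N') = \<zero>\<^bsub>?M\<^esub> \<longleftrightarrow> formal_act p a \<in> N'"
    if p: "Poly_Mapping.keys p \<subseteq> K \<times> K" for p a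
  proof -
    have act: "formal_act p h \<in> N'" if "h \<in> N'" for h
      using formal_act_closed[OF N' inv p that] by blast
    have "(\<lambda>h. h + p) ` null_sums \<odot>\<^bsub>?M\<^esub> ((\<lambda>h. h + a) ` N')
        = (\<Union>h\<in>N'. (\<lambda>g. g + formal_act p (h + a)) ` N')"
      unfolding quotient_module_def by (auto simp: bimodule_def a_r_coset_def' tensor_act_coset)
    \<comment> \<open>The union of cosets collapses to one because p maps N' into itself.\<close>
    also have "\<dots> = (\<lambda>g. g + formal_act p a) ` N'"
    proof (intro equalityI subsetI)
      fix y assume "y \<in> (\<Union>h\<in>N'. (\<lambda>g. g + formal_act p (h + a)) ` N')"
      then obtain h g where "h \<in> N'" "g \<in> N'" "y = (g + formal_act p h) + formal_act p a"
        by (auto simp: formal_act_add_right add.assoc)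
      then show "y \<in> (\<lambda>g. g + formal_act p a) ` N'" using act N' by (blast intro: subspace_add)
    next
      fix y assume "y \<in> (\<lambda>g. g + formal_act p a) ` N'"
      then show "y \<in> (\<Union>h\<in>N'. (\<lambda>g. g + formal_act p (h + a)) ` N')"
        using zero by (intro UN_I[of 0]) auto
    qed
    finally show ?thesis using coset by (simp add: quotient_module_def)
  qed
  show ?thesis
    unfolding faithful_def tensor_square_all_zero_iff carrier by (simp add: smult cong: imp_cong)
qed

lemma submodule_bimodule_iff:
  "submodule N tensor_square bimodule \<longleftrightarrow>
    subspace N \<and> (\<forall>k\<in>K. \<forall>a\<in>N. k \<bullet> a \<in> N \<and> a \<bullet> k \<in> N)"
proof -
  interpret A: abelian_group bimodule
    by (rule abelian_groupI) (auto simp: bimodule_def algebra_simps intro: exI[of _ "- _"])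
  have inv: "inv\<^bsub>add_monoid bimodule\<^esub> x = - x" for x
    using A.minus_equality[of "- x" x] by (simp add: a_inv_def bimodule_def)
  have act: "(\<lambda>h. h + p) ` null_sums \<odot>\<^bsub>bimodule\<^esub> a = formal_act p a" for p a
    by (simp add: bimodule_def tensor_act_coset)
  have "submodule N tensor_square bimodule \<longleftrightarrow>
    0 \<in> N \<and> (\<forall>x\<in>N. \<forall>y\<in>N. x + y \<in> N) \<and> (\<forall>x\<in>N. - x \<in> N) \<and>
    (\<forall>p. Poly_Mapping.keys p \<subseteq> K \<times> K \<longrightarrow> (\<forall>a\<in>N. formal_act p a \<in> N))"
  proof -
    have "(\<forall>r\<in>carrier tensor_square. \<forall>a\<in>N. r \<odot>\<^bsub>bimodule\<^esub> a \<in> N) \<longleftrightarrow>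
      (\<forall>p. Poly_Mapping.keys p \<subseteq> K \<times> K \<longrightarrow> (\<forall>a\<in>N. (\<lambda>h. h + p) ` null_sums \<odot>\<^bsub>bimodule\<^esub> a \<in> N))"
      unfolding tensor_square_carrier by blast
    also have "\<dots> \<longleftrightarrow> (\<forall>p. Poly_Mapping.keys p \<subseteq> K \<times> K \<longrightarrow> (\<forall>a\<in>N. formal_act p a \<in> N))"
      unfolding act ..
    finally have smult: "(\<forall>r a. r \<in> carrier tensor_square \<longrightarrow> a \<in> N \<longrightarrow> r \<odot>\<^bsub>bimodule\<^esub> a \<in> N) \<longleftrightarrow>
      (\<forall>p. Poly_Mapping.keys p \<subseteq> K \<times> K \<longrightarrow> (\<forall>a\<in>N. formal_act p a \<in> N))" by blast
    show ?thesis
      unfolding submodule_def subgroup_def submodule_axioms_def inv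
      using smult by (auto simp: bimodule_def)
  qed
  also have "\<dots> \<longleftrightarrow> subspace N \<and> (\<forall>k\<in>K. \<forall>a\<in>N. k \<bullet> a \<in> N \<and> a \<bullet> k \<in> N)"
  proof (intro iffI conjI ballI)
    assume *: "0 \<in> N \<and> (\<forall>x\<in>N. \<forall>y\<in>N. x + y \<in> N) \<and> (\<forall>x\<in>N. - x \<in> N) \<and>
      (\<forall>p. Poly_Mapping.keys p \<subseteq> K \<times> K \<longrightarrow> (\<forall>a\<in>N. formal_act p a \<in> N))"
    then have act_in: "(k \<bullet> a) \<bullet> k' \<in> N" if "k \<in> K" "k' \<in> K" "a \<in> N" for k k' a
      using that formal_act_of[of k k' a] by (metis keys_frag_of SigmaI empty_subsetI insert_subset)
    show "subspace N"
    proof (rule subspaceI)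
      fix c x assume "x \<in> N"
      \<comment> \<open>Scalars of the base field act through their multiples of the unit, which lie
        in K, so closure under the tensor action already gives a subspace.\<close>
      then have "((c *s \<e>) \<bullet> x) \<bullet> \<e> \<in> N" by (intro act_in) (auto simp: K_unit K_subspace subspace_scale)
      then show "c *s x \<in> N" by (simp add: mul_scale_left unit_left unit_right)
    qed (use * in auto)
    fix k a assume "k \<in> K" "a \<in> N"
    then show "k \<bullet> a \<in> N" "a \<bullet> k \<in> N"
      using act_in[of k \<e> a] act_in[of \<e> k a] by (auto simp: K_unit unit_left unit_right)
  next
    assume *: "subspace N \<and> (\<forall>k\<in>K. \<forall>a\<in>N. k \<bullet> a \<in> N \<and> a \<bullet> k \<in> N)"
    then show "\<forall>p. Poly_Mapping.keys p \<subseteq> K \<times> K \<longrightarrow> (\<forall>a\<in>N. formal_act p a \<in> N)"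
      using formal_act_closed by blast
    show "0 \<in> N" using * by (simp add: subspace_0)
    show "x + y \<in> N" if "x \<in> N" "y \<in> N" for x y using * that by (simp add: subspace_add)
    show "- x \<in> N" if "x \<in> N" for x using * that by (simp add: subspace_neg)
  qed
  finally show ?thesis .
qed

end

section \<open>Cyclic generators\<close>

context separable_subalgebra
begin

text \<open>Right multiplications compose in the reverse order; the commutativity of K corrects
  this.\<close>

lemma formal_act_mult:
  assumes "Poly_Mapping.keys p \<subseteq> K \<times> K" "Poly_Mapping.keys q \<subseteq> K \<times> K"
  shows "formal_act (p \<otimes>\<^bsub>free_ring\<^esub> q) a = formal_act p (formal_act q a)"
proof -
  have zero: "formal_act p 0 = 0" for p
    using formal_act_add_right[of p 0 0] by simp
  have diff: "formal_act p (a - b) = formal_act p a - formal_act p b" for p a b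
    using formal_act_add_right[of p "a - b" b] by simp
  show ?thesis using assms(1)
  proof (induction p rule: frag_induction)
    case (one x)
    from assms(2) show ?case
    proof (induction q rule: frag_induction)
      case (one y)
      obtain b c where x: "x = (b, c)" "b \<in> K" "c \<in> K" using \<open>x \<in> K \<times> K\<close> by auto
      obtain b' c' where y: "y = (b', c')" "b' \<in> K" "c' \<in> K" using one by auto
      have "((b \<bullet> b') \<bullet> a) \<bullet> (c \<bullet> c') = (b \<bullet> (b' \<bullet> a)) \<bullet> (c' \<bullet> c)"
        using x y by (simp add: K_left K_comm[of c c'])
      also have "\<dots> = (b \<bullet> ((b' \<bullet> a) \<bullet> c')) \<bullet> c"
        using x y by (simp add: K_left K_right)
      finally show ?case by (simp add: x y free_ring_mult_of formal_act_of)
    qed (simp_all add: free_ring_mult_0 free_ring_mult_diff_right formal_act_diff formal_act_0 zero diff)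
  qed (simp_all add: free_ring_mult_0 free_ring_mult_diff_left formal_act_diff formal_act_0)
qed

text \<open>The support of \<open>v\<close>, i.e. the set of weights that do not vanish at \<open>v\<close>, can be enlarged as
  long as \<open>v\<close> is annihilated by some \<open>p\<close>: add a suitable element of the image of \<open>p\<close>.\<close>

lemma cyclic_vector:
  assumes N: "subspace N" "\<And>k a. k \<in> K \<Longrightarrow> a \<in> N \<Longrightarrow> k \<bullet> a \<in> N \<and> a \<bullet> k \<in> N"
    and N': "subspace N'" "\<And>k a. k \<in> K \<Longrightarrow> a \<in> N' \<Longrightarrow> k \<bullet> a \<in> N' \<and> a \<bullet> k \<in> N'"
    and faithful: "\<And>p. Poly_Mapping.keys p \<subseteq> K \<times> K \<Longrightarrow> (\<And>a. a \<in> N \<Longrightarrow> formal_act p a \<in> N') \<Longrightarrow> p \<in> null_sums"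
  shows "\<exists>v\<in>N. \<forall>p. Poly_Mapping.keys p \<subseteq> K \<times> K \<longrightarrow> formal_act p v \<in> N' \<longrightarrow> p \<in> null_sums"
proof -
  define supp where "supp = (\<lambda>v. {(\<sigma>, \<tau>). \<sigma> \<in> chars K \<and> \<tau> \<in> chars K \<and>
    (\<exists>\<phi>\<in>bi_weight \<sigma> \<tau>. (\<forall>x\<in>N'. \<phi> x = 0) \<and> \<phi> v \<noteq> 0)})"
  have supp_subset: "supp v \<subseteq> chars K \<times> chars K" for v by (auto simp: supp_def)
  have fin: "finite (chars K \<times> chars K)" using finite_chars by simp
  have "\<exists>v. v \<in> N \<and> (\<forall>w. w \<in> N \<longrightarrow> card (supp w) \<le> card (supp v))"
    by (rule ex_has_greatest_nat[where k = 0 and b = "Suc (card (chars K \<times> chars K))"])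
      (use N(1) subspace_0 card_mono[OF fin supp_subset] in \<open>auto simp: less_Suc_eq_le\<close>)
  then obtain v where v: "v \<in> N" and max: "\<And>w. w \<in> N \<Longrightarrow> card (supp w) \<le> card (supp v)" by blast
  have "p \<in> null_sums" if p: "Poly_Mapping.keys p \<subseteq> K \<times> K" and pv: "formal_act p v \<in> N'" for p
  proof (rule ccontr)
    assume "p \<notin> null_sums"
    then obtain w where w: "w \<in> N" "formal_act p w \<notin> N'" using faithful[OF p] by blast
    obtain \<sigma> \<tau> \<phi> where \<phi>: "\<sigma> \<in> chars K" "\<tau> \<in> chars K" "\<phi> \<in> bi_weight \<sigma> \<tau>"
      "\<forall>x\<in>N'. \<phi> x = 0" "\<phi> (formal_act p w) \<noteq> 0"
      using bi_weight_separates[OF N' w(2)] by blast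
    let ?u = "v + formal_act p w"
    have u: "?u \<in> N" using v formal_act_closed[OF N p w(1)] N(1) by (simp add: subspace_add)
    have add: "\<psi> (x + y) = \<psi> x + \<psi> y" if "\<psi> \<in> bi_weight \<sigma>' \<tau>'" for \<psi> \<sigma>' \<tau>' x y
      using that dual_add by (simp add: bi_weight_def left_weight_def)
    \<comment> \<open>As p v lies in N', a weight vector that vanishes on N' either kills v or has a
      weight at which p is zero. Hence adding p w does not change its value wherever v was already
      seen.\<close>
    have vanish: "tensor_char \<sigma>' \<tau>' p * \<psi> v = 0"
      if "\<psi> \<in> bi_weight \<sigma>' \<tau>'" "\<forall>x\<in>N'. \<psi> x = 0" for \<psi> \<sigma>' \<tau>'
      using bi_weight_formal_act[OF that(1) p, of v] that(2) pv by simp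
    have "supp v \<subseteq> supp ?u"
    proof
      fix x assume "x \<in> supp v"
      then obtain \<sigma>' \<tau>' \<psi> where \<psi>: "x = (\<sigma>', \<tau>')" "\<sigma>' \<in> chars K" "\<tau>' \<in> chars K"
        "\<psi> \<in> bi_weight \<sigma>' \<tau>'" "\<forall>x\<in>N'. \<psi> x = 0" "\<psi> v \<noteq> 0"
        by (auto simp: supp_def)
      then have "\<psi> ?u = \<psi> v"
        using vanish[OF \<psi>(4,5)] by (simp add: add[OF \<psi>(4)] bi_weight_formal_act[OF \<psi>(4) p])
      then show "x \<in> supp ?u" using \<psi> unfolding supp_def by (auto intro!: bexI[of _ \<psi>])
    qed
    moreover have "tensor_char \<sigma> \<tau> p \<noteq> 0" using \<phi>(5) by (simp add: bi_weight_formal_act[OF \<phi>(3) p])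
    then have "\<psi> v = 0" if "\<psi> \<in> bi_weight \<sigma> \<tau>" "\<forall>x\<in>N'. \<psi> x = 0" for \<psi>
      using vanish[OF that] by simp
    then have "(\<sigma>, \<tau>) \<notin> supp v" unfolding supp_def by blast
    moreover have "(\<sigma>, \<tau>) \<in> supp ?u"
    proof -
      have "\<phi> v = 0" using vanish[OF \<phi>(3,4)] \<open>tensor_char \<sigma> \<tau> p \<noteq> 0\<close> by simp
      then have "\<phi> ?u \<noteq> 0" using \<phi>(5) by (simp add: add[OF \<phi>(3)])
      then show ?thesis using \<phi> unfolding supp_def by blast
    qed
    ultimately have "supp v \<subset> supp ?u" by blast
    then have "card (supp v) < card (supp ?u)"
      using finite_subset[OF supp_subset fin] by (intro psubset_card_mono) auto
    then show False using max[OF u] by simp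
  qed
  then show ?thesis using v by blast
qed

section \<open>Independent products and free generators\<close>

lemma formal_act_basis_sum:
  "formal_act (basis_sum B c) v = (\<Sum>x\<in>B \<times> B. c x *s ((fst x \<bullet> v) \<bullet> snd x))"
  unfolding basis_sum_def formal_act_int_sum int_sum_sum by (simp add: mul_scale_left)

lemma basis_sum_keys:
  assumes "B \<subseteq> K" shows "Poly_Mapping.keys (basis_sum B c) \<subseteq> K \<times> K"
proof -
  have "Poly_Mapping.keys (basis_sum B c) \<subseteq> (\<Union>x\<in>B \<times> B. Poly_Mapping.keys (frag_of (c x *s fst x, snd x)))"
    unfolding basis_sum_def by (rule Poly_Mapping.keys_sum)
  also have "\<dots> \<subseteq> K \<times> K"
  proof -
    have "c x *s fst x \<in> K" "snd x \<in> K" if "x \<in> B \<times> B" for x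
      using that assms K_subspace by (auto intro!: subspace_scale)
    then show ?thesis by (simp add: keys_frag_of UN_subset_iff)
  qed
  finally show ?thesis .
qed

text \<open>A combination of the products is the action of a basis sum on v. If it falls into N',
  the basis sum is null and its coefficients vanish.\<close>

lemma independent_products:
  assumes B: "finite B" "independent B" "B \<subseteq> K" and "subspace N'"
    and v: "\<And>p. Poly_Mapping.keys p \<subseteq> K \<times> K \<Longrightarrow> formal_act p v \<in> N' \<Longrightarrow> p \<in> null_sums"
  defines "g \<equiv> \<lambda>x. (fst x \<bullet> v) \<bullet> snd x"
  shows "inj_on g (B \<times> B)" "independent (g ` (B \<times> B))" "span (g ` (B \<times> B)) \<inter> N' \<subseteq> {0}"
proof -
  have zero: "c x = 0" if "(\<Sum>x\<in>B \<times> B. c x *s g x) \<in> N'" "x \<in> B \<times> B" for c x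
    using basis_sum_in_null_sums[OF B v[OF basis_sum_keys[OF B(3)]], of c "fst x" "snd x"] that
    by (auto simp: formal_act_basis_sum g_def)
  show inj: "inj_on g (B \<times> B)"
  proof (rule inj_onI, rule ccontr)
    fix x y assume xy: "x \<in> B \<times> B" "y \<in> B \<times> B" "g x = g y" "x \<noteq> y"
    \<comment> \<open>If two index pairs gave the same product, this difference of indicators would
      be a nontrivial relation.\<close>
    define c where "c = (\<lambda>z. if z = x then 1 else if z = y then - 1 else (0 :: 'f))"
    have "(\<Sum>z\<in>B \<times> B. c z *s g z) = (\<Sum>z\<in>{x, y}. c z *s g z)"
      by (rule sum.mono_neutral_right) (use xy B in \<open>auto simp: c_def\<close>)
    also have "\<dots> = 0" using xy by (simp add: c_def)
    finally have "c x = 0" using zero[of c x] xy \<open>subspace N'\<close> by (simp add: subspace_0)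
    then show False by (simp add: c_def)
  qed
  have sum_eq: "(\<Sum>y\<in>g ` (B \<times> B). u y *s y) = (\<Sum>x\<in>B \<times> B. u (g x) *s g x)" for u
    using sum.reindex[OF inj, of "\<lambda>y. u y *s y"] by simp
  have fin: "finite (g ` (B \<times> B))" using B by simp
  show "independent (g ` (B \<times> B))"
  proof (rule independent_if_scalars_zero[OF fin])
    fix u y assume "(\<Sum>y\<in>g ` (B \<times> B). u y *s y) = 0" "y \<in> g ` (B \<times> B)"
    then show "u y = 0" using zero[of "\<lambda>x. u (g x)"] \<open>subspace N'\<close> by (auto simp: sum_eq subspace_0)
  qed
  show "span (g ` (B \<times> B)) \<inter> N' \<subseteq> {0}"
  proof
    fix y assume y: "y \<in> span (g ` (B \<times> B)) \<inter> N'"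
    then obtain u where u: "y = (\<Sum>x\<in>B \<times> B. u (g x) *s g x)"
      unfolding span_finite[OF fin] by (auto simp: sum_eq)
    then have "u (g x) = 0" if "x \<in> B \<times> B" for x using zero[of "\<lambda>x. u (g x)"] that y by simp
    then show "y \<in> {0}" by (simp add: u)
  qed
qed

text \<open>Says that A is free of rank one over K \<otimes> K with basis v: the orbit map of v is
  surjective, and only null sums annihilate v.\<close>

definition generator :: "'a \<Rightarrow> bool"
  where "generator v \<longleftrightarrow> (\<forall>a. \<exists>p. Poly_Mapping.keys p \<subseteq> K \<times> K \<and> formal_act p v = a) \<and>
    (\<forall>p. Poly_Mapping.keys p \<subseteq> K \<times> K \<longrightarrow> formal_act p v = 0 \<longrightarrow> p \<in> null_sums)"

text \<open>The submodule generated by a vector with zero annihilator is itself faithful, so by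
  minimality it is all of A.\<close>

lemma minimally_faithful_generator:
  assumes "minimally_faithful tensor_square bimodule"
  shows "\<exists>v. generator v"
proof -
  have zero: "subspace {0}" "\<And>k a. k \<in> K \<Longrightarrow> a \<in> {0} \<Longrightarrow> k \<bullet> a \<in> {0} \<and> a \<bullet> k \<in> {0}"
    by (simp_all add: mul_0_left mul_0_right)
  have "faithful tensor_square bimodule" using assms by (simp add: minimally_faithful_def)
  then obtain v where v: "\<And>p. Poly_Mapping.keys p \<subseteq> K \<times> K \<Longrightarrow> formal_act p v = 0 \<Longrightarrow> p \<in> null_sums"
    using cyclic_vector[OF subspace_UNIV _ zero] by (auto simp: faithful_bimodule_iff)
  define N where "N = {formal_act p v | p. Poly_Mapping.keys p \<subseteq> K \<times> K}"
  have mult: "formal_act q a \<in> N" if a: "a \<in> N" and q: "Poly_Mapping.keys q \<subseteq> K \<times> K" for q a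
  proof -
    obtain p where "a = formal_act p v" "Poly_Mapping.keys p \<subseteq> K \<times> K" using a unfolding N_def by blast
    then show ?thesis using formal_act_mult[of q p v] free_ring_mult_closed[of q p] q
      unfolding N_def by (intro CollectI exI[of _ "q \<otimes>\<^bsub>free_ring\<^esub> p"]) auto
  qed
  have bimult: "(k \<bullet> a) \<bullet> k' \<in> N" if "a \<in> N" "k \<in> K" "k' \<in> K" for k a k'
    using mult[OF that(1), of "frag_of (k, k')"] that by (simp add: formal_act_of keys_frag_of)
  have subspace: "subspace N"
  proof (rule subspaceI)
    show "0 \<in> N" unfolding N_def by (rule CollectI, rule exI[of _ 0]) (simp add: formal_act_0)
    show "x + y \<in> N" if xy: "x \<in> N" "y \<in> N" for x y
    proof -
      obtain p q where "x = formal_act p v" "y = formal_act q v"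
        "Poly_Mapping.keys p \<subseteq> K \<times> K" "Poly_Mapping.keys q \<subseteq> K \<times> K" using xy unfolding N_def by blast
      then show ?thesis using keys_add[of p q] unfolding N_def
        by (intro CollectI exI[of _ "p + q"]) (auto simp: formal_act_add)
    qed
    show "c *s x \<in> N" if "x \<in> N" for c x
      using bimult[OF that, of "c *s \<e>" \<e>] K_unit K_subspace
      by (simp add: subspace_scale mul_scale_left unit_left unit_right)
  qed
  have inv: "k \<bullet> a \<in> N" "a \<bullet> k \<in> N" if "k \<in> K" "a \<in> N" for k a
    using bimult[OF that(2,1) K_unit] bimult[OF that(2) K_unit that(1)] by (simp_all add: unit_left unit_right)
  have "v \<in> N" unfolding N_def
    by (rule CollectI, rule exI[of _ "frag_of (\<e>, \<e>)"])
      (simp add: formal_act_of keys_frag_of unit_left unit_right K_unit)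
  then have "faithful tensor_square (quotient_module (bimodule\<lparr>carrier := N\<rparr>) {0})"
    using v by (subst faithful_section_iff[OF zero]) auto
  moreover have "submodule N tensor_square bimodule" "submodule {0} tensor_square bimodule"
    using subspace inv zero by (auto simp: submodule_bimodule_iff)
  moreover have "{0} \<subseteq> N" using subspace by (simp add: subspace_0)
  ultimately have "N = carrier bimodule"
    using assms unfolding minimally_faithful_def by (metis)
  then have "N = UNIV" by (simp add: bimodule_def)
  then have "\<exists>p. Poly_Mapping.keys p \<subseteq> K \<times> K \<and> formal_act p v = a" for a
  proof -
    have "a \<in> N" using \<open>N = UNIV\<close> by simp
    then show ?thesis unfolding N_def by blast
  qed
  then show ?thesis using v unfolding generator_def by blast
qed

text \<open>A weight vector is determined by its value at the generator, since its value at p v is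
  the value of the weight at p times its value at v.\<close>

lemma generator_bi_weight_unique:
  assumes "generator v" "\<phi> \<in> bi_weight \<sigma> \<tau>" "\<psi> \<in> bi_weight \<sigma> \<tau>" "\<phi> \<noteq> 0"
  shows "\<exists>c. \<psi> = fun_scale c \<phi>"
proof -
  have "\<exists>t. \<phi> a = t * \<phi> v \<and> \<psi> a = t * \<psi> v" for a
  proof -
    obtain p where p: "Poly_Mapping.keys p \<subseteq> K \<times> K" and a: "a = formal_act p v"
      using assms(1) unfolding generator_def by metis
    show ?thesis
      unfolding a bi_weight_formal_act[OF assms(2) p] bi_weight_formal_act[OF assms(3) p] by blast
  qed
  then have "\<exists>t. \<forall>a. \<phi> a = t a * \<phi> v \<and> \<psi> a = t a * \<psi> v" by (intro choice allI)
  then obtain t where t: "\<And>a. \<phi> a = t a * \<phi> v" "\<And>a. \<psi> a = t a * \<psi> v" by blast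
  have "\<phi> v \<noteq> 0"
  proof
    assume "\<phi> v = 0"
    then have "\<phi> a = 0" for a using t(1)[of a] by simp
    then show False using assms(4) by (simp add: fun_eq_iff)
  qed
  have "\<psi> = fun_scale (\<psi> v / \<phi> v) \<phi>"
  proof
    fix a
    show "\<psi> a = fun_scale (\<psi> v / \<phi> v) \<phi> a"
      unfolding fun_scale_apply t(1)[of a] t(2)[of a] using \<open>\<phi> v \<noteq> 0\<close> by simp
  qed
  then show ?thesis ..
qed

text \<open>Sending p v to the value of (\<sigma>, \<tau>) at p is well defined because the
  annihilator of v is null; this is a weight vector with value 1 at v.\<close>

lemma generator_bi_weight_exists:
  assumes v: "generator v" and \<sigma>: "\<sigma> \<in> chars K" and \<tau>: "\<tau> \<in> chars K"
  shows "\<exists>\<phi>\<in>bi_weight \<sigma> \<tau>. \<phi> \<noteq> 0"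
proof -
  have "\<forall>a. \<exists>p. Poly_Mapping.keys p \<subseteq> K \<times> K \<and> formal_act p v = a" using v by (simp add: generator_def)
  then obtain P where P: "\<And>a. Poly_Mapping.keys (P a) \<subseteq> K \<times> K" "\<And>a. formal_act (P a) v = a" by metis
  define \<phi> where "\<phi> = (\<lambda>a. tensor_char \<sigma> \<tau> (P a))"
  have \<phi>_act: "\<phi> (formal_act p v) = tensor_char \<sigma> \<tau> p" if p: "Poly_Mapping.keys p \<subseteq> K \<times> K" for p
  proof -
    let ?q = "P (formal_act p v)"
    have "formal_act (p - ?q) v = 0" by (simp add: formal_act_diff P)
    moreover have "Poly_Mapping.keys (p - ?q) \<subseteq> K \<times> K" using keys_diff[of p ?q] p P(1) by blast
    ultimately have "p - ?q \<in> null_sums" using v unfolding generator_def by blast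
    then have "tensor_char \<sigma> \<tau> (p - ?q) = 0" using \<sigma> \<tau> by (simp add: null_sums_def)
    then show ?thesis by (simp add: tensor_char_diff \<phi>_def)
  qed
  have \<phi>_mult: "\<phi> ((k \<bullet> a) \<bullet> k') = \<sigma> k * \<tau> k' * \<phi> a" if "k \<in> K" "k' \<in> K" for k k' a
  proof -
    have keys: "Poly_Mapping.keys (frag_of (k, k')) \<subseteq> K \<times> K" using that by (simp add: keys_frag_of)
    have "(k \<bullet> a) \<bullet> k' = formal_act (frag_of (k, k') \<otimes>\<^bsub>free_ring\<^esub> P a) v"
      using formal_act_mult[OF keys P(1)] by (simp add: P formal_act_of)
    then show ?thesis
      using \<phi>_act[OF free_ring_mult_closed[OF keys P(1)]] tensor_char_mult[OF \<sigma> \<tau> keys P(1)]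
      by (simp add: tensor_char_of \<phi>_def)
  qed
  have \<sigma>1: "\<sigma> \<e> = 1" "\<tau> \<e> = 1" "\<sigma> (c *s \<e>) = to_ac c" for c using \<sigma> \<tau> K_unit by (auto simp: chars_def)
  have "\<phi> \<in> dual"
    unfolding dual_def
  proof (intro CollectI conjI allI)
    fix x y
    have "\<phi> (formal_act (P x + P y) v) = tensor_char \<sigma> \<tau> (P x + P y)"
      by (rule \<phi>_act) (use keys_add[of "P x" "P y"] P(1) in blast)
    then show "\<phi> (x + y) = \<phi> x + \<phi> y"
      by (simp add: formal_act_add P(2)) (simp add: \<phi>_def tensor_char_def field_space.int_sum_add)
    show "\<phi> (c *s x) = to_ac c * \<phi> x" for c
      using \<phi>_mult[of "c *s \<e>" \<e> x] K_unit K_subspace \<sigma>1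
      by (simp add: subspace_scale mul_scale_left unit_left unit_right)
  qed
  then have "\<phi> \<in> bi_weight \<sigma> \<tau>"
    using \<phi>_mult[OF _ K_unit] \<phi>_mult[OF K_unit]
    by (simp add: bi_weight_def left_weight_def right_weight_def unit_left unit_right \<sigma>1)
  moreover have "\<phi> v = 1" using \<phi>_act[of "frag_of (\<e>, \<e>)"] K_unit \<sigma>1
    by (simp add: keys_frag_of formal_act_of tensor_char_of unit_left unit_right)
  ultimately show ?thesis by (metis zero_fun_apply zero_neq_one)
qed

text \<open>The products \<open>b v b'\<close> give \<open>(dim K)\<^sup>2 = dim A\<close> vectors of \<open>N\<close> independent modulo \<open>N'\<close>.\<close>

lemma minimally_faithful_if_dim:
  assumes dim: "dim UNIV = (dim K)\<^sup>2" and faithful: "faithful tensor_square bimodule"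
  shows "minimally_faithful tensor_square bimodule"
  unfolding minimally_faithful_def
proof (intro conjI allI impI notI faithful)
  fix N N'
  assume sub: "submodule N tensor_square bimodule \<and> submodule N' tensor_square bimodule \<and> N' \<subseteq> N \<and>
      \<not> (N = carrier bimodule \<and> N' = {\<zero>\<^bsub>bimodule\<^esub>})"
    and section_faithful: "faithful tensor_square (quotient_module (bimodule\<lparr>carrier := N\<rparr>) N')"
  have N: "subspace N" "\<And>k a. k \<in> K \<Longrightarrow> a \<in> N \<Longrightarrow> k \<bullet> a \<in> N \<and> a \<bullet> k \<in> N"
    and N': "subspace N'" "\<And>k a. k \<in> K \<Longrightarrow> a \<in> N' \<Longrightarrow> k \<bullet> a \<in> N' \<and> a \<bullet> k \<in> N'"
    using sub by (auto simp: submodule_bimodule_iff)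
  have "\<exists>v\<in>N. \<forall>p. Poly_Mapping.keys p \<subseteq> K \<times> K \<longrightarrow> formal_act p v \<in> N' \<longrightarrow> p \<in> null_sums"
    by (rule cyclic_vector[OF N N']) (use section_faithful faithful_section_iff[OF N'] in blast)+
  then obtain v where v: "v \<in> N"
    "\<And>p. Poly_Mapping.keys p \<subseteq> K \<times> K \<Longrightarrow> formal_act p v \<in> N' \<Longrightarrow> p \<in> null_sums" by blast
  obtain B where B: "finite B" "independent B" "B \<subseteq> K" "span B = K" using finite_basis by blast
  let ?g = "\<lambda>x. (fst x \<bullet> v) \<bullet> snd x"
  have g: "inj_on ?g (B \<times> B)" "independent (?g ` (B \<times> B))" "span (?g ` (B \<times> B)) \<inter> N' \<subseteq> {0}"
    by (rule independent_products[OF B(1-3) N'(1) v(2)]; assumption)+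
  obtain E where E: "finite E" "independent E" "span E = UNIV"
    using fin maximal_independent_subset[of UNIV] independent_span_bound by (metis subset_UNIV top.extremum_uniqueI)
  interpret fd: finite_dimensional_vector_space scale E
    by unfold_locales (use E in auto)
  have "card B = dim K" using B by (metis basis_card_eq_dim order_refl)
  then have "card (?g ` (B \<times> B)) = dim UNIV"
    using card_image[OF g(1)] dim by (simp add: card_cartesian_product power2_eq_square)
  \<comment> \<open>These are as many independent vectors as the dimension of A, so they span A.
    This leaves no room for N' and, as they lie in N, forces N to be everything.\<close>
  then have "UNIV \<subseteq> span (?g ` (B \<times> B))"
    using g(2) by (intro fd.card_ge_dim_independent) auto
  then have span: "span (?g ` (B \<times> B)) = UNIV" by blast
  then have "N' = {0}" using g(3) N'(1) subspace_0 by blast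
  moreover have "?g ` (B \<times> B) \<subseteq> N"
  proof (rule image_subsetI)
    fix x assume "x \<in> B \<times> B"
    then have "fst x \<in> K" "snd x \<in> K" using B(3) by auto
    then show "?g x \<in> N" using v(1) N(2) by blast
  qed
  then have "N = UNIV" using span N(1) span_minimal by blast
  ultimately show False using sub by (simp add: bimodule_def)
qed

end

section \<open>Operators on the dual space\<close>

context nonassoc_algebra
begin

text \<open>Over the algebraic closure, \<open>S\<close> generates an algebra of operators; this is where elements
  of the scalar extension of the nucleus live.\<close>

inductive_set left_ops :: "'a set \<Rightarrow> (('a \<Rightarrow> 'f alg_closure) \<Rightarrow> 'a \<Rightarrow> 'f alg_closure) set"
  for S :: "'a set" where
  mult: "k \<in> S \<Longrightarrow> (\<lambda>\<phi> a. \<phi> (k \<bullet> a)) \<in> left_ops S"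
| scale: "T \<in> left_ops S \<Longrightarrow> (\<lambda>\<phi>. fun_scale c (T \<phi>)) \<in> left_ops S"
| add: "T \<in> left_ops S \<Longrightarrow> T' \<in> left_ops S \<Longrightarrow> (\<lambda>\<phi>. T \<phi> + T' \<phi>) \<in> left_ops S"
| comp: "T \<in> left_ops S \<Longrightarrow> T' \<in> left_ops S \<Longrightarrow> (\<lambda>\<phi>. T (T' \<phi>)) \<in> left_ops S"

text \<open>The elements whose left multiplication commutes with every right multiplication.\<close>

definition left_nucleus :: "'a set"
  where "left_nucleus = {x. \<forall>a b. (x \<bullet> a) \<bullet> b = x \<bullet> (a \<bullet> b)}"

lemma left_ops_mono:
  assumes "T \<in> left_ops S" "S \<subseteq> S'" shows "T \<in> left_ops S'"
  using assms(1)
proof induction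
  case (mult k)
  then show ?case using assms(2) by (intro left_ops.mult) blast
next
  case (scale T c)
  show ?case by (rule left_ops.scale[OF scale.IH])
next
  case (add T T')
  show ?case by (rule left_ops.add[OF add.IH])
next
  case (comp T T')
  show ?case by (rule left_ops.comp[OF comp.IH])
qed

lemma left_ops_add: "T \<in> left_ops S \<Longrightarrow> T (\<phi> + \<psi>) = T \<phi> + T \<psi>"
proof (induction arbitrary: \<phi> \<psi> rule: left_ops.induct)
  case (mult k)
  show ?case by (rule ext) simp
next
  case (scale T c)
  show ?case unfolding scale.IH by (rule funs.scale_right_distrib)
next
  case (add T T')
  show ?case unfolding add.IH by (simp only: add_ac)
qed simp

lemma left_ops_scale: "T \<in> left_ops S \<Longrightarrow> T (fun_scale c \<phi>) = fun_scale c (T \<phi>)"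
proof (induction arbitrary: \<phi> rule: left_ops.induct)
  case (mult k)
  show ?case by (rule ext) simp
next
  case (scale T d)
  show ?case unfolding scale.IH by (rule funs.scale_left_commute)
next
  case (add T T')
  show ?case unfolding add.IH by (rule funs.scale_right_distrib[symmetric])
qed simp

lemma left_ops_0: "T \<in> left_ops S \<Longrightarrow> T 0 = 0"
  using left_ops_scale[of T S 0 0] by simp

lemma left_ops_sum: "T \<in> left_ops S \<Longrightarrow> T (\<Sum>i\<in>I. f i) = (\<Sum>i\<in>I. T (f i))"
  by (induction I rule: infinite_finite_induct)
    (simp_all only: sum.infinite sum.empty sum.insert left_ops_0 left_ops_add not_False_eq_True)

lemma left_ops_closed:
  assumes "T \<in> left_ops S" "funs.subspace U" "\<And>k \<phi>. k \<in> S \<Longrightarrow> \<phi> \<in> U \<Longrightarrow> (\<lambda>a. \<phi> (k \<bullet> a)) \<in> U" "\<phi> \<in> U"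
  shows "T \<phi> \<in> U"
  using assms(1,4) by (induction arbitrary: \<phi>) (auto intro: assms funs.subspace_add funs.subspace_scale)

text \<open>Consequently the value of T \<phi> at y can be computed at the unit, after replacing
  \<phi> by its right translate by y.\<close>

lemma left_ops_right_mult:
  assumes "T \<in> left_ops left_nucleus"
  shows "T (\<lambda>a. \<phi> (a \<bullet> y)) = (\<lambda>a. T \<phi> (a \<bullet> y))"
  using assms
proof (induction arbitrary: \<phi>)
  case (mult k)
  then show ?case by (simp add: left_nucleus_def)
next
  case (scale T c)
  show ?case unfolding scale.IH by (rule ext) simp
next
  case (add T T')
  show ?case unfolding add.IH by (rule ext) simp
next
  case (comp T T')
  show ?case unfolding comp.IH ..
qed

text \<open>On a stable set Y, \<open>T \<phi>\<close> depends only on \<phi> restricted to Y. This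
  admits functionals that behave like weight vectors on Y alone.\<close>

lemma left_ops_local:
  assumes "T \<in> left_ops S" "\<And>k a. k \<in> S \<Longrightarrow> a \<in> Y \<Longrightarrow> k \<bullet> a \<in> Y" "\<And>a. a \<in> Y \<Longrightarrow> \<phi> a = \<psi> a" "a \<in> Y"
  shows "T \<phi> a = T \<psi> a"
  using assms(1,3,4)
proof (induction arbitrary: \<phi> \<psi> a)
  case (mult k)
  show ?case by (rule mult.prems(1)) (rule assms(2)[OF mult.hyps mult.prems(2)])
next
  case (scale T c)
  have "T \<phi> a = T \<psi> a" by (rule scale.IH[OF scale.prems])
  then show ?case by (simp only: fun_scale_apply)
next
  case (add T T')
  have "T \<phi> a = T \<psi> a" by (rule add.IH(1)[OF add.prems])
  moreover have "T' \<phi> a = T' \<psi> a" by (rule add.IH(2)[OF add.prems])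
  ultimately show ?case by (simp only: plus_fun_apply)
next
  case (comp T T')
  show ?case
  proof (rule comp.IH(1))
    show "T' \<phi> b = T' \<psi> b" if "b \<in> Y" for b by (rule comp.IH(2)[OF comp.prems(1) that])
  qed (rule comp.prems)
qed

lemma left_ops_zero_on_span:
  assumes "T \<in> left_ops S" "\<And>\<phi>. \<phi> \<in> W \<Longrightarrow> T \<phi> = 0" "\<phi> \<in> funs.span W"
  shows "T \<phi> = 0"
proof -
  have "funs.span W \<subseteq> {\<phi>. T \<phi> = 0}"
    by (rule funs.span_minimal)
      (use assms in \<open>auto simp: funs.subspace_def left_ops_0 left_ops_add left_ops_scale\<close>)
  then show ?thesis using assms(3) by blast
qed

end

context separable_subalgebra
begin

section \<open>Projections onto weight spaces\<close>

lemma K_left_nucleus: "K \<subseteq> left_nucleus"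
  by (auto simp: left_nucleus_def K_left)

lemma chars_differ:
  assumes "\<sigma> \<in> chars K" "\<tau> \<in> chars K" "\<sigma> \<noteq> \<tau>" shows "\<exists>k\<in>K. \<sigma> k \<noteq> \<tau> k"
proof (rule ccontr)
  assume *: "\<not> (\<exists>k\<in>K. \<sigma> k \<noteq> \<tau> k)"
  have "\<sigma> x = \<tau> x" for x
    by (cases "x \<in> K") (use * assms in \<open>auto simp: chars_def\<close>)
  then show False using assms by auto
qed

text \<open>The operator of the idempotent e_\<sigma> of K over \<Omega>. Its effect is prescribed
  on stable subsets Y, so that it can also be evaluated at functionals that merely extend a
  character of K.\<close>

definition projection :: "('a \<Rightarrow> 'f alg_closure) \<Rightarrow> (('a \<Rightarrow> 'f alg_closure) \<Rightarrow> 'a \<Rightarrow> 'f alg_closure) \<Rightarrow> bool"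
  where "projection \<sigma> E \<longleftrightarrow> E \<in> left_ops K \<and>
    (\<forall>\<chi>\<in>chars K. \<forall>\<phi> Y. (\<forall>k\<in>K. \<forall>a\<in>Y. k \<bullet> a \<in> Y \<and> \<phi> (k \<bullet> a) = \<chi> k * \<phi> a) \<longrightarrow>
      (\<forall>a\<in>Y. E \<phi> a = (if \<chi> = \<sigma> then \<phi> a else 0)))"

text \<open>\<open>E\<close> is the Lagrange product of the factors \<open>(k - \<chi> k) / (\<sigma> k - \<chi> k)\<close>, one for each
  character \<open>\<chi> \<noteq> \<sigma>\<close>.\<close>

lemma projection_exists:
  assumes \<sigma>: "\<sigma> \<in> chars K"
  shows "\<exists>E. projection \<sigma> E"
proof -
  define weight_on where "weight_on = (\<lambda>\<chi> (\<phi> :: 'a \<Rightarrow> 'f alg_closure) Y.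
    \<forall>k\<in>K. \<forall>a\<in>Y. k \<bullet> a \<in> Y \<and> \<phi> (k \<bullet> a) = \<chi> k * \<phi> a)"
  define proj where "proj = (\<lambda>E \<chi>. \<forall>\<phi> Y. weight_on \<chi> \<phi> Y \<longrightarrow>
    (\<forall>a\<in>Y. E \<phi> a = (if \<chi> = \<sigma> then \<phi> a else 0)))"
  have "\<exists>E\<in>left_ops K. \<forall>\<chi>\<in>insert \<sigma> C. proj E \<chi>" if "finite C" "C \<subseteq> chars K - {\<sigma>}" for C
    using that
  proof (induction C rule: finite_induct)
    case empty
    have "(\<lambda>\<phi> a. \<phi> (\<e> \<bullet> a)) \<in> left_ops K" by (rule left_ops.mult) (rule K_unit)
    then show ?case by (rule rev_bexI) (simp add: unit_left proj_def)
  next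
    case (insert \<chi>' C)
    then obtain E where E: "E \<in> left_ops K" "\<And>\<chi>. \<chi> \<in> insert \<sigma> C \<Longrightarrow> proj E \<chi>" by blast
    obtain k where k: "k \<in> K" "\<sigma> k \<noteq> \<chi>' k" using chars_differ[OF \<sigma>, of \<chi>'] insert.prems by blast
    \<comment> \<open>One Lagrange factor; the identity is written as left multiplication by the
      unit so that it belongs to \<open>left_ops\<close>. On weight \<chi> the factor acts by the
      scalar t below, which is 1 for \<sigma> and 0 for the new character.\<close>
    define D where "D = (\<lambda>(\<phi> :: 'a \<Rightarrow> 'f alg_closure).
      fun_scale (1 / (\<sigma> k - \<chi>' k)) ((\<lambda>a. \<phi> (k \<bullet> a)) + fun_scale (- \<chi>' k) (\<lambda>a. \<phi> (\<e> \<bullet> a))))"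
    have D: "D \<in> left_ops K" unfolding D_def
      by (rule left_ops.scale[OF left_ops.add[OF left_ops.mult[OF k(1)] left_ops.scale[OF left_ops.mult[OF K_unit]]]])
    have "proj (\<lambda>\<phi>. E (D \<phi>)) \<chi>" if \<chi>: "\<chi> \<in> insert \<sigma> (insert \<chi>' C)" for \<chi>
      unfolding proj_def
    proof (intro allI impI ballI)
      fix \<phi> Y a assume Y: "weight_on \<chi> \<phi> Y" and a: "a \<in> Y"
      define t where "t = (\<chi> k - \<chi>' k) / (\<sigma> k - \<chi>' k)"
      have "E (D \<phi>) a = E (fun_scale t \<phi>) a"
      proof (rule left_ops_local[OF E(1)])
        show "D \<phi> b = fun_scale t \<phi> b" if "b \<in> Y" for b
        proof -
          have "\<phi> (k \<bullet> b) = \<chi> k * \<phi> b" using Y that k(1) by (simp add: weight_on_def)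
          then have "D \<phi> b = 1 / (\<sigma> k - \<chi>' k) * (\<chi> k * \<phi> b + (- \<chi>' k) * \<phi> b)"
            by (simp only: D_def fun_scale_apply plus_fun_apply unit_left)
          also have "\<dots> = t * \<phi> b" by (simp only: t_def) (simp add: left_diff_distrib)
          finally show ?thesis by (simp only: fun_scale_apply)
        qed
        show "k \<bullet> b \<in> Y" if "k \<in> K" "b \<in> Y" for k b using Y that by (simp add: weight_on_def)
      qed (rule a)
      then have "E (D \<phi>) a = t * E \<phi> a" by (simp only: left_ops_scale[OF E(1)] fun_scale_apply)
      also have "\<dots> = (if \<chi> = \<sigma> then \<phi> a else 0)"
      proof (cases "\<chi> = \<chi>'")
        case True
        then have "t = 0" "\<chi> \<noteq> \<sigma>" using k by (auto simp: t_def)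
        then show ?thesis by simp
      next
        case False
        then have "proj E \<chi>" using \<chi> by (intro E(2)) simp
        then have "E \<phi> a = (if \<chi> = \<sigma> then \<phi> a else 0)" using Y a unfolding proj_def by blast
        moreover have "t = 1" if "\<chi> = \<sigma>" using k(2) that by (simp add: t_def)
        ultimately show ?thesis by simp
      qed
      finally show "E (D \<phi>) a = (if \<chi> = \<sigma> then \<phi> a else 0)" .
    qed
    moreover have "(\<lambda>\<phi>. E (D \<phi>)) \<in> left_ops K" using E(1) D by (rule left_ops.comp)
    ultimately show ?case by (intro bexI[of _ "\<lambda>\<phi>. E (D \<phi>)"] ballI)
  qed
  moreover have "finite (chars K - {\<sigma>})" using finite_chars by simp
  ultimately obtain E where E: "E \<in> left_ops K" "\<forall>\<chi>\<in>insert \<sigma> (chars K - {\<sigma>}). proj E \<chi>" by blast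
  have "insert \<sigma> (chars K - {\<sigma>}) = chars K" using \<sigma> by blast
  with E(2) have "\<forall>\<chi>\<in>chars K. proj E \<chi>" by simp
  then have "projection \<sigma> E"
    unfolding projection_def proj_def weight_on_def by (rule conjI[OF E(1)])
  then show ?thesis by (intro exI[of _ E])
qed

lemma projection_weight_on:
  assumes "projection \<sigma> E" "\<chi> \<in> chars K" "\<And>k a. k \<in> K \<Longrightarrow> a \<in> Y \<Longrightarrow> k \<bullet> a \<in> Y"
    "\<And>k a. k \<in> K \<Longrightarrow> a \<in> Y \<Longrightarrow> \<phi> (k \<bullet> a) = \<chi> k * \<phi> a" "a \<in> Y"
  shows "E \<phi> a = (if \<chi> = \<sigma> then \<phi> a else 0)"
proof -
  have "\<forall>k\<in>K. \<forall>a\<in>Y. k \<bullet> a \<in> Y \<and> \<phi> (k \<bullet> a) = \<chi> k * \<phi> a" using assms(3,4) by simp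
  from conjunct2[OF assms(1)[unfolded projection_def], THEN bspec, OF assms(2),
      THEN spec, of \<phi>, THEN spec, of Y, THEN mp, OF this] assms(5)
  show ?thesis by (rule bspec)
qed

lemma projection_weight:
  assumes "projection \<sigma> E" "\<chi> \<in> chars K" "\<phi> \<in> left_weight K \<chi>"
  shows "E \<phi> = (if \<chi> = \<sigma> then \<phi> else 0)"
proof
  fix a
  have "E \<phi> a = (if \<chi> = \<sigma> then \<phi> a else 0)"
    by (rule projection_weight_on[OF assms(1,2), of UNIV]) (use assms(3) in \<open>simp_all add: left_weight_def\<close>)
  then show "E \<phi> a = (if \<chi> = \<sigma> then \<phi> else 0) a" by simp
qed

lemma projection_left_ops: "projection \<sigma> E \<Longrightarrow> E \<in> left_ops left_nucleus"
  unfolding projection_def using left_ops_mono K_left_nucleus by blast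

lemma span_dual_left: "dual \<subseteq> funs.span (\<Union>\<sigma>\<in>chars K. left_weight K \<sigma>)"
proof -
  have "dual \<subseteq> funs.span (\<Union>\<sigma>\<in>chars K. dual \<inter> left_weight K \<sigma>)"
    by (rule span_left_weights) (auto simp: subspace_dual dual_left_mult)
  also have "\<dots> \<subseteq> funs.span (\<Union>\<sigma>\<in>chars K. left_weight K \<sigma>)" by (rule funs.span_mono) auto
  finally show ?thesis .
qed

lemma projection_in_left_weight:
  assumes E: "projection \<sigma> E" and "\<phi> \<in> dual"
  shows "E \<phi> \<in> left_weight K \<sigma>"
proof -
  have E': "E \<in> left_ops K" using E by (simp add: projection_def)
  have "funs.span (\<Union>\<sigma>\<in>chars K. left_weight K \<sigma>) \<subseteq> {\<phi>. E \<phi> \<in> left_weight K \<sigma>}"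
  proof (rule funs.span_minimal)
    show "funs.subspace {\<phi>. E \<phi> \<in> left_weight K \<sigma>}"
      using subspace_left_weight[of K \<sigma>]
      by (auto simp: funs.subspace_def left_ops_0[OF E'] left_ops_add[OF E'] left_ops_scale[OF E'])
    show "(\<Union>\<sigma>\<in>chars K. left_weight K \<sigma>) \<subseteq> {\<phi>. E \<phi> \<in> left_weight K \<sigma>}"
      using projection_weight[OF E] funs.subspace_0[OF subspace_left_weight] by auto
  qed
  then show ?thesis using span_dual_left assms(2) by blast
qed

lemma sum_projections:
  assumes E: "\<And>\<sigma>. \<sigma> \<in> chars K \<Longrightarrow> projection \<sigma> (E \<sigma>)" and "\<phi> \<in> dual"
  shows "(\<Sum>\<sigma>\<in>chars K. E \<sigma> \<phi>) = \<phi>"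
proof -
  have E': "E \<sigma> \<in> left_ops K" if "\<sigma> \<in> chars K" for \<sigma> using E[OF that] by (simp add: projection_def)
  have "funs.span (\<Union>\<sigma>\<in>chars K. left_weight K \<sigma>) \<subseteq> {\<phi>. (\<Sum>\<sigma>\<in>chars K. E \<sigma> \<phi>) = \<phi>}"
  proof (rule funs.span_minimal)
    show "funs.subspace {\<phi>. (\<Sum>\<sigma>\<in>chars K. E \<sigma> \<phi>) = \<phi>}"
      unfolding funs.subspace_def
      by (auto simp: left_ops_0[OF E'] left_ops_add[OF E'] left_ops_scale[OF E'] sum.distrib
          funs.scale_sum_right[symmetric])
    show "(\<Union>\<sigma>\<in>chars K. left_weight K \<sigma>) \<subseteq> {\<phi>. (\<Sum>\<sigma>\<in>chars K. E \<sigma> \<phi>) = \<phi>}"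
    proof clarify
      fix \<chi> \<phi> assume \<chi>: "\<chi> \<in> chars K" "\<phi> \<in> left_weight K \<chi>"
      have "(\<Sum>\<sigma>\<in>chars K. E \<sigma> \<phi>) = (\<Sum>\<sigma>\<in>chars K. if \<chi> = \<sigma> then \<phi> else 0)"
        using projection_weight[OF E \<chi>] by (intro sum.cong) auto
      then show "(\<Sum>\<sigma>\<in>chars K. E \<sigma> \<phi>) = \<phi>" using \<chi> finite_chars by simp
    qed
  qed
  then show ?thesis using span_dual_left assms(2) by blast
qed

lemma right_weight_left_ops:
  assumes "T \<in> left_ops left_nucleus" "\<phi> \<in> right_weight K \<tau>"
  shows "T \<phi> \<in> right_weight K \<tau>"
proof (rule left_ops_closed[OF assms(1) subspace_right_weight _ assms(2)])
  fix x \<phi> assume "\<phi> \<in> right_weight K \<tau>"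
  then show "(\<lambda>a. \<phi> (x \<bullet> a)) \<in> right_weight K \<tau>"
    by (simp add: right_weight_def dual_left_mult K_right[symmetric])
qed

text \<open>Every pair of characters occurs in the dual with multiplicity one. This is the only
  property of K, beyond separability, that the comparison with K' uses.\<close>

definition one_dim_weights :: bool
  where "one_dim_weights \<longleftrightarrow> (\<forall>\<sigma>\<in>chars K. \<forall>\<tau>\<in>chars K. (\<exists>\<phi>\<in>bi_weight \<sigma> \<tau>. \<phi> \<noteq> 0) \<and>
    (\<forall>\<phi>\<in>bi_weight \<sigma> \<tau>. \<forall>\<psi>\<in>bi_weight \<sigma> \<tau>. \<phi> \<noteq> 0 \<longrightarrow> (\<exists>c. \<psi> = fun_scale c \<phi>)))"

text \<open>Since \<open>T\<close> commutes with right multiplications, the identity only has to be checked at the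
  unit, where all weight vectors of weight \<open>(\<sigma>, \<tau>)\<close> with \<open>\<sigma> \<noteq> \<tau>\<close> vanish. After splitting, it says
  that the diagonal entries \<open>e x e\<close> of \<open>x\<close> in the nucleus are scalars, \<open>e A e\<close> being
  one-dimensional.\<close>

lemma projection_sandwich:
  assumes one_dim: "one_dim_weights" and \<sigma>: "\<sigma> \<in> chars K" and E: "projection \<sigma> E"
    and T: "T \<in> left_ops left_nucleus"
  shows "\<exists>\<epsilon>. \<forall>\<phi>\<in>dual. E (T (E \<phi>)) = fun_scale \<epsilon> (E \<phi>)"
proof -
  note E' = projection_left_ops[OF E]
  have bw: "E (T \<phi>) \<in> bi_weight \<sigma> \<tau>" if "\<phi> \<in> right_weight K \<tau>" for \<phi> \<tau>
  proof -
    have "T \<phi> \<in> right_weight K \<tau>" using T that by (rule right_weight_left_ops)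
    then show ?thesis unfolding bi_weight_def
      using right_weight_left_ops[OF E'] projection_in_left_weight[OF E] by (auto simp: right_weight_def)
  qed
  \<comment> \<open>The scalar \<epsilon> is read off at weight (\<sigma>, \<sigma>), whose vectors
    are the only ones of left weight \<sigma> that can be nonzero at the unit.\<close>
  obtain \<phi>\<^sub>0 where \<phi>\<^sub>0: "\<phi>\<^sub>0 \<in> bi_weight \<sigma> \<sigma>" "\<phi>\<^sub>0 \<noteq> 0" using one_dim \<sigma> unfolding one_dim_weights_def by blast
  have "E (T \<phi>\<^sub>0) \<in> bi_weight \<sigma> \<sigma>" by (rule bw) (use \<phi>\<^sub>0(1) in \<open>simp add: bi_weight_def\<close>)
  then obtain \<epsilon> where \<epsilon>: "E (T \<phi>\<^sub>0) = fun_scale \<epsilon> \<phi>\<^sub>0" using one_dim \<sigma> \<phi>\<^sub>0 unfolding one_dim_weights_def by metis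
  define R where "R = (\<lambda>\<phi>. E (T (E \<phi>)) + fun_scale (- \<epsilon>) (E \<phi>))"
  have R: "R \<in> left_ops left_nucleus" unfolding R_def
    by (rule left_ops.add[OF left_ops.comp[OF E' left_ops.comp[OF T E']] left_ops.scale[OF E']])
  have R_unit: "R \<phi> \<e> = 0" if "\<phi> \<in> dual" for \<phi>
  proof -
    have "dual \<subseteq> funs.span (\<Union>\<sigma>\<in>chars K. \<Union>\<tau>\<in>chars K. dual \<inter> bi_weight \<sigma> \<tau>)"
      by (rule span_bi_weight) (auto simp: subspace_dual dual_left_mult dual_right_mult)
    also have "\<dots> \<subseteq> {\<phi>. R \<phi> \<e> = 0}"
    proof (rule funs.span_minimal)
      show "funs.subspace {\<phi>. R \<phi> \<e> = 0}"
        by (auto simp: funs.subspace_def left_ops_0[OF R] left_ops_add[OF R] left_ops_scale[OF R])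
      show "(\<Union>\<sigma>\<in>chars K. \<Union>\<tau>\<in>chars K. dual \<inter> bi_weight \<sigma> \<tau>) \<subseteq> {\<phi>. R \<phi> \<e> = 0}"
      proof clarify
        fix \<chi> \<tau> \<phi> assume \<chi>: "\<chi> \<in> chars K" and \<tau>: "\<tau> \<in> chars K" and \<phi>: "\<phi> \<in> bi_weight \<chi> \<tau>"
        show "R \<phi> \<e> = 0"
        proof (cases "\<chi> = \<sigma>")
          case False
          then have "E \<phi> = 0" using projection_weight[OF E \<chi>] \<phi> by (simp add: bi_weight_def)
          then show ?thesis by (simp add: R_def left_ops_0[OF T] left_ops_0[OF E'])
        next
          case True
          then have E\<phi>: "E \<phi> = \<phi>" using projection_weight[OF E \<chi>] \<phi> by (simp add: bi_weight_def)
          show ?thesis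
          proof (cases "\<tau> = \<sigma>")
            case True
            then obtain c where c: "\<phi> = fun_scale c \<phi>\<^sub>0"
              using one_dim \<sigma> \<phi>\<^sub>0 \<phi> \<open>\<chi> = \<sigma>\<close> unfolding one_dim_weights_def by metis
            have "E (T \<phi>) = fun_scale \<epsilon> \<phi>"
              unfolding c left_ops_scale[OF T] left_ops_scale[OF E'] \<epsilon> by (rule funs.scale_left_commute)
            then show ?thesis by (simp add: R_def E\<phi>)
          next
            case False
            then obtain k where k: "k \<in> K" "\<sigma> k \<noteq> \<tau> k" using chars_differ[OF \<sigma> \<tau>] by blast
            have unit_zero: "\<psi> \<e> = 0" if "\<psi> \<in> bi_weight \<sigma> \<tau>" for \<psi>
            proof -
              have "\<psi> (k \<bullet> \<e>) = \<sigma> k * \<psi> \<e>" "\<psi> (\<e> \<bullet> k) = \<tau> k * \<psi> \<e>"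
                using that k(1) by (simp_all add: bi_weight_def left_weight_def right_weight_def)
              then show ?thesis using k(2) by (simp add: unit_left unit_right)
            qed
            have "E (T \<phi>) \<in> bi_weight \<sigma> \<tau>" by (rule bw) (use \<phi> in \<open>simp add: bi_weight_def\<close>)
            then have "E (T \<phi>) \<e> = 0" "\<phi> \<e> = 0" using unit_zero \<phi> \<open>\<chi> = \<sigma>\<close> by blast+
            then show ?thesis by (simp add: R_def E\<phi>)
          qed
        qed
      qed
    qed
    finally show ?thesis using that by blast
  qed
  have "R \<phi> = 0" if "\<phi> \<in> dual" for \<phi>
  proof
    fix a
    have "R (\<lambda>b. \<phi> (b \<bullet> a)) \<e> = 0" by (rule R_unit) (rule dual_right_mult[OF that])
    then show "R \<phi> a = 0 a" by (simp add: left_ops_right_mult[OF R] unit_left)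
  qed
  then have "E (T (E \<phi>)) = fun_scale \<epsilon> (E \<phi>)" if "\<phi> \<in> dual" for \<phi>
    using that by (simp add: R_def fun_eq_iff)
  then show ?thesis by blast
qed

lemma finite_strict_order_minimal:
  assumes "finite S" "x \<in> S"
    and trans: "\<And>x y z. x \<in> S \<Longrightarrow> y \<in> S \<Longrightarrow> z \<in> S \<Longrightarrow> R x y \<Longrightarrow> R y z \<Longrightarrow> R x z"
    and irrefl: "\<And>x. x \<in> S \<Longrightarrow> \<not> R x x"
  shows "\<exists>m\<in>S. \<forall>y\<in>S. \<not> R y m"
proof -
  define r where "r = {(x, y). x \<in> S \<and> y \<in> S \<and> R x y}"
  have "trans r" using trans unfolding r_def trans_def by blast
  then have "acyclic r" using irrefl by (auto simp: acyclic_def r_def trancl_id)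
  moreover have "finite r" by (rule finite_subset[of _ "S \<times> S"]) (use assms(1) in \<open>auto simp: r_def\<close>)
  ultimately have "wf r" by (simp add: finite_acyclic_wf)
  then obtain m where "m \<in> S" "\<And>y. (y, m) \<in> r \<Longrightarrow> y \<notin> S" using wfE_min[OF _ assms(2)] by metis
  then show ?thesis unfolding r_def by blast
qed

text \<open>The operators vanishing on \<open>U\<close> have no diagonal entries, so \<open>\<sigma>\<close> leads to \<open>\<sigma>'\<close> if some of
  them has a nonzero entry from \<open>\<sigma>\<close> to \<open>\<sigma>'\<close> defines a strict order. Hence they act by triangular
  matrices with zero diagonal.\<close>

lemma idempotent_left_op_zero:
  assumes one_dim: "one_dim_weights" and U: "U \<subseteq> dual"
    and meets: "\<And>\<sigma>. \<sigma> \<in> chars K \<Longrightarrow> \<exists>\<phi>\<in>U. \<phi> \<noteq> 0 \<and> \<phi> \<in> left_weight K \<sigma>"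
    and P: "P \<in> left_ops left_nucleus" "\<And>\<phi>. \<phi> \<in> U \<Longrightarrow> P \<phi> = 0"
    and idem: "\<And>\<phi>. \<phi> \<in> dual \<Longrightarrow> P (P \<phi>) = P \<phi>"
    and "\<phi> \<in> dual"
  shows "P \<phi> = 0"
proof (rule ccontr)
  assume "P \<phi> \<noteq> 0"
  have "\<forall>\<sigma>. \<exists>E. \<sigma> \<in> chars K \<longrightarrow> projection \<sigma> E" using projection_exists by blast
  then obtain E where "\<forall>\<sigma>. \<sigma> \<in> chars K \<longrightarrow> projection \<sigma> (E \<sigma>)" by (rule choice[THEN exE])
  then have E: "projection \<sigma> (E \<sigma>)" if "\<sigma> \<in> chars K" for \<sigma> using that by blast
  have E': "E \<sigma> \<in> left_ops left_nucleus" if "\<sigma> \<in> chars K" for \<sigma>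
    by (rule projection_left_ops[OF E[OF that]])
  define I where "I = {T \<in> left_ops left_nucleus. \<forall>\<phi>\<in>U. T \<phi> = 0}"
  have I_ops: "T \<in> left_ops left_nucleus" if "T \<in> I" for T using that by (simp add: I_def)
  \<comment> \<open>The diagonal entry is one scalar valid on the whole dual; a nonzero vector of
    weight \<sigma> in U, which T kills, shows that it is zero.\<close>
  have diag: "E \<sigma> (T (E \<sigma> \<chi>)) = 0" if \<sigma>: "\<sigma> \<in> chars K" and T: "T \<in> I" and "\<chi> \<in> dual" for \<sigma> T \<chi>
  proof -
    obtain \<epsilon> where \<epsilon>: "\<forall>\<phi>\<in>dual. E \<sigma> (T (E \<sigma> \<phi>)) = fun_scale \<epsilon> (E \<sigma> \<phi>)"
      using projection_sandwich[OF one_dim \<sigma> E[OF \<sigma>] I_ops[OF T]] by (rule exE)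
    obtain \<psi> where \<psi>: "\<psi> \<in> U" "\<psi> \<noteq> 0" "\<psi> \<in> left_weight K \<sigma>" using meets[OF \<sigma>] by blast
    have E\<psi>: "E \<sigma> \<psi> = \<psi>" using projection_weight[OF E[OF \<sigma>] \<sigma> \<psi>(3)] by simp
    have T\<psi>: "T \<psi> = 0" using T \<psi>(1) by (simp add: I_def)
    have "E \<sigma> (T (E \<sigma> \<psi>)) = fun_scale \<epsilon> (E \<sigma> \<psi>)" using \<epsilon> \<psi>(1) U by blast
    then have "fun_scale \<epsilon> \<psi> = 0" unfolding E\<psi> T\<psi> left_ops_0[OF E'[OF \<sigma>]] by (rule sym)
    then have "\<epsilon> = 0" using \<psi>(2) funs.scale_eq_0_iff[of \<epsilon> \<psi>] by metis
    then show ?thesis using \<epsilon> \<open>\<chi> \<in> dual\<close> by simp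
  qed
  \<comment> \<open>The right weight spaces span the dual, so P is nonzero on one of them. The rest
    of the proof stays in this column, which every operator in use preserves.\<close>
  have "\<exists>\<tau>\<in>chars K. \<exists>\<psi>\<in>right_weight K \<tau>. P \<psi> \<noteq> 0"
  proof (rule ccontr)
    assume *: "\<not> ?thesis"
    have "dual \<subseteq> funs.span (\<Union>\<tau>\<in>chars K. dual \<inter> right_weight K \<tau>)"
      by (rule span_right_weights) (auto simp: subspace_dual dual_right_mult)
    then have in_span: "\<phi> \<in> funs.span (\<Union>\<tau>\<in>chars K. dual \<inter> right_weight K \<tau>)" using \<open>\<phi> \<in> dual\<close> by (rule subsetD)
    have "P \<chi> = 0" if "\<chi> \<in> (\<Union>\<tau>\<in>chars K. dual \<inter> right_weight K \<tau>)" for \<chi> using * that by blast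
    then have "P \<phi> = 0" using left_ops_zero_on_span[OF P(1) _ in_span] by blast
    then show False using \<open>P \<phi> \<noteq> 0\<close> by (rule notE[rotated])
  qed
  then obtain \<tau> \<psi>' where \<tau>: "\<tau> \<in> chars K" and \<psi>': "\<psi>' \<in> right_weight K \<tau>" "P \<psi>' \<noteq> 0" by blast
  define \<psi> where "\<psi> = P \<psi>'"
  have \<psi>: "\<psi> \<in> right_weight K \<tau>" unfolding \<psi>_def using P(1) \<psi>'(1) by (rule right_weight_left_ops)
  have rw_dual: "\<chi> \<in> dual" if "\<chi> \<in> right_weight K \<tau>" for \<chi> using that by (simp add: right_weight_def)
  have bw_rw: "\<chi> \<in> right_weight K \<tau>" if "\<chi> \<in> bi_weight \<sigma> \<tau>" for \<sigma> \<chi> using that by (simp add: bi_weight_def)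
  have P\<psi>: "P \<psi> = \<psi>" unfolding \<psi>_def by (rule idem[OF rw_dual[OF \<psi>'(1)]])
  have E_bw: "E \<sigma> \<chi> \<in> bi_weight \<sigma> \<tau>" if "\<sigma> \<in> chars K" "\<chi> \<in> right_weight K \<tau>" for \<sigma> \<chi>
    using right_weight_left_ops[OF E'[OF that(1)] that(2)] projection_in_left_weight[OF E[OF that(1)] rw_dual[OF that(2)]]
    by (simp add: bi_weight_def)
  define S where "S = {\<sigma> \<in> chars K. E \<sigma> \<psi> \<noteq> 0}"
  define leads where "leads = (\<lambda>\<sigma> \<sigma>'. \<exists>T\<in>I. \<exists>\<chi>\<in>bi_weight \<sigma> \<tau>. E \<sigma>' (T \<chi>) \<noteq> 0)"
  have S: "\<sigma> \<in> chars K" if "\<sigma> \<in> S" for \<sigma> using that by (simp add: S_def)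
  have trans: "leads \<sigma>\<^sub>1 \<sigma>\<^sub>3"
    if \<sigma>: "\<sigma>\<^sub>1 \<in> S" "\<sigma>\<^sub>2 \<in> S" "\<sigma>\<^sub>3 \<in> S" and l: "leads \<sigma>\<^sub>1 \<sigma>\<^sub>2" "leads \<sigma>\<^sub>2 \<sigma>\<^sub>3" for \<sigma>\<^sub>1 \<sigma>\<^sub>2 \<sigma>\<^sub>3
  proof -
    obtain T \<chi> where 1: "T \<in> I" "\<chi> \<in> bi_weight \<sigma>\<^sub>1 \<tau>" "E \<sigma>\<^sub>2 (T \<chi>) \<noteq> 0"
      using l(1) unfolding leads_def by (elim bexE)
    obtain T' \<chi>' where 2: "T' \<in> I" "\<chi>' \<in> bi_weight \<sigma>\<^sub>2 \<tau>" "E \<sigma>\<^sub>3 (T' \<chi>') \<noteq> 0"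
      using l(2) unfolding leads_def by (elim bexE)
    note E2 = E'[OF S[OF \<sigma>(2)]] and E3 = E'[OF S[OF \<sigma>(3)]]
    have "T \<chi> \<in> right_weight K \<tau>" using right_weight_left_ops[OF I_ops[OF 1(1)] bw_rw[OF 1(2)]] .
    then have "E \<sigma>\<^sub>2 (T \<chi>) \<in> bi_weight \<sigma>\<^sub>2 \<tau>" by (rule E_bw[OF S[OF \<sigma>(2)]])
    \<comment> \<open>Both vectors lie on the line of weight (\<open>\<sigma>\<^sub>2\<close>,
      \<tau>), so the nonzero vector reached by T may replace \<chi>', and the two entries compose
      to a nonzero one.\<close>
    then obtain c where c: "\<chi>' = fun_scale c (E \<sigma>\<^sub>2 (T \<chi>))"
      using one_dim[unfolded one_dim_weights_def, rule_format, OF S[OF \<sigma>(2)] \<tau>] 1(3) 2(2) by blast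
    have "E \<sigma>\<^sub>3 (T' \<chi>') = fun_scale c (E \<sigma>\<^sub>3 (T' (E \<sigma>\<^sub>2 (T \<chi>))))"
      unfolding c left_ops_scale[OF I_ops[OF 2(1)]] left_ops_scale[OF E3] ..
    then have nz: "E \<sigma>\<^sub>3 (T' (E \<sigma>\<^sub>2 (T \<chi>))) \<noteq> 0" using 2(3) funs.scale_zero_right by metis
    have "(\<lambda>\<phi>. T' (E \<sigma>\<^sub>2 (T \<phi>))) \<in> left_ops left_nucleus"
      by (rule left_ops.comp[OF I_ops[OF 2(1)] left_ops.comp[OF E2 I_ops[OF 1(1)]]])
    moreover have "T' (E \<sigma>\<^sub>2 (T \<phi>)) = 0" if "\<phi> \<in> U" for \<phi>
    proof -
      have "T \<phi> = 0" using 1(1) that by (simp add: I_def)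
      then show ?thesis by (simp only: left_ops_0[OF E2] left_ops_0[OF I_ops[OF 2(1)]])
    qed
    ultimately have "(\<lambda>\<phi>. T' (E \<sigma>\<^sub>2 (T \<phi>))) \<in> I" unfolding I_def by simp
    then show ?thesis unfolding leads_def using 1(2) nz by (intro bexI)
  qed
  have irrefl: "\<not> leads \<sigma> \<sigma>" if \<sigma>: "\<sigma> \<in> S" for \<sigma>
  proof
    assume "leads \<sigma> \<sigma>"
    then obtain T \<chi> where T: "T \<in> I" "\<chi> \<in> bi_weight \<sigma> \<tau>" "E \<sigma> (T \<chi>) \<noteq> 0"
      unfolding leads_def by (elim bexE)
    have "\<chi> \<in> left_weight K \<sigma>" using T(2) by (simp add: bi_weight_def)
    then have "E \<sigma> \<chi> = \<chi>" using projection_weight[OF E[OF S[OF \<sigma>]] S[OF \<sigma>]] by simp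
    then show False using diag[OF S[OF \<sigma>] T(1) rw_dual[OF bw_rw[OF T(2)]]] T(3) by simp
  qed
  have decomp: "(\<Sum>\<sigma>\<in>chars K. E \<sigma> \<psi>) = \<psi>" by (rule sum_projections[OF E rw_dual[OF \<psi>]])
  have "\<exists>\<sigma>. \<sigma> \<in> S"
  proof (rule ccontr)
    assume "\<not> (\<exists>\<sigma>. \<sigma> \<in> S)"
    then have "(\<Sum>\<sigma>\<in>chars K. E \<sigma> \<psi>) = 0" by (intro sum.neutral) (simp add: S_def)
    then show False using decomp \<psi>'(2) by (simp add: \<psi>_def)
  qed
  then obtain \<sigma>\<^sub>0 where "\<sigma>\<^sub>0 \<in> S" by (rule exE)
  moreover have "finite S" using finite_chars by (simp add: S_def)
  ultimately obtain \<sigma> where \<sigma>: "\<sigma> \<in> S" and min: "\<And>\<sigma>'. \<sigma>' \<in> S \<Longrightarrow> \<not> leads \<sigma>' \<sigma>"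
    using finite_strict_order_minimal[of S \<sigma>\<^sub>0 leads] trans irrefl by blast
  note \<sigma>K = S[OF \<sigma>]
  have "P \<in> I" using P by (simp add: I_def)
  \<comment> \<open>No character in the support of \<psi> leads to the minimal \<sigma>. Expanding
    \<psi> = P \<psi> therefore makes the \<sigma>-component of \<psi> vanish, although \<sigma>
    belongs to the support.\<close>
  have zero: "E \<sigma> (P (E \<sigma>' \<psi>)) = 0" if \<sigma>': "\<sigma>' \<in> chars K" for \<sigma>'
  proof (cases "\<sigma>' \<in> S")
    case True
    from min[OF True] show ?thesis unfolding leads_def using \<open>P \<in> I\<close> E_bw[OF \<sigma>' \<psi>] by blast
  next
    case False
    then have "E \<sigma>' \<psi> = 0" using \<sigma>' by (simp add: S_def)
    then show ?thesis by (simp only: left_ops_0[OF P(1)] left_ops_0[OF E'[OF \<sigma>K]])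
  qed
  have "E \<sigma> \<psi> = E \<sigma> (P (\<Sum>\<sigma>'\<in>chars K. E \<sigma>' \<psi>))" by (simp only: decomp P\<psi>)
  also have "\<dots> = (\<Sum>\<sigma>'\<in>chars K. E \<sigma> (P (E \<sigma>' \<psi>)))"
    unfolding left_ops_sum[OF P(1)] left_ops_sum[OF E'[OF \<sigma>K]] ..
  also have "\<dots> = 0" by (rule sum.neutral) (use zero in blast)
  finally show False using \<sigma> by (simp add: S_def)
qed

text \<open>If \<sigma>' did not occur on U, the projection of K' for \<sigma>' would be an
  idempotent killing U, hence zero on the dual. But it preserves the value 1 at the unit of a
  functional extending \<sigma>'.\<close>

lemma left_weight_meets:
  assumes one_dim: "one_dim_weights" and K': "separable_subalgebra scale mul unit K'"
    and U: "funs.subspace U" "U \<subseteq> dual" "\<And>x \<phi>. x \<in> K' \<Longrightarrow> \<phi> \<in> U \<Longrightarrow> (\<lambda>a. \<phi> (x \<bullet> a)) \<in> U"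
    and meets: "\<And>\<sigma>. \<sigma> \<in> chars K \<Longrightarrow> \<exists>\<phi>\<in>U. \<phi> \<noteq> 0 \<and> \<phi> \<in> left_weight K \<sigma>"
    and \<sigma>': "\<sigma>' \<in> chars K'"
  shows "\<exists>\<phi>\<in>U. \<phi> \<noteq> 0 \<and> \<phi> \<in> left_weight K' \<sigma>'"
proof (rule ccontr)
  assume none: "\<not> ?thesis"
  interpret K': separable_subalgebra scale mul unit K' by (rule K')
  obtain P where P: "K'.projection \<sigma>' P" using K'.projection_exists[OF \<sigma>'] by blast
  note P' = K'.projection_left_ops[OF P]
  have PU: "P \<phi> = 0" if "\<phi> \<in> U" for \<phi>
  proof (rule left_ops_zero_on_span[OF P'])
    show "\<phi> \<in> funs.span (\<Union>\<chi>\<in>chars K'. U \<inter> left_weight K' \<chi>)" using K'.span_left_weights[OF U] that by blast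
    fix \<psi> assume "\<psi> \<in> (\<Union>\<chi>\<in>chars K'. U \<inter> left_weight K' \<chi>)"
    then obtain \<chi> where \<chi>: "\<chi> \<in> chars K'" "\<psi> \<in> U" "\<psi> \<in> left_weight K' \<chi>" by blast
    show "P \<psi> = 0"
    proof (cases "\<chi> = \<sigma>'")
      case True
      then have "\<psi> = 0" using none \<chi> by blast
      then show ?thesis by (simp add: left_ops_0[OF P'])
    qed (use K'.projection_weight[OF P \<chi>(1,3)] in simp)
  qed
  have idem: "P (P \<phi>) = P \<phi>" if "\<phi> \<in> dual" for \<phi>
    using K'.projection_weight[OF P \<sigma>' K'.projection_in_left_weight[OF P that]] by simp
  \<comment> \<open>Such a \<phi> satisfies the weight condition on K' only, which is the reason for
    the localised form of projections.\<close>
  obtain \<phi> where \<phi>: "\<phi> \<in> dual" "\<forall>x\<in>K'. \<phi> x = \<sigma>' x"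
    using dual_extend[OF K'.K_subspace, of \<sigma>'] \<sigma>' by (auto simp: chars_def)
  have "\<phi> \<e> = 1" using \<phi>(2) \<sigma>' K'.K_unit by (simp add: chars_def)
  have P_unit: "P \<phi> \<e> = (if \<sigma>' = \<sigma>' then \<phi> \<e> else 0)"
  proof (rule K'.projection_weight_on[OF P \<sigma>' K'.K_mult _ K'.K_unit])
    show "\<phi> (k \<bullet> a) = \<sigma>' k * \<phi> a" if "k \<in> K'" "a \<in> K'" for k a
      using \<phi>(2) \<sigma>' K'.K_mult[OF that] that by (simp add: chars_def)
  qed
  have "P \<phi> = 0"
    by (rule idempotent_left_op_zero[OF one_dim U(2) meets P' PU idem \<phi>(1)])
  then have "\<phi> \<e> = 0" using P_unit by (simp only: zero_fun_apply if_True simp_thms)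
  then show False using \<open>\<phi> \<e> = 1\<close> by simp
qed

lemma opposite_one_dim_weights:
  assumes "one_dim_weights"
  shows "separable_subalgebra.one_dim_weights scale (\<lambda>x y. y \<bullet> x) \<e> K"
proof -
  interpret opp: separable_subalgebra scale "\<lambda>x y. y \<bullet> x" \<e> K by (rule opposite)
  have "opp.bi_weight \<sigma> \<tau> = bi_weight \<tau> \<sigma>" for \<sigma> \<tau>
    unfolding opp.bi_weight_def bi_weight_def opposite_left_weight opposite_right_weight by blast
  then show ?thesis using assms
    unfolding opp.one_dim_weights_def one_dim_weights_def opposite_chars by auto
qed

text \<open>The first application takes for U the functionals of right weight \<tau> for K. It shows
  that those of left weight \<sigma>' for K' meet every right weight of K, so they can serve as U in
  the opposite algebra.\<close>

lemma bi_weight_transfer: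
  assumes one_dim: "one_dim_weights" and K': "separable_subalgebra scale mul unit K'"
    and \<sigma>': "\<sigma>' \<in> chars K'" and \<tau>': "\<tau>' \<in> chars K'"
  shows "\<exists>\<phi>\<in>left_weight K' \<sigma>' \<inter> right_weight K' \<tau>'. \<phi> \<noteq> 0"
proof -
  interpret K': separable_subalgebra scale mul unit K' by (rule K')
  interpret opp: separable_subalgebra scale "\<lambda>x y. y \<bullet> x" \<e> K by (rule opposite)
  have 1: "\<exists>\<phi>\<in>left_weight K' \<sigma>'. \<phi> \<noteq> 0 \<and> \<phi> \<in> right_weight K \<tau>" if \<tau>: "\<tau> \<in> chars K" for \<tau>
  proof -
    have "\<exists>\<phi>\<in>right_weight K \<tau>. \<phi> \<noteq> 0 \<and> \<phi> \<in> left_weight K' \<sigma>'"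
    proof (rule left_weight_meets[OF one_dim K' subspace_right_weight _ _ _ \<sigma>'])
      show "right_weight K \<tau> \<subseteq> dual" by (auto simp: right_weight_def)
      show "(\<lambda>a. \<phi> (x \<bullet> a)) \<in> right_weight K \<tau>" if "\<phi> \<in> right_weight K \<tau>" for x \<phi>
        using that by (simp add: right_weight_def dual_left_mult K_right[symmetric])
      show "\<exists>\<phi>\<in>right_weight K \<tau>. \<phi> \<noteq> 0 \<and> \<phi> \<in> left_weight K \<sigma>" if "\<sigma> \<in> chars K" for \<sigma>
        using one_dim that \<tau> unfolding one_dim_weights_def bi_weight_def by blast
    qed
    then show ?thesis by blast
  qed
  have "\<exists>\<phi>\<in>left_weight K' \<sigma>'. \<phi> \<noteq> 0 \<and> \<phi> \<in> opp.left_weight K' \<tau>'"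
  proof (rule opp.left_weight_meets[OF opposite_one_dim_weights[OF one_dim] K'.opposite subspace_left_weight])
    show "left_weight K' \<sigma>' \<subseteq> opp.dual" by (auto simp: left_weight_def)
    show "(\<lambda>a. \<phi> (a \<bullet> x)) \<in> left_weight K' \<sigma>'" if "\<phi> \<in> left_weight K' \<sigma>'" for x \<phi>
      using that by (simp add: left_weight_def dual_right_mult K'.K_left)
    show "\<exists>\<phi>\<in>left_weight K' \<sigma>'. \<phi> \<noteq> 0 \<and> \<phi> \<in> opp.left_weight K \<sigma>" if "\<sigma> \<in> opp.chars K" for \<sigma>
      using that 1 unfolding opposite_left_weight opposite_chars by blast
    show "\<tau>' \<in> opp.chars K'" using \<tau>' by (simp add: K'.opposite_chars)
  qed
  then show ?thesis unfolding K'.opposite_left_weight by blast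
qed

lemma generator_one_dim_weights:
  assumes "generator v"
  shows "one_dim_weights"
  unfolding one_dim_weights_def
proof (intro ballI conjI impI)
  fix \<sigma> \<tau> assume \<sigma>\<tau>: "\<sigma> \<in> chars K" "\<tau> \<in> chars K"
  show "\<exists>\<phi>\<in>bi_weight \<sigma> \<tau>. \<phi> \<noteq> 0" by (rule generator_bi_weight_exists[OF assms \<sigma>\<tau>])
  fix \<phi> \<psi> assume "\<phi> \<in> bi_weight \<sigma> \<tau>" "\<psi> \<in> bi_weight \<sigma> \<tau>" "\<phi> \<noteq> 0"
  then show "\<exists>c. \<psi> = fun_scale c \<phi>" by (rule generator_bi_weight_unique[OF assms])
qed

text \<open>A formal sum acting as zero on A evaluates to zero at each pair of characters of K',
  because some nonzero functional has that weight. Minimality then follows by counting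
  dimensions.\<close>

lemma minimally_faithful_transfer:
  assumes "minimally_faithful tensor_square bimodule"
    and K': "separable_subalgebra scale mul unit K'" and dim: "dim UNIV = (dim K')\<^sup>2"
  shows "minimally_faithful (tensor_algebra (algebra_on K') (algebra_on K')) bimodule"
proof -
  interpret K': separable_subalgebra scale mul unit K' by (rule K')
  obtain v where "generator v" using minimally_faithful_generator[OF assms(1)] by blast
  then have one_dim: "one_dim_weights" by (rule generator_one_dim_weights)
  have "faithful K'.tensor_square bimodule"
    unfolding K'.faithful_bimodule_iff
  proof (intro allI impI)
    fix p assume p: "Poly_Mapping.keys p \<subseteq> K' \<times> K'" and zero: "\<forall>a. formal_act p a = 0"
    have "K'.tensor_char \<sigma> \<tau> p = 0" if st: "\<sigma> \<in> chars K'" "\<tau> \<in> chars K'" for \<sigma> \<tau>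
    proof -
      obtain \<phi> where \<phi>: "\<phi> \<in> K'.bi_weight \<sigma> \<tau>" "\<phi> \<noteq> 0"
        using bi_weight_transfer[OF one_dim K' st] by (auto simp: K'.bi_weight_def)
      then obtain a where "\<phi> a \<noteq> 0" by (auto simp: fun_eq_iff)
      moreover have "\<phi> 0 = 0" using \<phi>(1) by (simp add: K'.bi_weight_def left_weight_def dual_0)
      ultimately show ?thesis using K'.bi_weight_formal_act[OF \<phi>(1) p, of a] zero by simp
    qed
    then show "p \<in> K'.null_sums" using p by (simp add: K'.null_sums_def)
  qed
  with dim show ?thesis by (rule K'.minimally_faithful_if_dim)
qed

end

section \<open>Etale subalgebras\<close>

lemma ring_iso_mult_add:
  assumes "h \<in> ring_iso B C" "x \<in> carrier B" "y \<in> carrier B"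
  shows "h (x \<oplus>\<^bsub>B\<^esub> y) = h x \<oplus>\<^bsub>C\<^esub> h y" "h (x \<otimes>\<^bsub>B\<^esub> y) = h x \<otimes>\<^bsub>C\<^esub> h y" "h x \<in> carrier C"
  using assms by (auto simp: ring_iso_def ring_hom_def)

context nonassoc_algebra
begin

text \<open>Presents the isomorphism through its coordinates, as an embedding into a product, so
  that later arguments take place in one field at a time.\<close>

lemma etale_subalgebraE:
  assumes "etale_subalgebra K"
  obtains r :: nat and L :: "nat \<Rightarrow> ('f, 'a) module" and h where
    "subspace K" "\<e> \<in> K" "\<And>x y. x \<in> K \<Longrightarrow> y \<in> K \<Longrightarrow> x \<bullet> y \<in> K"
    "\<And>i. i < r \<Longrightarrow> finite_separable_extension (L i)"
    "\<And>x y i. x \<in> K \<Longrightarrow> y \<in> K \<Longrightarrow> i < r \<Longrightarrow> h (x + y) i = h x i \<oplus>\<^bsub>L i\<^esub> h y i"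
    "\<And>x y i. x \<in> K \<Longrightarrow> y \<in> K \<Longrightarrow> i < r \<Longrightarrow> h (x \<bullet> y) i = h x i \<otimes>\<^bsub>L i\<^esub> h y i"
    "\<And>i. i < r \<Longrightarrow> h \<e> i = \<one>\<^bsub>L i\<^esub>"
    "\<And>c x i. x \<in> K \<Longrightarrow> i < r \<Longrightarrow> h (c *s x) i = c \<odot>\<^bsub>L i\<^esub> h x i"
    "\<And>x i. x \<in> K \<Longrightarrow> i < r \<Longrightarrow> h x i \<in> carrier (L i)"
    "\<And>x y. x \<in> K \<Longrightarrow> y \<in> K \<Longrightarrow> (\<And>i. i < r \<Longrightarrow> h x i = h y i) \<Longrightarrow> x = y"
proof -
  obtain r :: nat and L :: "nat \<Rightarrow> ('f, 'a) module" and h where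
    L: "\<forall>i<r. finite_separable_extension (L i)" and
    h: "h \<in> algebra_iso (algebra_on K) (product_algebra {..<r} L)"
    using assms by (auto simp: etale_subalgebra_def etale_algebra_def)
  have iso: "h \<in> ring_iso (algebra_on K) (product_algebra {..<r} L)"
    and sc: "\<And>c x. x \<in> K \<Longrightarrow> h (c *s x) = c \<odot>\<^bsub>product_algebra {..<r} L\<^esub> h x"
    using h by (auto simp: algebra_iso_def algebra_on_def)
  note hom = ring_iso_mult_add[OF iso, simplified algebra_on_def product_algebra_def, simplified]
  have one: "h \<e> = \<one>\<^bsub>product_algebra {..<r} L\<^esub>" and inj: "inj_on h K"
    using iso by (auto simp: ring_iso_def ring_hom_def algebra_on_def bij_betw_def)
  show thesis
  proof (rule that[of r L h])
    show "subspace K" "\<e> \<in> K" "\<And>x y. x \<in> K \<Longrightarrow> y \<in> K \<Longrightarrow> x \<bullet> y \<in> K"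
      using assms by (auto simp: etale_subalgebra_def subalgebra_def)
    show "x = y" if "x \<in> K" "y \<in> K" "\<And>i. i < r \<Longrightarrow> h x i = h y i" for x y
    proof (rule inj_onD[OF inj])
      show "h x = h y" using hom(3)[OF that(1,1)] hom(3)[OF that(2,2)] that(3)
        by (intro PiE_ext[of _ "{..<r}" "\<lambda>i. carrier (L i)"]) auto
    qed fact+
    show "h x i \<in> carrier (L i)" if "x \<in> K" "i < r" for x i
      using hom(3)[OF that(1,1)] that(2) by (auto simp: PiE_iff)
  qed (use L hom one sc in \<open>simp_all add: product_algebra_def\<close>)
qed

lemma etale_subalgebra_separable:
  assumes et: "etale_subalgebra K" and nuc: "K \<subseteq> nucleus" and fin: finite_dim
  shows "separable_subalgebra scale mul unit K"
proof -
  obtain r :: nat and L :: "nat \<Rightarrow> ('f, 'a) module" and h where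
    K: "subspace K" "\<e> \<in> K" "\<And>x y. x \<in> K \<Longrightarrow> y \<in> K \<Longrightarrow> x \<bullet> y \<in> K"
    and L: "\<And>i. i < r \<Longrightarrow> finite_separable_extension (L i)"
    and add: "\<And>x y i. x \<in> K \<Longrightarrow> y \<in> K \<Longrightarrow> i < r \<Longrightarrow> h (x + y) i = h x i \<oplus>\<^bsub>L i\<^esub> h y i"
    and mult: "\<And>x y i. x \<in> K \<Longrightarrow> y \<in> K \<Longrightarrow> i < r \<Longrightarrow> h (x \<bullet> y) i = h x i \<otimes>\<^bsub>L i\<^esub> h y i"
    and one: "\<And>i. i < r \<Longrightarrow> h \<e> i = \<one>\<^bsub>L i\<^esub>"
    and smult: "\<And>c x i. x \<in> K \<Longrightarrow> i < r \<Longrightarrow> h (c *s x) i = c \<odot>\<^bsub>L i\<^esub> h x i"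
    and closed: "\<And>x i. x \<in> K \<Longrightarrow> i < r \<Longrightarrow> h x i \<in> carrier (L i)"
    and inj: "\<And>x y. x \<in> K \<Longrightarrow> y \<in> K \<Longrightarrow> (\<And>i. i < r \<Longrightarrow> h x i = h y i) \<Longrightarrow> x = y"
  proof (rule etale_subalgebraE[OF et], goal_cases)
    case (1 r L h)
    show ?case by (rule 1(1)) (fact 1)+
  qed
  have field: "field (L i)" if "i < r" for i using L[OF that] by (simp add: finite_separable_extension_def)
  have comm: "x \<bullet> y = y \<bullet> x" if "x \<in> K" "y \<in> K" for x y
  proof (rule inj)
    fix i assume i: "i < r"
    interpret comm_monoid "L i" using field[OF i] by (simp add: field_def domain_def cring_def)
    show "h (x \<bullet> y) i = h (y \<bullet> x) i" using i that by (simp add: mult closed m_comm)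
  qed (use that K in auto)
  have assoc: "(k \<bullet> x) \<bullet> y = k \<bullet> (x \<bullet> y)" "(x \<bullet> k) \<bullet> y = x \<bullet> (k \<bullet> y)" "(x \<bullet> y) \<bullet> k = x \<bullet> (y \<bullet> k)"
    if "k \<in> K" for k x y
    using that nuc unfolding nucleus_def associator_def by auto
  have "\<exists>p. separable_poly p \<and> poly_op p (\<lambda>x. k \<bullet> x) \<e> = 0" if k: "k \<in> K" for k
  proof -
    have "\<exists>p :: 'f poly. Polynomial.lead_coeff p = 1 \<and> Factorial_Ring.irreducible p
        \<and> eval_in (L i) p (h k i) = \<zero>\<^bsub>L i\<^esub> \<and> coprime p (pderiv p)" if "i < r" for i
      using L[OF that] closed[OF k that] by (simp add: finite_separable_extension_def separable_element_def)
    then obtain p :: "nat \<Rightarrow> 'f poly" where p: "\<And>i. i < r \<Longrightarrow> Polynomial.lead_coeff (p i) = 1"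
      "\<And>i. i < r \<Longrightarrow> Factorial_Ring.irreducible (p i)"
      "\<And>i. i < r \<Longrightarrow> eval_in (L i) (p i) (h k i) = \<zero>\<^bsub>L i\<^esub>"
      "\<And>i. i < r \<Longrightarrow> coprime (p i) (pderiv (p i))" by metis
    \<comment> \<open>The product of the distinct minimal polynomials of the coordinates of k: it is
      separable and vanishes at k in every coordinate.\<close>
    define q where "q = \<Prod>(p ` {..<r})"
    have "separable_poly q" unfolding q_def by (rule separable_poly_prod) (use p in auto)
    let ?k = "\<lambda>x. k \<bullet> x"
    have lin: "?k (x + y) = ?k x + ?k y" "?k (c *s x) = c *s ?k x" for x y c
      by (simp_all add: mul_add_right mul_scale_right)
    have pow: "(?k ^^ j) \<e> \<in> K" for j by (induction j) (use K k in auto)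
    have op_K: "poly_op u ?k \<e> \<in> K" for u
      unfolding poly_op_def by (intro subspace_sum subspace_scale K(1) pow)
    have h0: "h 0 i = \<zero>\<^bsub>L i\<^esub>" if i: "i < r" for i
    proof -
      interpret abelian_group "L i" using field[OF i] by (simp add: field_def domain_def cring_def ring_def)
      have "0 \<in> K" using K(1) by (rule subspace_0)
      then have "h 0 i = h 0 i \<oplus>\<^bsub>L i\<^esub> h 0 i" using add[of 0 0 i] i by simp
      then show ?thesis using closed[OF \<open>0 \<in> K\<close> i] by (metis add.l_cancel_one' zero_closed)
    qed
    have h_sum: "h (\<Sum>j\<in>J. f j) i = (\<Oplus>\<^bsub>L i\<^esub>j\<in>J. h (f j) i)"
      if i: "i < r" and "finite J" "\<And>j. j \<in> J \<Longrightarrow> f j \<in> K" for i and f :: "nat \<Rightarrow> 'a" and J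
      using that(2,3)
    proof (induction J rule: finite_induct)
      case empty
      interpret abelian_group "L i"
        using field[OF i] by (simp add: field_def domain_def cring_def ring_def)
      show ?case unfolding sum.empty finsum_empty by (rule h0[OF i])
    next
      case (insert j J)
      interpret abelian_group "L i"
        using field[OF i] by (simp add: field_def domain_def cring_def ring_def)
      show ?case using insert i closed K(1) by (simp add: add subspace_sum Pi_def)
    qed
    have ev: "h (poly_op u ?k \<e>) i = eval_in (L i) u (h k i)" if i: "i < r" for u i
    proof -
      interpret monoid "L i"
        using field[OF i] by (simp add: field_def domain_def cring_def ring_def)
      interpret comm_monoid "L i"
        using field[OF i] by (simp add: field_def domain_def cring_def)
      have hk: "h k i \<in> carrier (L i)" using closed k i by blast
      have "h ((?k ^^ j) \<e>) i = h k i [^]\<^bsub>L i\<^esub> j" for j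
        by (induction j) (use i k pow hk in \<open>simp_all add: one mult m_comm\<close>)
      then show ?thesis
        unfolding poly_op_def eval_in_def using i pow K(1)
        by (subst h_sum) (auto simp: subspace_scale smult)
    qed
    have "poly_op q ?k \<e> = 0"
    proof (rule inj)
      show "poly_op q ?k \<e> \<in> K" by (rule op_K)
      show "0 \<in> K" using K(1) by (rule subspace_0)
      fix i assume i: "i < r"
      have ring: "ring (L i)" using field[OF i] by (simp add: field_def domain_def cring_def)
      define u where "u = \<Prod>(p ` {..<r} - {p i})"
      have q: "q = p i * u" unfolding q_def u_def using i by (intro prod.remove) auto
      \<comment> \<open>Evaluating a polynomial at the left multiplication by k amounts to
        multiplying by its value at the unit. A product of polynomials thus evaluates to a product
        in K, whose i-th coordinate contains a zero factor.\<close>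
      have left: "poly_op v ?k w = poly_op v ?k \<e> \<bullet> w" for v w
      proof -
        have "(?k ^^ j) w = (?k ^^ j) \<e> \<bullet> w" for j
          by (induction j) (simp_all add: unit_left assoc(1)[OF k])
        then have "poly_op v ?k w = (\<Sum>j\<le>Polynomial.degree v. (Polynomial.coeff v j *s (?k ^^ j) \<e>) \<bullet> w)"
          unfolding poly_op_def mul_scale_left by (intro sum.cong) simp_all
        also have "\<dots> = poly_op v ?k \<e> \<bullet> w" unfolding poly_op_def
          by (rule linear_sum[symmetric]) (rule mul_add_left)
        finally show ?thesis .
      qed
      have "h (poly_op q ?k \<e>) i = h (poly_op (p i) ?k \<e>) i \<otimes>\<^bsub>L i\<^esub> h (poly_op u ?k \<e>) i"
      proof -
        have "poly_op q ?k \<e> = poly_op (p i) ?k \<e> \<bullet> poly_op u ?k \<e>"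
          unfolding q poly_op_mult[of ?k, OF lin] by (rule left)
        then show ?thesis using mult[OF op_K op_K i] by simp
      qed
      also have "h (poly_op (p i) ?k \<e>) i = \<zero>\<^bsub>L i\<^esub>" using ev[OF i] p(3)[OF i] by simp
      finally show "h (poly_op q ?k \<e>) i = h 0 i"
        unfolding h0[OF i] ring.ring_simprules(24)[OF ring closed[OF op_K i]] .
    qed
    then show ?thesis using \<open>separable_poly q\<close> by blast
  qed
  moreover have "\<exists>B. finite B \<and> span B = UNIV" using fin by (simp add: finite_dim_def)
  ultimately show ?thesis by unfold_locales (use K comm assoc in auto)
qed

end

theorem proposition3p6:
  fixes scale :: "'f::field \<Rightarrow> 'a::ab_group_add \<Rightarrow> 'a"
    and mul :: "'a \<Rightarrow> 'a \<Rightarrow> 'a"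
    and unit :: 'a
    and n :: nat
    and K' :: "'a set"
  assumes "nonassoc_algebra scale mul unit"
    and "nonassoc_algebra.semiassociative scale mul unit"
    and "nonassoc_algebra.alg_degree scale = real n"
    and "nonassoc_algebra.etale_subalgebra scale mul unit K'"
    and "K' \<subseteq> nonassoc_algebra.nucleus mul"
    and "vector_space.dim scale K' = n"
  shows "nonassoc_algebra.semiassociative_wrt scale mul unit K'"
proof -
  interpret nonassoc_algebra scale mul unit by (rule assms(1))
  obtain K where K: "semiassociative_wrt K" using assms(2) unfolding semiassociative_def by blast
  then have "finite_dim" "central" and K_sep: "separable_subalgebra scale mul unit K"
    and mf: "minimally_faithful (tensor_algebra (algebra_on K) (algebra_on K)) bimodule"
    using etale_subalgebra_separable by (auto simp: semiassociative_wrt_def)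
  have K': "separable_subalgebra scale mul unit K'"
    using assms(4,5) \<open>finite_dim\<close> by (rule etale_subalgebra_separable)
  have "real (dim UNIV) = (real n)\<^sup>2"
    using assms(3) unfolding alg_degree_def by (metis of_nat_0_le_iff real_sqrt_pow2)
  then have "real (dim UNIV) = real ((dim K')\<^sup>2)" using assms(6) by simp
  then have "dim UNIV = (dim K')\<^sup>2" by (simp only: of_nat_eq_iff)
  then have "minimally_faithful (tensor_algebra (algebra_on K') (algebra_on K')) bimodule"
    by (rule separable_subalgebra.minimally_faithful_transfer[OF K_sep mf K'])
  then show ?thesis
    using assms(4,5) \<open>finite_dim\<close> \<open>central\<close> unfolding semiassociative_wrt_def by blast
qed

end
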